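(* $\mathsf{RCA}_0\vdash \forall k\,(\mathsf{AHT}_k\rightarrow\mathsf{IPT}^2_k)$, and $\mathsf{RCA}_0\vdash \mathsf{AHT}\rightarrow\mathsf{IPT}^2$.
   Context: $\mathsf{RCA}_0$ is the usual base system of reverse mathematics in second-order arithmetic; $\mathbf{N}$ denotes its first-order universe, and all principles below are statements in the language of second-order arithmetic. A map into $k$ means a map into $\{0,\dots,k-1\}$. $[\mathbf{N}]^2$ is the set of pairs $(x,y)$ of elements of $\mathbf{N}$ with $x<y$. For a positive integer $n=2^{t_1}+\dots+2^{t_p}$ with $t_1<\dots<t_p$, put $\lambda(n)=t_1$ and $\mu(n)=t_p$. A set $X$ of positive integers satisfies the Apartness Condition if for all $x,x'\in X$ with $x<x'$ we have $\mu(x)<\lambda(x')$. For an infinite set $H=\{h_1<h_2<h_3<\dots\}$, $AS(H)$ denotes the set of all finite sums of distinct adjacent elements of $H$, i.e. all sums $h_i+h_{i+1}+\dots+h_j$ with $i\le j$ (including single elements, $i=j$). $\mathsf{AHT}_k$ (Adjacent Hindman's Theorem for $k$ colors): for every $c:\mathbf{N}\to k$ there exists an infinite set $H$ of positive integers satisfying the Apartness Condition such that all elements of $AS(H)$ have the same $c$-color. $\mathsf{AHT}$ denotes the single sentence $\forall k\,\mathsf{AHT}_k$. $\mathsf{IPT}^2_k$ (Increasing Polarized Ramsey's Theorem for pairs and $k$ colors): for every $f:[\mathbf{N}]^2\to k$ there exist infinite sets $H_1,H_2\subseteq\mathbf{N}$ and a color $c<k$ such that $f(x_1,x_2)=c$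 for all $(x_1,x_2)\in H_1\times H_2$ with $x_1<x_2$. $\mathsf{IPT}^2$ denotes the single sentence $\forall k\,\mathsf{IPT}^2_k$. *)

theory Defs
  imports Main
begin

section \<open>The language of second-order arithmetic\<close>

text \<open>
  Number variables and set variables are two independent families of de Bruijn indices:
  \<open>AllN\<close> binds number variable \<open>0\<close>, \<open>AllS\<close> binds set variable \<open>0\<close>.
  There are no set terms, and equality is primitive for numbers only.
\<close>

datatype tm =
    Var nat
  | Zero (\<open>\<^bold>0\<close>)
  | One (\<open>\<^bold>1\<close>)
  | Add tm tm (infixl \<open>\<^bold>+\<close> 65)
  | Mul tm tm (infixl \<open>\<^bold>*\<close> 70)

datatype fm =
    Eq tm tm (infix \<open>\<^bold>=\<close> 50)
  | Less tm tm (infix \<open>\<^bold><\<close> 50)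
  | Mem tm nat (infix \<open>\<^bold>\<in>\<close> 50)
  | Fls
  | Imp fm fm (infixr \<open>\<^bold>\<longrightarrow>\<close> 25)
  | AllN fm
  | AllS fm

abbreviation Neg :: "fm \<Rightarrow> fm" (\<open>\<^bold>\<not> _\<close> [40] 40) where
  "\<^bold>\<not> p \<equiv> p \<^bold>\<longrightarrow> Fls"

abbreviation And :: "fm \<Rightarrow> fm \<Rightarrow> fm" (infixr \<open>\<^bold>\<and>\<close> 35) where
  "p \<^bold>\<and> q \<equiv> \<^bold>\<not> (p \<^bold>\<longrightarrow> \<^bold>\<not> q)"

abbreviation Or :: "fm \<Rightarrow> fm \<Rightarrow> fm" (infixr \<open>\<^bold>\<or>\<close> 30) where
  "p \<^bold>\<or> q \<equiv> \<^bold>\<not> p \<^bold>\<longrightarrow> q"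

abbreviation Iff :: "fm \<Rightarrow> fm \<Rightarrow> fm" (infixr \<open>\<^bold>\<longleftrightarrow>\<close> 25) where
  "p \<^bold>\<longleftrightarrow> q \<equiv> (p \<^bold>\<longrightarrow> q) \<^bold>\<and> (q \<^bold>\<longrightarrow> p)"

abbreviation ExN :: "fm \<Rightarrow> fm" where
  "ExN p \<equiv> \<^bold>\<not> AllN (\<^bold>\<not> p)"

abbreviation ExS :: "fm \<Rightarrow> fm" where
  "ExS p \<equiv> \<^bold>\<not> AllS (\<^bold>\<not> p)"

abbreviation Le :: "tm \<Rightarrow> tm \<Rightarrow> fm" (infix \<open>\<^bold>\<le>\<close> 50) where
  "s \<^bold>\<le> t \<equiv> s \<^bold>< t \<^bold>\<or> s \<^bold>= t"

subsection \<open>Substitution\<close>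

primrec subst_tm :: "(nat \<Rightarrow> tm) \<Rightarrow> tm \<Rightarrow> tm" where
  "subst_tm \<sigma> (Var n) = \<sigma> n"
| "subst_tm \<sigma> \<^bold>0 = \<^bold>0"
| "subst_tm \<sigma> \<^bold>1 = \<^bold>1"
| "subst_tm \<sigma> (s \<^bold>+ t) = subst_tm \<sigma> s \<^bold>+ subst_tm \<sigma> t"
| "subst_tm \<sigma> (s \<^bold>* t) = subst_tm \<sigma> s \<^bold>* subst_tm \<sigma> t"

abbreviation up :: "tm \<Rightarrow> tm" where
  "up \<equiv> subst_tm (\<lambda>n. Var (Suc n))"

primrec substN :: "(nat \<Rightarrow> tm) \<Rightarrow> fm \<Rightarrow> fm" where
  "substN \<sigma> (s \<^bold>= t) = (subst_tm \<sigma> s \<^bold>= subst_tm \<sigma> t)"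
| "substN \<sigma> (s \<^bold>< t) = (subst_tm \<sigma> s \<^bold>< subst_tm \<sigma> t)"
| "substN \<sigma> (t \<^bold>\<in> X) = (subst_tm \<sigma> t \<^bold>\<in> X)"
| "substN \<sigma> Fls = Fls"
| "substN \<sigma> (p \<^bold>\<longrightarrow> q) = (substN \<sigma> p \<^bold>\<longrightarrow> substN \<sigma> q)"
| "substN \<sigma> (AllN p) = AllN (substN (case_nat (Var 0) (\<lambda>n. up (\<sigma> n))) p)"
| "substN \<sigma> (AllS p) = AllS (substN \<sigma> p)"

primrec substS :: "(nat \<Rightarrow> nat) \<Rightarrow> fm \<Rightarrow> fm" where
  "substS \<rho> (s \<^bold>= t) = (s \<^bold>= t)"
| "substS \<rho> (s \<^bold>< t) = (s \<^bold>< t)"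
| "substS \<rho> (t \<^bold>\<in> X) = (t \<^bold>\<in> \<rho> X)"
| "substS \<rho> Fls = Fls"
| "substS \<rho> (p \<^bold>\<longrightarrow> q) = (substS \<rho> p \<^bold>\<longrightarrow> substS \<rho> q)"
| "substS \<rho> (AllN p) = AllN (substS \<rho> p)"
| "substS \<rho> (AllS p) = AllS (substS (case_nat 0 (\<lambda>n. Suc (\<rho> n))) p)"

abbreviation upN :: "fm \<Rightarrow> fm" where
  "upN \<equiv> substN (\<lambda>n. Var (Suc n))"

abbreviation upS :: "fm \<Rightarrow> fm" where
  "upS \<equiv> substS Suc"

abbreviation instN :: "tm \<Rightarrow> fm \<Rightarrow> fm" where
  "instN t \<equiv> substN (case_nat t Var)"

abbreviation instS :: "nat \<Rightarrow> fm \<Rightarrow> fm" where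
  "instS Y \<equiv> substS (case_nat Y (\<lambda>n. n))"


section \<open>Provability\<close>

text \<open>
  Classical two-sorted natural deduction with equality. Members of the theory \<open>T\<close> may contain
  free variables and stand for their universal closures: the eigenvariable conditions in
  \<open>AllN_I\<close> and \<open>AllS_I\<close> concern the context \<open>\<Gamma>\<close> only.
\<close>

inductive deriv :: "fm set \<Rightarrow> fm list \<Rightarrow> fm \<Rightarrow> bool" for T :: "fm set" where
  Axm: "p \<in> T \<Longrightarrow> deriv T \<Gamma> p"
| Assm: "p \<in> set \<Gamma> \<Longrightarrow> deriv T \<Gamma> p"
| ImpI: "deriv T (p # \<Gamma>) q \<Longrightarrow> deriv T \<Gamma> (p \<^bold>\<longrightarrow> q)"
| ImpE: "deriv T \<Gamma> (p \<^bold>\<longrightarrow> q) \<Longrightarrow> deriv T \<Gamma> p \<Longrightarrow> deriv T \<Gamma> q"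
| Classical: "deriv T ((\<^bold>\<not> p) # \<Gamma>) Fls \<Longrightarrow> deriv T \<Gamma> p"
| AllN_I: "deriv T (map upN \<Gamma>) p \<Longrightarrow> deriv T \<Gamma> (AllN p)"
| AllN_E: "deriv T \<Gamma> (AllN p) \<Longrightarrow> deriv T \<Gamma> (instN t p)"
| AllS_I: "deriv T (map upS \<Gamma>) p \<Longrightarrow> deriv T \<Gamma> (AllS p)"
| AllS_E: "deriv T \<Gamma> (AllS p) \<Longrightarrow> deriv T \<Gamma> (instS Y p)"
| EqI: "deriv T \<Gamma> (t \<^bold>= t)"
| EqE: "deriv T \<Gamma> (s \<^bold>= t) \<Longrightarrow> deriv T \<Gamma> (instN s p) \<Longrightarrow> deriv T \<Gamma> (instN t p)"

definition proves :: "fm set \<Rightarrow> fm \<Rightarrow> bool" (infix \<open>\<turnstile>\<close> 50) where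
  "T \<turnstile> p \<longleftrightarrow> deriv T [] p"


section \<open>The system RCA0\<close>

text \<open>
  Bounded existential quantification is covered through negation. The term bounding a quantifier
  is lifted, so that it does not contain the bound variable.
\<close>

inductive delta0 :: "fm \<Rightarrow> bool" where
  "delta0 (s \<^bold>= t)"
| "delta0 (s \<^bold>< t)"
| "delta0 (t \<^bold>\<in> X)"
| "delta0 Fls"
| "delta0 p \<Longrightarrow> delta0 q \<Longrightarrow> delta0 (p \<^bold>\<longrightarrow> q)"
| "delta0 p \<Longrightarrow> delta0 (AllN (Var 0 \<^bold>< up t \<^bold>\<longrightarrow> p))"

definition sigma1 :: "fm \<Rightarrow> bool" where
  "sigma1 p \<longleftrightarrow> (\<exists>q. delta0 q \<and> p = ExN q)"

definition pi1 :: "fm \<Rightarrow> bool" where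
  "pi1 p \<longleftrightarrow> (\<exists>q. delta0 q \<and> p = AllN q)"

definition basic_axioms :: "fm set" where
  "basic_axioms =
    {\<^bold>\<not> (Var 0 \<^bold>+ \<^bold>1 \<^bold>= \<^bold>0),
     Var 0 \<^bold>+ \<^bold>1 \<^bold>= Var 1 \<^bold>+ \<^bold>1 \<^bold>\<longrightarrow> Var 0 \<^bold>= Var 1,
     Var 0 \<^bold>+ \<^bold>0 \<^bold>= Var 0,
     Var 0 \<^bold>+ (Var 1 \<^bold>+ \<^bold>1) \<^bold>= (Var 0 \<^bold>+ Var 1) \<^bold>+ \<^bold>1,
     Var 0 \<^bold>* \<^bold>0 \<^bold>= \<^bold>0,
     Var 0 \<^bold>* (Var 1 \<^bold>+ \<^bold>1) \<^bold>= (Var 0 \<^bold>* Var 1) \<^bold>+ Var 0,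
     \<^bold>\<not> (Var 0 \<^bold>< \<^bold>0),
     Var 0 \<^bold>< Var 1 \<^bold>+ \<^bold>1 \<^bold>\<longleftrightarrow> Var 0 \<^bold>< Var 1 \<^bold>\<or> Var 0 \<^bold>= Var 1}"

text \<open>In the induction step, number variable \<open>0\<close> is replaced by its successor and no other changes.\<close>

definition induction_axiom :: "fm \<Rightarrow> fm" where
  "induction_axiom p =
    (instN \<^bold>0 p \<^bold>\<and> AllN (p \<^bold>\<longrightarrow> substN (case_nat (Var 0 \<^bold>+ \<^bold>1) (\<lambda>n. Var (Suc n))) p)
      \<^bold>\<longrightarrow> AllN p)"

definition comprehension_axiom :: "fm \<Rightarrow> fm \<Rightarrow> fm" where
  "comprehension_axiom p q =
    (AllN (p \<^bold>\<longleftrightarrow> q) \<^bold>\<longrightarrow> ExS (AllN (Var 0 \<^bold>\<in> 0 \<^bold>\<longleftrightarrow> upS p)))"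

definition RCA0 :: "fm set" where
  "RCA0 = basic_axioms
    \<union> {induction_axiom p | p. sigma1 p}
    \<union> {comprehension_axiom p q | p q. sigma1 p \<and> pi1 q}"


section \<open>Functions and sets inside RCA0\<close>

text \<open>
  In what follows the parameters of a formula are number terms and indices of set variables;
  terms are lifted with \<open>up\<close> under number quantifiers, set indices with \<open>Suc\<close> under set quantifiers.
  The pairing is \<open>(x, y) \<mapsto> (x + y)\<^sup>2 + x\<close>, and functions are sets of pairs.
\<close>

definition pr :: "tm \<Rightarrow> tm \<Rightarrow> tm" where
  "pr s t = (s \<^bold>+ t) \<^bold>* (s \<^bold>+ t) \<^bold>+ s"

definition App :: "nat \<Rightarrow> tm \<Rightarrow> tm \<Rightarrow> fm" where
  "App F s t = (pr s t \<^bold>\<in> F)"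

definition Infinite :: "nat \<Rightarrow> fm" where
  "Infinite X = AllN (ExN (Var 1 \<^bold>< Var 0 \<^bold>\<and> Var 0 \<^bold>\<in> X))"

text \<open>\<open>Fun F\<close>: \<open>F\<close> is a function from \<open>N\<close> to \<open>N\<close>.\<close>

definition Fun :: "nat \<Rightarrow> fm" where
  "Fun F =
    (AllN (Var 0 \<^bold>\<in> F \<^bold>\<longrightarrow> ExN (ExN (Var 2 \<^bold>= pr (Var 1) (Var 0)))) \<^bold>\<and>
     AllN (ExN (App F (Var 1) (Var 0))) \<^bold>\<and>
     AllN (AllN (AllN (App F (Var 2) (Var 1) \<^bold>\<and> App F (Var 2) (Var 0) \<^bold>\<longrightarrow> Var 1 \<^bold>= Var 0))))"

definition Map_into :: "nat \<Rightarrow> tm \<Rightarrow> fm" where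
  "Map_into F k =
    (Fun F \<^bold>\<and> AllN (AllN (App F (Var 1) (Var 0) \<^bold>\<longrightarrow> Var 0 \<^bold>< up (up k))))"

text \<open>\<open>Pair_map_into F k\<close>: \<open>F\<close> is a map from \<open>[N]\<^sup>2\<close> into \<open>k\<close>.\<close>

definition Pair_map_into :: "nat \<Rightarrow> tm \<Rightarrow> fm" where
  "Pair_map_into F k =
    (AllN (Var 0 \<^bold>\<in> F \<^bold>\<longrightarrow>
       ExN (ExN (ExN (Var 2 \<^bold>< Var 1 \<^bold>\<and> Var 0 \<^bold>< up (up (up (up k))) \<^bold>\<and>
         Var 3 \<^bold>= pr (pr (Var 2) (Var 1)) (Var 0))))) \<^bold>\<and>
     AllN (AllN (Var 1 \<^bold>< Var 0 \<^bold>\<longrightarrow> ExN (App F (pr (Var 2) (Var 1)) (Var 0)))) \<^bold>\<and>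
     AllN (AllN (AllN (App F (Var 2) (Var 1) \<^bold>\<and> App F (Var 2) (Var 0) \<^bold>\<longrightarrow> Var 1 \<^bold>= Var 0))))"

text \<open>\<open>Partial_sums s f\<close>: \<open>s\<close> maps \<open>n\<close> to \<open>f(0) + \<dots> + f(n - 1)\<close>.\<close>

definition Partial_sums :: "nat \<Rightarrow> nat \<Rightarrow> fm" where
  "Partial_sums s f =
    (Fun s \<^bold>\<and> App s \<^bold>0 \<^bold>0 \<^bold>\<and>
     AllN (AllN (AllN (App s (Var 2) (Var 1) \<^bold>\<and> App f (Var 2) (Var 0) \<^bold>\<longrightarrow>
       App s (Var 2 \<^bold>+ \<^bold>1) (Var 1 \<^bold>+ Var 0)))))"


section \<open>The Apartness Condition\<close>

text \<open>\<open>Pow2 x y\<close>: \<open>2\<^sup>x = y\<close>, as witnessed by the exponential function.\<close>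

definition Pow2 :: "tm \<Rightarrow> tm \<Rightarrow> fm" where
  "Pow2 x y =
    ExS (Fun 0 \<^bold>\<and> App 0 \<^bold>0 \<^bold>1 \<^bold>\<and>
      AllN (AllN (App 0 (Var 1) (Var 0) \<^bold>\<longrightarrow> App 0 (Var 1 \<^bold>+ \<^bold>1) (Var 0 \<^bold>+ Var 0))) \<^bold>\<and>
      App 0 x y)"

text \<open>
  \<open>Binary n p t\<close>: \<open>n\<close> is the sum of the powers of 2 with exponents \<open>t(0) < \<dots> < t(p - 1)\<close>,
  where \<open>p > 0\<close>. The function \<open>t\<close> is total, but its values from \<open>p\<close> on are irrelevant. Inside the
  set quantifiers, set variable \<open>1\<close> lists the powers and set variable \<open>0\<close> their partial sums.
\<close>

definition Binary :: "tm \<Rightarrow> tm \<Rightarrow> nat \<Rightarrow> fm" where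
  "Binary n p t =
    (\<^bold>0 \<^bold>< p \<^bold>\<and> Fun t \<^bold>\<and>
     AllN (AllN (AllN (AllN (Var 3 \<^bold>< Var 2 \<^bold>\<and> Var 2 \<^bold>< up (up (up (up p))) \<^bold>\<and>
       App t (Var 3) (Var 1) \<^bold>\<and> App t (Var 2) (Var 0) \<^bold>\<longrightarrow> Var 1 \<^bold>< Var 0)))) \<^bold>\<and>
     ExS (ExS (Fun 1 \<^bold>\<and>
       AllN (AllN (AllN (Var 2 \<^bold>< up (up (up p)) \<^bold>\<and>
         App (Suc (Suc t)) (Var 2) (Var 1) \<^bold>\<and> App 1 (Var 2) (Var 0) \<^bold>\<longrightarrow> Pow2 (Var 1) (Var 0)))) \<^bold>\<and>
       Partial_sums 0 1 \<^bold>\<and> App 0 p n)))"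

text \<open>\<open>Lambda n a\<close> and \<open>Mu n a\<close>: the least, resp. greatest, exponent in \<open>n\<close> is \<open>a\<close>.\<close>

definition Lambda :: "tm \<Rightarrow> tm \<Rightarrow> fm" where
  "Lambda n a = ExS (ExN (Binary (up n) (Var 0) 0 \<^bold>\<and> App 0 \<^bold>0 (up a)))"

definition Mu :: "tm \<Rightarrow> tm \<Rightarrow> fm" where
  "Mu n a = ExS (ExN (Binary (up n) (Var 0 \<^bold>+ \<^bold>1) 0 \<^bold>\<and> App 0 (Var 0) (up a)))"

definition Apart :: "nat \<Rightarrow> fm" where
  "Apart X =
    AllN (AllN (Var 1 \<^bold>\<in> X \<^bold>\<and> Var 0 \<^bold>\<in> X \<^bold>\<and> Var 1 \<^bold>< Var 0 \<^bold>\<longrightarrow>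
      ExN (ExN (Mu (Var 3) (Var 1) \<^bold>\<and> Lambda (Var 2) (Var 0) \<^bold>\<and> Var 1 \<^bold>< Var 0))))"


section \<open>The combinatorial principles\<close>

text \<open>\<open>Enumerates h H\<close>: \<open>H = {h(0) < h(1) < h(2) < \<dots>}\<close>.\<close>

definition Enumerates :: "nat \<Rightarrow> nat \<Rightarrow> fm" where
  "Enumerates h H =
    (Fun h \<^bold>\<and>
     AllN (AllN (AllN (AllN (Var 3 \<^bold>< Var 2 \<^bold>\<and>
       App h (Var 3) (Var 1) \<^bold>\<and> App h (Var 2) (Var 0) \<^bold>\<longrightarrow> Var 1 \<^bold>< Var 0)))) \<^bold>\<and>
     AllN (Var 0 \<^bold>\<in> H \<^bold>\<longleftrightarrow> ExN (App h (Var 0) (Var 1))))"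

text \<open>
  \<open>AS H z\<close>: \<open>z = h(i) + \<dots> + h(j)\<close> for some \<open>i \<le> j\<close>, where \<open>h\<close> enumerates \<open>H\<close>. The sum is
  expressed by \<open>s(j + 1) = s(i) + z\<close>, where \<open>s\<close> is the function of partial sums of \<open>h\<close>. Inside the
  quantifiers, set variables \<open>1\<close>, \<open>0\<close> are \<open>h\<close>, \<open>s\<close> and number variables \<open>2\<close>, \<open>1\<close>, \<open>0\<close> are
  \<open>i\<close>, \<open>j\<close>, \<open>s(i)\<close>.
\<close>

definition AS :: "nat \<Rightarrow> tm \<Rightarrow> fm" where
  "AS H z =
    ExS (ExS (Enumerates 1 (Suc (Suc H)) \<^bold>\<and> Partial_sums 0 1 \<^bold>\<and>
      ExN (ExN (ExN (Var 2 \<^bold>\<le> Var 1 \<^bold>\<and> App 0 (Var 2) (Var 0) \<^bold>\<and>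
        App 0 (Var 1 \<^bold>+ \<^bold>1) (Var 0 \<^bold>+ up (up (up z))))))))"

text \<open>Set variable \<open>1\<close> is the colouring and set variable \<open>0\<close> is \<open>H\<close>.\<close>

definition AHT_k :: "tm \<Rightarrow> fm" where
  "AHT_k k =
    AllS (Map_into 0 k \<^bold>\<longrightarrow>
      ExS (Infinite 0 \<^bold>\<and> AllN (Var 0 \<^bold>\<in> 0 \<^bold>\<longrightarrow> \<^bold>0 \<^bold>< Var 0) \<^bold>\<and> Apart 0 \<^bold>\<and>
        ExN (AllN (AS 0 (Var 0) \<^bold>\<longrightarrow> App 1 (Var 0) (Var 1)))))"

definition AHT :: fm where
  "AHT = AllN (AHT_k (Var 0))"

text \<open>Set variables \<open>2\<close>, \<open>1\<close>, \<open>0\<close> are the colouring and the two infinite sets, in this order.\<close>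

definition IPT2_k :: "tm \<Rightarrow> fm" where
  "IPT2_k k =
    AllS (Pair_map_into 0 k \<^bold>\<longrightarrow>
      ExS (ExS (Infinite 1 \<^bold>\<and> Infinite 0 \<^bold>\<and>
        ExN (Var 0 \<^bold>< up k \<^bold>\<and>
          AllN (AllN (Var 1 \<^bold>\<in> 1 \<^bold>\<and> Var 0 \<^bold>\<in> 0 \<^bold>\<and> Var 1 \<^bold>< Var 0 \<^bold>\<longrightarrow>
            App 2 (pr (Var 1) (Var 0)) (Var 2)))))))"

definition IPT2 :: fm where
  "IPT2 = AllN (IPT2_k (Var 0))"

end

theory Submission
  imports Defs "HOL-Library.Countable_Set"
begin

text \<open>
  By completeness it suffices to argue inside an arbitrary model of RCA0. Given \<open>f\<close>, colour \<open>n\<close>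
  with \<open>f (\<lambda>(n), \<mu>(n))\<close>. By apartness, the sum \<open>h\<^sub>i + \<dots> + h\<^sub>j\<close> of adjacent elements of the
  homogeneous set has least exponent \<open>\<lambda>(h\<^sub>i)\<close> and greatest exponent \<open>\<mu>(h\<^sub>j)\<close>, so the sets of all
  \<open>\<lambda>(h\<^sub>i)\<close> and of all \<open>\<mu>(h\<^sub>j)\<close> are as required.

  The formula \<open>AS\<close> refers to the enumeration of \<open>H\<close> and to its partial sums, which must be shown to
  exist by primitive recursion. Finite sequences are coded by binary expansions for this purpose.
  That the exponential function exists is not proved from RCA0: an apart set comes with
  a witness for \<open>Mu\<close>, and this contains the exponential function, so a first application of the
  hypothesis, to a constant colouring, provides it.
\<close>

section \<open>Substitution\<close>

text \<open>The colouring must be a set of the model, hence \<Delta>1 in sets already present,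
  whereas the formulas \<open>Lambda\<close> and \<open>Mu\<close> quantify over sets. Once a
  function \<open>ex\<close> with the values \<open>2^a\<close> is fixed, exponents can be read off
  by bounded search: \<open>a\<close> is the least exponent of \<open>n\<close> iff \<open>n\<close>
  is an odd multiple of \<open>ex a\<close>, and \<open>b\<close> is the greatest iff
  \<open>ex b \<le> n < 2 * ex b\<close>. Therefore \<open>ex\<close> has to be found before the
  colouring can be defined, and both applications of the hypothesis are made for the same
  \<open>k\<close>. Recursion is carried out only for steps that never decrease the value. The pairs
  of argument and value then have increasing codes, so that a computation is prolonged by a new
  leading binary digit and no carry can destroy its earlier part. Enumerations and partial sums are
  of this kind.\<close>

abbreviation liftN :: "(nat \<Rightarrow> tm) \<Rightarrow> nat \<Rightarrow> tm" where
  "liftN \<sigma> \<equiv> case_nat (Var 0) (\<lambda>n. up (\<sigma> n))"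

abbreviation liftS :: "(nat \<Rightarrow> nat) \<Rightarrow> nat \<Rightarrow> nat" where
  "liftS \<rho> \<equiv> case_nat 0 (\<lambda>n. Suc (\<rho> n))"

lemma subst_tm_comp: "subst_tm \<sigma> (subst_tm \<tau> t) = subst_tm (\<lambda>n. subst_tm \<sigma> (\<tau> n)) t"
  by (induction t) auto

lemma subst_tm_Var [simp]: "subst_tm Var t = t"
  by (induction t) auto

lemma liftN_comp: "(\<lambda>n. subst_tm (liftN \<sigma>) (liftN \<tau> n)) = liftN (\<lambda>n. subst_tm \<sigma> (\<tau> n))"
  by (auto simp: fun_eq_iff subst_tm_comp split: nat.split)

lemma substN_comp: "substN \<sigma> (substN \<tau> p) = substN (\<lambda>n. subst_tm \<sigma> (\<tau> n)) p"
  by (induction p arbitrary: \<sigma> \<tau>) (auto simp: subst_tm_comp liftN_comp)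

lemma liftN_Var [simp]: "liftN Var = Var"
  by (auto simp: fun_eq_iff split: nat.split)

lemma substN_Var [simp]: "substN Var p = p"
  by (induction p) (simp_all add: liftN_Var[simplified])

lemma liftS_comp: "(\<lambda>n. liftS \<rho> (liftS \<rho>' n)) = liftS (\<lambda>n. \<rho> (\<rho>' n))"
  by (auto simp: fun_eq_iff split: nat.split)

lemma substS_comp: "substS \<rho> (substS \<rho>' p) = substS (\<lambda>n. \<rho> (\<rho>' n)) p"
  by (induction p arbitrary: \<rho> \<rho>') (auto simp: liftS_comp)

lemma liftS_id [simp]: "liftS (\<lambda>n. n) = (\<lambda>n. n)"
  by (auto simp: fun_eq_iff split: nat.split)

lemma substS_id [simp]: "substS (\<lambda>n. n) p = p"
  by (induction p) simp_all

lemma substN_substS: "substN \<sigma> (substS \<rho> p) = substS \<rho> (substN \<sigma> p)"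
  by (induction p arbitrary: \<sigma> \<rho>) auto

lemma instN_substN: "instN t (substN (liftN \<sigma>) p) = substN (case_nat t \<sigma>) p"
proof -
  have "(\<lambda>n. subst_tm (case_nat t Var) (liftN \<sigma> n)) = case_nat t \<sigma>"
    by (auto simp: fun_eq_iff subst_tm_comp split: nat.split)
  then show ?thesis by (simp add: substN_comp)
qed

lemma instS_substS: "instS Y (substS (liftS \<rho>) p) = substS (case_nat Y \<rho>) p"
proof -
  have "(\<lambda>n. case_nat Y (\<lambda>n. n) (liftS \<rho> n)) = case_nat Y \<rho>"
    by (auto simp: fun_eq_iff split: nat.split)
  then show ?thesis by (simp add: substS_comp)
qed

lemma substN_instN: "substN \<sigma> (instN t p) = instN (subst_tm \<sigma> t) (substN (liftN \<sigma>) p)"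
proof -
  have "(\<lambda>n. subst_tm \<sigma> (case_nat t Var n)) = case_nat (subst_tm \<sigma> t) \<sigma>"
    by (auto simp: fun_eq_iff split: nat.split)
  then show ?thesis unfolding instN_substN by (simp add: substN_comp)
qed

lemma substS_instS: "substS \<rho> (instS Y p) = instS (\<rho> Y) (substS (liftS \<rho>) p)"
proof -
  have "(\<lambda>n. \<rho> (case_nat Y (\<lambda>n. n) n)) = case_nat (\<rho> Y) \<rho>"
    by (auto simp: fun_eq_iff split: nat.split)
  then show ?thesis unfolding instS_substS by (simp add: substS_comp)
qed

lemma substN_upN: "substN (liftN \<sigma>) (upN p) = upN (substN \<sigma> p)"
  by (simp add: substN_comp)

lemma substS_upS: "substS (liftS \<rho>) (upS p) = upS (substS \<rho> p)"
  by (simp add: substS_comp)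

text \<open>The case of two subterms or subformulas in the support lemmas below: the larger of the
  two bounds serves both.\<close>

lemma finite_support_conj:
  fixes P Q :: "(nat \<Rightarrow> 'a) \<Rightarrow> (nat \<Rightarrow> 'a) \<Rightarrow> bool"
  assumes "\<exists>m::nat. \<forall>\<sigma> \<tau>. (\<forall>n<m. \<sigma> n = \<tau> n) \<longrightarrow> P \<sigma> \<tau>"
    and "\<exists>m::nat. \<forall>\<sigma> \<tau>. (\<forall>n<m. \<sigma> n = \<tau> n) \<longrightarrow> Q \<sigma> \<tau>"
  shows "\<exists>m::nat. \<forall>\<sigma> \<tau>. (\<forall>n<m. \<sigma> n = \<tau> n) \<longrightarrow> P \<sigma> \<tau> \<and> Q \<sigma> \<tau>"
proof -
  obtain a b where a: "\<And>\<sigma> \<tau>. \<forall>n<a. \<sigma> n = \<tau> n \<Longrightarrow> P \<sigma> \<tau>" and b: "\<And>\<sigma> \<tau>. \<forall>n<b. \<sigma> n = \<tau> n \<Longrightarrow> Q \<sigma> \<tau>"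
    using assms by blast
  show ?thesis
  proof (intro exI[of _ "max a b"] allI impI conjI)
    fix \<sigma> \<tau> :: "nat \<Rightarrow> 'a" assume "\<forall>n<max a b. \<sigma> n = \<tau> n"
    then show "P \<sigma> \<tau>" "Q \<sigma> \<tau>" by (auto intro!: a b)
  qed
qed

lemma tm_finite_support: "\<exists>m. \<forall>\<sigma> \<tau>. (\<forall>n<m. \<sigma> n = \<tau> n) \<longrightarrow> subst_tm \<sigma> t = subst_tm \<tau> t"
proof (induction t)
  case (Var x)
  then show ?case by (auto intro: exI[of _ "Suc x"])
next
  case (Add s t)
  show ?case using finite_support_conj[OF Add] by simp
next
  case (Mul s t)
  show ?case using finite_support_conj[OF Mul] by simp
qed auto

text \<open>Any variable from the bound on is fresh for the formula; Henkin witnesses are chosen in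
  this way. Under a quantifier the same bound still works, since lifting only shifts variables
  upwards.\<close>

lemma substN_finite_support: "\<exists>m. \<forall>\<sigma> \<tau>. (\<forall>n<m. \<sigma> n = \<tau> n) \<longrightarrow> substN \<sigma> p = substN \<tau> p"
proof (induction p)
  case (Eq s t)
  show ?case using finite_support_conj[OF tm_finite_support tm_finite_support] by simp
next
  case (Less s t)
  show ?case using finite_support_conj[OF tm_finite_support tm_finite_support] by simp
next
  case (Mem t X)
  show ?case using tm_finite_support by simp
next
  case (Imp p q)
  show ?case using finite_support_conj[OF Imp] by simp
next
  case (AllN p)
  then obtain a where a: "\<And>\<sigma> \<tau>. \<forall>n<a. \<sigma> n = \<tau> n \<Longrightarrow> substN \<sigma> p = substN \<tau> p" by blast
  show ?case
  proof (intro exI[of _ a] allI impI)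
    fix \<sigma> \<tau> :: "nat \<Rightarrow> tm"
    assume "\<forall>n<a. \<sigma> n = \<tau> n"
    then have "\<forall>n<a. liftN \<sigma> n = liftN \<tau> n" by (auto split: nat.split)
    from a[OF this] show "substN \<sigma> (AllN p) = substN \<tau> (AllN p)" by simp
  qed
qed auto

lemma substS_finite_support: "\<exists>m. \<forall>\<rho> \<rho>'. (\<forall>n<m. \<rho> n = \<rho>' n) \<longrightarrow> substS \<rho> p = substS \<rho>' p"
proof (induction p)
  case (Mem t X)
  then show ?case by (auto intro: exI[of _ "Suc X"])
next
  case (Imp p q)
  show ?case using finite_support_conj[OF Imp] by simp
next
  case (AllS p)
  then obtain a where a: "\<And>\<rho> \<rho>'. \<forall>n<a. \<rho> n = \<rho>' n \<Longrightarrow> substS \<rho> p = substS \<rho>' p" by blast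
  show ?case
  proof (intro exI[of _ a] allI impI)
    fix \<rho> \<rho>' :: "nat \<Rightarrow> nat"
    assume "\<forall>n<a. \<rho> n = \<rho>' n"
    then have "\<forall>n<a. liftS \<rho> n = liftS \<rho>' n" by (auto split: nat.split)
    from a[OF this] show "substS \<rho> (AllS p) = substS \<rho>' (AllS p)" by simp
  qed
qed auto

section \<open>Completeness\<close>

text \<open>Contexts are lists, but the rules look only at their elements, so inclusion of the
  underlying sets covers weakening, exchange and contraction.\<close>

lemma deriv_weaken: "deriv T \<Gamma> p \<Longrightarrow> set \<Gamma> \<subseteq> set \<Delta> \<Longrightarrow> deriv T \<Delta> p"
proof (induction arbitrary: \<Delta> rule: deriv.induct)
  case (ImpI p \<Gamma> q)
  have "deriv T (p # \<Delta>) q" using ImpI.prems by (intro ImpI.IH) auto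
  then show ?case by (rule deriv.ImpI)
next
  case (ImpE \<Gamma> p q)
  then show ?case by (blast intro: deriv.ImpE)
next
  case (Classical p \<Gamma>)
  have "deriv T ((\<^bold>\<not> p) # \<Delta>) Fls" using Classical.prems by (intro Classical.IH) auto
  then show ?case by (rule deriv.Classical)
next
  case (AllN_I \<Gamma> p)
  have "deriv T (map upN \<Delta>) p" using AllN_I.prems by (intro AllN_I.IH) auto
  then show ?case by (rule deriv.AllN_I)
next
  case (AllS_I \<Gamma> p)
  have "deriv T (map upS \<Delta>) p" using AllS_I.prems by (intro AllS_I.IH) auto
  then show ?case by (rule deriv.AllS_I)
next
  case (EqE \<Gamma> s t p)
  show ?case using EqE.IH(1)[OF EqE.prems] EqE.IH(2)[OF EqE.prems] by (rule deriv.EqE)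
qed (auto intro: deriv.intros)

text \<open>The rule \<open>Axm\<close> inserts an axiom with its free variables untouched. A
  derivation can therefore be substituted into only if the substitution instances of the axioms are
  derivable as well.\<close>

locale substitutive =
  fixes T :: "fm set"
  assumes instance_derivable: "p \<in> T \<Longrightarrow> deriv T [] (substN \<sigma> (substS \<rho> p))"
begin

lemma deriv_substN: "deriv T \<Gamma> p \<Longrightarrow> deriv T (map (substN \<sigma>) \<Gamma>) (substN \<sigma> p)"
proof (induction arbitrary: \<sigma> rule: deriv.induct)
  case (Axm p \<Gamma>)
  have "deriv T [] (substN \<sigma> p)" using instance_derivable[OF Axm, of \<sigma> "\<lambda>n. n"] by simp
  then show ?case by (rule deriv_weaken) simp
next
  case (AllN_I \<Gamma> p)
  have "deriv T (map upN (map (substN \<sigma>) \<Gamma>)) (substN (liftN \<sigma>) p)"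
    using AllN_I.IH[of "liftN \<sigma>"] by (simp add: substN_upN comp_def)
  then show ?case by (auto intro: deriv.AllN_I)
next
  case (AllN_E \<Gamma> p t)
  have "deriv T (map (substN \<sigma>) \<Gamma>) (AllN (substN (liftN \<sigma>) p))" using AllN_E.IH by simp
  then show ?case unfolding substN_instN by (rule deriv.AllN_E)
next
  case (AllS_I \<Gamma> p)
  have "deriv T (map upS (map (substN \<sigma>) \<Gamma>)) (substN \<sigma> p)"
    using AllS_I.IH[of \<sigma>] by (simp add: substN_substS comp_def)
  then show ?case by (auto intro: deriv.AllS_I)
next
  case (AllS_E \<Gamma> p Y)
  have "deriv T (map (substN \<sigma>) \<Gamma>) (AllS (substN \<sigma> p))" using AllS_E.IH by simp
  then show ?case unfolding substN_substS by (rule deriv.AllS_E)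
next
  case (EqE \<Gamma> s t p)
  have "deriv T (map (substN \<sigma>) \<Gamma>) (subst_tm \<sigma> s \<^bold>= subst_tm \<sigma> t)" using EqE.IH(1) by simp
  moreover have "deriv T (map (substN \<sigma>) \<Gamma>) (instN (subst_tm \<sigma> s) (substN (liftN \<sigma>) p))"
    using EqE.IH(2) by (simp only: substN_instN)
  ultimately show ?case unfolding substN_instN by (rule deriv.EqE)
next
  case (ImpI p \<Gamma> q)
  then show ?case by (auto intro: deriv.ImpI)
next
  case (ImpE \<Gamma> p q)
  show ?case using ImpE.IH(1)[of \<sigma>] ImpE.IH(2)[of \<sigma>] by (auto intro: deriv.ImpE)
next
  case (Classical p \<Gamma>)
  then show ?case by (auto intro: deriv.Classical)
qed (auto intro: deriv.intros)

lemma deriv_substS: "deriv T \<Gamma> p \<Longrightarrow> deriv T (map (substS \<rho>) \<Gamma>) (substS \<rho> p)"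
proof (induction arbitrary: \<rho> rule: deriv.induct)
  case (Axm p \<Gamma>)
  have "deriv T [] (substS \<rho> p)" using instance_derivable[OF Axm, of Var \<rho>] by simp
  then show ?case by (rule deriv_weaken) simp
next
  case (AllN_I \<Gamma> p)
  have "deriv T (map upN (map (substS \<rho>) \<Gamma>)) (substS \<rho> p)"
    using AllN_I.IH[of \<rho>] by (simp add: substN_substS comp_def)
  then show ?case by (auto intro: deriv.AllN_I)
next
  case (AllN_E \<Gamma> p t)
  have "deriv T (map (substS \<rho>) \<Gamma>) (AllN (substS \<rho> p))" using AllN_E.IH by simp
  then show ?case unfolding substN_substS[symmetric] by (rule deriv.AllN_E)
next
  case (AllS_I \<Gamma> p)
  have "deriv T (map upS (map (substS \<rho>) \<Gamma>)) (substS (liftS \<rho>) p)"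
    using AllS_I.IH[of "liftS \<rho>"] by (simp add: substS_upS comp_def)
  then show ?case by (auto intro: deriv.AllS_I)
next
  case (AllS_E \<Gamma> p Y)
  have "deriv T (map (substS \<rho>) \<Gamma>) (AllS (substS (liftS \<rho>) p))" using AllS_E.IH by simp
  then show ?case unfolding substS_instS by (rule deriv.AllS_E)
next
  case (EqE \<Gamma> s t p)
  have "deriv T (map (substS \<rho>) \<Gamma>) (s \<^bold>= t)" using EqE.IH(1)[of \<rho>] by simp
  moreover have "deriv T (map (substS \<rho>) \<Gamma>) (instN s (substS \<rho> p))"
    using EqE.IH(2)[of \<rho>] by (simp add: substN_substS)
  ultimately show ?case unfolding substN_substS[symmetric] by (rule deriv.EqE)
next
  case (ImpI p \<Gamma> q)
  then show ?case by (auto intro: deriv.ImpI)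
next
  case (ImpE \<Gamma> p q)
  show ?case using ImpE.IH(1)[of \<rho>] ImpE.IH(2)[of \<rho>] by (auto intro: deriv.ImpE)
next
  case (Classical p \<Gamma>)
  then show ?case by (auto intro: deriv.Classical)
qed (auto intro: deriv.intros)

section \<open>Consistent contexts and their Henkin extensions\<close>

definition consistent :: "fm list \<Rightarrow> bool" where
  "consistent \<Gamma> \<longleftrightarrow> \<not> deriv T \<Gamma> Fls"

lemma list_support:
  assumes "\<And>p. \<exists>m::nat. \<forall>\<sigma> \<tau>. (\<forall>n<m. \<sigma> n = \<tau> n) \<longrightarrow> S \<sigma> p = S \<tau> p"
  shows "\<exists>m. \<forall>p\<in>set ps. \<forall>\<sigma> \<tau>. (\<forall>n<m. \<sigma> n = \<tau> n) \<longrightarrow> S \<sigma> p = S \<tau> p"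
proof (induction ps)
  case (Cons p ps)
  obtain a where "\<forall>\<sigma> \<tau>. (\<forall>n<a. \<sigma> n = \<tau> n) \<longrightarrow> S \<sigma> p = S \<tau> p" using assms by blast
  moreover obtain b where "\<forall>p\<in>set ps. \<forall>\<sigma> \<tau>. (\<forall>n<b. \<sigma> n = \<tau> n) \<longrightarrow> S \<sigma> p = S \<tau> p"
    using Cons by blast
  ultimately have "\<forall>q\<in>set (p # ps). \<forall>\<sigma> \<tau>. (\<forall>n<max a b. \<sigma> n = \<tau> n) \<longrightarrow> S \<sigma> q = S \<tau> q"
    by simp
  then show ?case by blast
qed simp

text \<open>The eigenvariable form of universal introduction. \<open>AllN_I\<close> works with
  lifted contexts instead, so the fresh variable is turned into the bound one by substituting into
  the derivation.\<close>

lemma generalize_fresh_N: "\<exists>m. deriv T \<Gamma> (instN (Var m) q) \<longrightarrow> deriv T \<Gamma> (AllN q)"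
proof -
  obtain m where m': "\<forall>p\<in>set (q # \<Gamma>). \<forall>\<sigma> \<tau>. (\<forall>n<m. \<sigma> n = \<tau> n) \<longrightarrow> substN \<sigma> p = substN \<tau> p"
    using list_support[where S = substN, OF substN_finite_support] ..
  have m: "substN \<sigma> p = substN \<tau> p" if "p \<in> set (q # \<Gamma>)" "\<And>n. n < m \<Longrightarrow> \<sigma> n = \<tau> n" for p \<sigma> \<tau>
    using m'[rule_format, OF that] .
  \<comment> \<open>Renames the fresh \<open>m\<close> to \<open>0\<close> and shifts the others.
    Below \<open>m\<close>, where the variables of the context lie, this is the lifting
    \<open>upN\<close>.\<close>
  define \<sigma> where "\<sigma> = (\<lambda>n. if n = m then Var 0 else Var (Suc n))"
  have "map (substN \<sigma>) \<Gamma> = map upN \<Gamma>"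
  proof (rule map_cong[OF refl])
    fix p assume "p \<in> set \<Gamma>"
    then show "substN \<sigma> p = upN p" by (intro m) (auto simp: \<sigma>_def)
  qed
  moreover have "substN \<sigma> (instN (Var m) q) = q"
  proof -
    have "substN \<sigma> (instN (Var m) q) = substN (case_nat (Var 0) \<sigma>) q"
      unfolding substN_instN instN_substN by (simp add: \<sigma>_def)
    also have "\<dots> = substN Var q" by (intro m) (auto simp: \<sigma>_def split: nat.split)
    finally show ?thesis by simp
  qed
  ultimately have "deriv T \<Gamma> (instN (Var m) q) \<longrightarrow> deriv T \<Gamma> (AllN q)"
    using deriv_substN[of \<Gamma> "instN (Var m) q" \<sigma>] AllN_I by metis
  then show ?thesis ..
qed

lemma generalize_fresh_S: "\<exists>m. deriv T \<Gamma> (instS m q) \<longrightarrow> deriv T \<Gamma> (AllS q)"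
proof -
  obtain m where m': "\<forall>p\<in>set (q # \<Gamma>). \<forall>\<rho> \<rho>'. (\<forall>n<m. \<rho> n = \<rho>' n) \<longrightarrow> substS \<rho> p = substS \<rho>' p"
    using list_support[where S = substS, OF substS_finite_support] ..
  have m: "substS \<rho> p = substS \<rho>' p" if "p \<in> set (q # \<Gamma>)" "\<And>n. n < m \<Longrightarrow> \<rho> n = \<rho>' n" for p \<rho> \<rho>'
    using m'[rule_format, OF that] .
  define \<rho> where "\<rho> = (\<lambda>n. if n = m then 0 else Suc n)"
  have "map (substS \<rho>) \<Gamma> = map upS \<Gamma>"
  proof (rule map_cong[OF refl])
    fix p assume "p \<in> set \<Gamma>"
    then show "substS \<rho> p = upS p" by (intro m) (auto simp: \<rho>_def)
  qed
  moreover have "substS \<rho> (instS m q) = q"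
  proof -
    have "substS \<rho> (instS m q) = substS (case_nat 0 \<rho>) q"
      unfolding substS_instS instS_substS by (simp add: \<rho>_def)
    also have "\<dots> = substS (\<lambda>n. n) q" by (intro m) (auto simp: \<rho>_def split: nat.split)
    finally show ?thesis by simp
  qed
  ultimately have "deriv T \<Gamma> (instS m q) \<longrightarrow> deriv T \<Gamma> (AllS q)"
    using deriv_substS[of \<Gamma> "instS m q" \<rho>] AllS_I by metis
  then show ?thesis ..
qed

text \<open>If the negation of \<open>p\<close> led to a contradiction, \<open>p\<close> would be
  derivable classically, and hence \<open>A\<close>, whose negation is in the context. In use,
  \<open>A\<close> is a universal formula and \<open>p\<close> its instance at a fresh
  variable.\<close>

lemma consistent_add_counterexample:
  assumes "consistent \<Gamma>" "(\<^bold>\<not> A) \<in> set \<Gamma>" "deriv T \<Gamma> p \<longrightarrow> deriv T \<Gamma> A"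
  shows "consistent ((\<^bold>\<not> p) # \<Gamma>)"
  unfolding consistent_def
proof
  assume "deriv T ((\<^bold>\<not> p) # \<Gamma>) Fls"
  then have "deriv T \<Gamma> A" using assms(3) Classical by blast
  then show False using assms(1) ImpE[OF Assm[OF assms(2)]] unfolding consistent_def by blast
qed

text \<open>One stage of the Lindenbaum construction with Henkin witnesses built in:
  \<open>\<phi>\<close> is added if this is consistent, and a negated universal formula is added
  together with a counterexample.\<close>

lemma extension_step:
  assumes "consistent \<Gamma>"
  shows "\<exists>\<Delta>. set \<Gamma> \<subseteq> set \<Delta> \<and> consistent \<Delta> \<and> (\<phi> \<in> set \<Delta> \<or> \<not> consistent (\<phi> # \<Gamma>)) \<and>
    (\<forall>q. \<phi> = (\<^bold>\<not> AllN q) \<and> \<phi> \<in> set \<Delta> \<longrightarrow> (\<exists>t. (\<^bold>\<not> instN t q) \<in> set \<Delta>)) \<and>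
    (\<forall>q. \<phi> = (\<^bold>\<not> AllS q) \<and> \<phi> \<in> set \<Delta> \<longrightarrow> (\<exists>Y. (\<^bold>\<not> instS Y q) \<in> set \<Delta>))"
proof (cases "consistent (\<phi> # \<Gamma>)")
  case True
  consider q where "\<phi> = (\<^bold>\<not> AllN q)" | q where "\<phi> = (\<^bold>\<not> AllS q)"
    | "\<forall>q. \<phi> \<noteq> (\<^bold>\<not> AllN q) \<and> \<phi> \<noteq> (\<^bold>\<not> AllS q)" by blast
  then show ?thesis
  proof cases
    case 1
    obtain m where m: "deriv T (\<phi> # \<Gamma>) (instN (Var m) q) \<longrightarrow> deriv T (\<phi> # \<Gamma>) (AllN q)"
      using generalize_fresh_N by blast
    have "consistent ((\<^bold>\<not> instN (Var m) q) # \<phi> # \<Gamma>)"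
      by (intro consistent_add_counterexample[OF True, of "AllN q"]) (use m in \<open>simp_all add: 1\<close>)
    then show ?thesis using 1 by (intro exI[of _ "(\<^bold>\<not> instN (Var m) q) # \<phi> # \<Gamma>"]) auto
  next
    case 2
    obtain m where m: "deriv T (\<phi> # \<Gamma>) (instS m q) \<longrightarrow> deriv T (\<phi> # \<Gamma>) (AllS q)"
      using generalize_fresh_S by blast
    have "consistent ((\<^bold>\<not> instS m q) # \<phi> # \<Gamma>)"
      by (intro consistent_add_counterexample[OF True, of "AllS q"]) (use m in \<open>simp_all add: 2\<close>)
    then show ?thesis using 2 by (intro exI[of _ "(\<^bold>\<not> instS m q) # \<phi> # \<Gamma>"]) auto
  next
    case 3
    then show ?thesis using True by (intro exI[of _ "\<phi> # \<Gamma>"]) auto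
  qed
next
  case False
  \<comment> \<open>The context stays as it is, so the two witness clauses have to be
    vacuous.\<close>
  have "\<phi> \<notin> set \<Gamma>"
  proof
    assume "\<phi> \<in> set \<Gamma>"
    then have "deriv T (\<phi> # \<Gamma>) Fls \<Longrightarrow> deriv T \<Gamma> Fls" by (rule_tac deriv_weaken) auto
    then show False using False assms unfolding consistent_def by blast
  qed
  then show ?thesis using False assms by (intro exI[of _ \<Gamma>]) auto
qed

end

section \<open>Truth in two-sorted structures\<close>

instance tm :: countable by countable_datatype
instance fm :: countable by countable_datatype

primrec eval :: "'n \<Rightarrow> 'n \<Rightarrow> ('n \<Rightarrow> 'n \<Rightarrow> 'n) \<Rightarrow> ('n \<Rightarrow> 'n \<Rightarrow> 'n) \<Rightarrow> (nat \<Rightarrow> 'n) \<Rightarrow> tm \<Rightarrow> 'n" where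
  "eval z u a m e (Var n) = e n"
| "eval z u a m e \<^bold>0 = z"
| "eval z u a m e \<^bold>1 = u"
| "eval z u a m e (s \<^bold>+ t) = a (eval z u a m e s) (eval z u a m e t)"
| "eval z u a m e (s \<^bold>* t) = m (eval z u a m e s) (eval z u a m e t)"

text \<open>The sort of sets is an arbitrary type with a membership relation \<open>M\<close>: the
  term model takes the set variables themselves as its sets, the standard model takes sets of
  numbers.\<close>

primrec sat :: "'n \<Rightarrow> 'n \<Rightarrow> ('n \<Rightarrow> 'n \<Rightarrow> 'n) \<Rightarrow> ('n \<Rightarrow> 'n \<Rightarrow> 'n) \<Rightarrow> ('n \<Rightarrow> 'n \<Rightarrow> bool) \<Rightarrow>
    ('s \<Rightarrow> 'n \<Rightarrow> bool) \<Rightarrow> (nat \<Rightarrow> 'n) \<Rightarrow> (nat \<Rightarrow> 's) \<Rightarrow> fm \<Rightarrow> bool" where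
  "sat z u a m l M e S (s \<^bold>= t) \<longleftrightarrow> eval z u a m e s = eval z u a m e t"
| "sat z u a m l M e S (s \<^bold>< t) \<longleftrightarrow> l (eval z u a m e s) (eval z u a m e t)"
| "sat z u a m l M e S (t \<^bold>\<in> X) \<longleftrightarrow> M (S X) (eval z u a m e t)"
| "sat z u a m l M e S Fls \<longleftrightarrow> False"
| "sat z u a m l M e S (p \<^bold>\<longrightarrow> q) \<longleftrightarrow> (sat z u a m l M e S p \<longrightarrow> sat z u a m l M e S q)"
| "sat z u a m l M e S (AllN p) \<longleftrightarrow> (\<forall>x. sat z u a m l M (case_nat x e) S p)"
| "sat z u a m l M e S (AllS p) \<longleftrightarrow> (\<forall>X. sat z u a m l M e (case_nat X S) p)"

lemma case_nat_comp: "(\<lambda>n. f (case_nat x g n)) = case_nat (f x) (\<lambda>n. f (g n))"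
  by (auto simp: fun_eq_iff split: nat.split)

lemma deriv_congruence:
  assumes "deriv T \<Gamma> (s \<^bold>= t)"
  shows "deriv T \<Gamma> (t \<^bold>= s)"
    and "deriv T \<Gamma> (t \<^bold>= r) \<Longrightarrow> deriv T \<Gamma> (s \<^bold>= r)"
    and "deriv T \<Gamma> (s' \<^bold>= t') \<Longrightarrow> deriv T \<Gamma> (s \<^bold>+ s' \<^bold>= t \<^bold>+ t')"
    and "deriv T \<Gamma> (s' \<^bold>= t') \<Longrightarrow> deriv T \<Gamma> (s \<^bold>* s' \<^bold>= t \<^bold>* t')"
    and "deriv T \<Gamma> (s' \<^bold>= t') \<Longrightarrow> deriv T \<Gamma> (s \<^bold>< s') \<Longrightarrow> deriv T \<Gamma> (t \<^bold>< t')"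
    and "deriv T \<Gamma> (s \<^bold>\<in> X) \<Longrightarrow> deriv T \<Gamma> (t \<^bold>\<in> X)"
proof -
  \<comment> \<open>In the instances of \<open>EqE\<close> below, \<open>Var 0\<close> marks the
    occurrence that is rewritten, and \<open>up\<close> shields all other terms from the
    substitution.\<close>
  have up_inst: "subst_tm (case_nat r Var) (up t) = t" for r t
    by (simp add: subst_tm_comp)
  note E = EqE[of T \<Gamma>]
  show sym: "deriv T \<Gamma> (t \<^bold>= s)"
    using E[OF assms, of "Var 0 \<^bold>= up s"] by (simp add: up_inst EqI)
  show "deriv T \<Gamma> (s \<^bold>= r)" if "deriv T \<Gamma> (t \<^bold>= r)"
    using E[OF sym, of "Var 0 \<^bold>= up r"] that by (simp add: up_inst)
  show "deriv T \<Gamma> (t \<^bold>\<in> X)" if "deriv T \<Gamma> (s \<^bold>\<in> X)"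
    using E[OF assms, of "Var 0 \<^bold>\<in> X"] that by simp
  show "deriv T \<Gamma> (s \<^bold>+ s' \<^bold>= t \<^bold>+ t')" if "deriv T \<Gamma> (s' \<^bold>= t')"
    using E[OF assms, of "up (s \<^bold>+ s') \<^bold>= Var 0 \<^bold>+ up t'"] 
      E[OF that, of "up (s \<^bold>+ s') \<^bold>= up s \<^bold>+ Var 0"] by (simp add: up_inst EqI)
  show "deriv T \<Gamma> (s \<^bold>* s' \<^bold>= t \<^bold>* t')" if "deriv T \<Gamma> (s' \<^bold>= t')"
    using E[OF assms, of "up (s \<^bold>* s') \<^bold>= Var 0 \<^bold>* up t'"] 
      E[OF that, of "up (s \<^bold>* s') \<^bold>= up s \<^bold>* Var 0"] by (simp add: up_inst EqI)
  show "deriv T \<Gamma> (t \<^bold>< t')" if "deriv T \<Gamma> (s' \<^bold>= t')" "deriv T \<Gamma> (s \<^bold>< s')"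
    using E[OF assms, of "Var 0 \<^bold>< up t'"] E[OF that(1), of "up s \<^bold>< Var 0"] that(2)
    by (simp add: up_inst)
qed

text \<open>
  The terms \<open>d i\<close> make the term model infinite, so that its universe can be identified with \<open>nat\<close>.
\<close>

theorem (in substitutive) completeness:
  fixes d :: "nat \<Rightarrow> tm"
  assumes distinct: "\<And>i j. i < j \<Longrightarrow> deriv T [] (\<^bold>\<not> (d i \<^bold>= d j))"
    and not_provable: "\<not> T \<turnstile> goal"
  obtains z u :: nat and a m l and M :: "nat \<Rightarrow> nat \<Rightarrow> bool" where "\<And>p e S. p \<in> T \<Longrightarrow> sat z u a m l M e S p"
    and "\<exists>e S. \<not> sat z u a m l M e S goal"
proof -
  define step where "step = (\<lambda>\<phi> \<Gamma> \<Delta>. set \<Gamma> \<subseteq> set \<Delta> \<and> consistent \<Delta> \<and> (\<phi> \<in> set \<Delta> \<or> \<not> consistent (\<phi> # \<Gamma>)) \<and>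
    (\<forall>q. \<phi> = (\<^bold>\<not> AllN q) \<and> \<phi> \<in> set \<Delta> \<longrightarrow> (\<exists>t. (\<^bold>\<not> instN t q) \<in> set \<Delta>)) \<and>
    (\<forall>q. \<phi> = (\<^bold>\<not> AllS q) \<and> \<phi> \<in> set \<Delta> \<longrightarrow> (\<exists>Y. (\<^bold>\<not> instS Y q) \<in> set \<Delta>)))"
  have ex_step: "\<exists>\<Delta>. step \<phi> \<Gamma> \<Delta>" if "consistent \<Gamma>" for \<phi> \<Gamma>
    unfolding step_def using extension_step[OF that] .
  have "consistent [\<^bold>\<not> goal]"
    using not_provable Classical unfolding consistent_def proves_def by blast
  \<comment> \<open>Stage \<open>n\<close> treats the formula with code \<open>n\<close>. Every
    stage is a finite list, which leaves fresh variables for the next witness.\<close>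
  then have "\<exists>G. \<forall>n. (consistent (G n) \<and> (n = 0 \<longrightarrow> G n = [\<^bold>\<not> goal])) \<and> step (from_nat n) (G n) (G (Suc n))"
  proof (intro dependent_nat_choice)
    fix \<Gamma> and n :: nat assume "consistent \<Gamma> \<and> (n = 0 \<longrightarrow> \<Gamma> = [\<^bold>\<not> goal])"
    then obtain \<Delta> where "step (from_nat n) \<Gamma> \<Delta>" using ex_step by blast
    then show "\<exists>\<Delta>. (consistent \<Delta> \<and> (Suc n = 0 \<longrightarrow> \<Delta> = [\<^bold>\<not> goal])) \<and> step (from_nat n) \<Gamma> \<Delta>"
      unfolding step_def by blast
  qed blast
  then obtain G where G0: "G 0 = [\<^bold>\<not> goal]" and cons: "\<And>n. consistent (G n)"
    and step: "\<And>n. step (from_nat n) (G n) (G (Suc n))" by blast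
  have mono: "set (G i) \<subseteq> set (G j)" if "i \<le> j" for i j
    using that by (induction rule: dec_induct) (use step step_def in blast)+
  \<comment> \<open>As the stages increase, \<open>D\<close> is closed under derivation; it is
    complete because each formula is decided at the stage given by its code.\<close>
  define D where "D p \<longleftrightarrow> (\<exists>n. deriv T (G n) p)" for p
  have D2: "\<exists>n. deriv T (G n) p \<and> deriv T (G n) q" if "D p" "D q" for p q
  proof -
    from that obtain i j where "deriv T (G i) p" "deriv T (G j) q" unfolding D_def by blast
    then show ?thesis using mono by (meson deriv_weaken max.cobounded1 max.cobounded2)
  qed
  have D_closed: "D q" if "\<And>\<Gamma>. deriv T \<Gamma> p \<Longrightarrow> deriv T \<Gamma> q" "D p" for p q
    using that unfolding D_def by blast
  have D_closed2: "D r" if "\<And>\<Gamma>. deriv T \<Gamma> p \<Longrightarrow> deriv T \<Gamma> q \<Longrightarrow> deriv T \<Gamma> r" "D p" "D q" for p q r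
    using that D2 unfolding D_def by blast
  have D_deriv: "D p" if "deriv T [] p" for p
    using that deriv_weaken[of T "[]" p "G 0"] unfolding D_def by auto
  have D_MP: "D q" if "D (p \<^bold>\<longrightarrow> q)" "D p" for p q
    using D_closed2[OF ImpE that] .
  have D_Fls: "\<not> D Fls" using cons unfolding D_def consistent_def by blast
  have in_D: "D p" if "p \<in> set (G n)" for p n
    using Assm[OF that] unfolding D_def by blast
  have D_cases: "p \<in> set (G (Suc (to_nat p))) \<or> D (\<^bold>\<not> p)" for p
    using step[of "to_nat p"] unfolding step_def D_def consistent_def by (auto intro: ImpI)
  have D_in: "p \<in> set (G (Suc (to_nat p)))" if "D p" for p
    using D_cases[of p] D_MP[OF _ that] D_Fls by blast
  have D_Imp: "D (p \<^bold>\<longrightarrow> q) \<longleftrightarrow> (D p \<longrightarrow> D q)" for p q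
  proof
    assume *: "D p \<longrightarrow> D q"
    show "D (p \<^bold>\<longrightarrow> q)"
    proof (cases "D p")
      case True
      then have "D q" using * by blast
      moreover have "deriv T \<Gamma> (p \<^bold>\<longrightarrow> q)" if "deriv T \<Gamma> q" for \<Gamma>
        using that by (intro ImpI) (auto elim: deriv_weaken)
      ultimately show ?thesis using D_closed by blast
    next
      case False
      then have "D (\<^bold>\<not> p)" using D_cases in_D by blast
      moreover have "deriv T \<Gamma> (p \<^bold>\<longrightarrow> q)" if "deriv T \<Gamma> (\<^bold>\<not> p)" for \<Gamma>
      proof (rule ImpI, rule Classical)
        have "deriv T ((\<^bold>\<not> q) # p # \<Gamma>) (\<^bold>\<not> p)" using that by (rule deriv_weaken) auto
        moreover have "deriv T ((\<^bold>\<not> q) # p # \<Gamma>) p" by (rule Assm) simp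
        ultimately show "deriv T ((\<^bold>\<not> q) # p # \<Gamma>) Fls" by (rule ImpE)
      qed
      ultimately show ?thesis using D_closed by blast
    qed
  qed (use D_MP in blast)
  have D_neg: "D (\<^bold>\<not> p) \<longleftrightarrow> \<not> D p" for p using D_Imp D_Fls by blast
  have D_AllN: "D (AllN p) \<longleftrightarrow> (\<forall>t. D (instN t p))" for p
  proof
    assume "\<forall>t. D (instN t p)"
    then show "D (AllN p)"
    proof (rule contrapos_pp)
      assume "\<not> D (AllN p)"
      \<comment> \<open>The negated universal formula entered at its own stage, together with a
        counterexample.\<close>
      then have "(\<^bold>\<not> AllN p) \<in> set (G (Suc (to_nat (\<^bold>\<not> AllN p))))" using D_neg D_in by blast
      then obtain t where "D (\<^bold>\<not> instN t p)"
        using step[of "to_nat (\<^bold>\<not> AllN p)"] in_D unfolding step_def by auto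
      then show "\<not> (\<forall>t. D (instN t p))" using D_neg by blast
    qed
  qed (blast intro: D_closed AllN_E)
  have D_AllS: "D (AllS p) \<longleftrightarrow> (\<forall>Y. D (instS Y p))" for p
  proof
    assume "\<forall>Y. D (instS Y p)"
    then show "D (AllS p)"
    proof (rule contrapos_pp)
      assume "\<not> D (AllS p)"
      then have "(\<^bold>\<not> AllS p) \<in> set (G (Suc (to_nat (\<^bold>\<not> AllS p))))" using D_neg D_in by blast
      then obtain Y where "D (\<^bold>\<not> instS Y p)"
        using step[of "to_nat (\<^bold>\<not> AllS p)"] in_D unfolding step_def by auto
      then show "\<not> (\<forall>Y. D (instS Y p))" using D_neg by blast
    qed
  qed (blast intro: D_closed AllS_E)
  \<comment> \<open>Equality is a primitive symbol, so terms have to be divided by the equations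
    that belong to \<open>D\<close>.\<close>
  define q where "q t = {s. D (t \<^bold>= s)}" for t
  have D_refl: "D (t \<^bold>= t)" for t by (intro D_deriv EqI)
  have D_sym: "D (t \<^bold>= s)" if "D (s \<^bold>= t)" for s t
    using D_closed deriv_congruence(1) that by blast
  have D_trans: "D (s \<^bold>= r)" if "D (s \<^bold>= t)" "D (t \<^bold>= r)" for s t r
    using D_closed2[OF deriv_congruence(2) that] .
  have q: "q s = q t \<longleftrightarrow> D (s \<^bold>= t)" for s t
    unfolding q_def using D_refl D_sym D_trans by blast
  have "q (d i) \<noteq> q (d j)" if "i < j" for i j
    using D_deriv[OF distinct[OF that]] D_neg q by blast
  then have "inj (\<lambda>i. q (d i))" by (metis injI linorder_neqE_nat)
  then have "infinite (range (\<lambda>i. q (d i)))" by (rule range_inj_infinite)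
  then have "infinite (range q)"
    by (rule infinite_super[rotated]) auto
  have bij: "bij_betw (to_nat_on (range q)) (range q) UNIV"
    using to_nat_on_infinite[OF countable_image[OF countableI_type] \<open>infinite (range q)\<close>] .
  define N where "N t = to_nat_on (range q) (q t)" for t
  have N: "N s = N t \<longleftrightarrow> D (s \<^bold>= t)" for s t
    unfolding N_def inj_on_eq_iff[OF bij_betw_imp_inj_on[OF bij] rangeI rangeI] by (rule q)
  have "surj N" using bij_betw_imp_surj_on[OF bij] unfolding N_def by (metis image_image)
  define rp where "rp = inv N"
  have N_rp: "N (rp x) = x" for x unfolding rp_def using \<open>surj N\<close> by (rule surj_f_inv_f)
  have rp_N: "D (rp (N t) \<^bold>= t)" for t using N N_rp by blast
  define a where "a x y = N (rp x \<^bold>+ rp y)" for x y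
  define m where "m x y = N (rp x \<^bold>* rp y)" for x y
  define l where "l x y \<longleftrightarrow> D (rp x \<^bold>< rp y)" for x y
  define M where "M X x \<longleftrightarrow> D (rp x \<^bold>\<in> X)" for X x
  have a: "a (N s) (N t) = N (s \<^bold>+ t)" for s t
    unfolding a_def N using D_closed2[OF deriv_congruence(3)] rp_N by blast
  have m: "m (N s) (N t) = N (s \<^bold>* t)" for s t
    unfolding m_def N using D_closed2[OF deriv_congruence(4)] rp_N by blast
  have congr_less: "D (t \<^bold>< t')" if "D (s \<^bold>= t)" "D (s' \<^bold>= t')" "D (s \<^bold>< s')" for s t s' t'
  proof -
    have *: "D (s \<^bold>< t')"
      using D_closed2[OF _ that(2,3), of "s \<^bold>< t'"] deriv_congruence(5)[OF EqI] by blast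
    show ?thesis using D_closed2[OF _ that(1) *] deriv_congruence(5)[OF _ EqI] by blast
  qed
  have l: "l (N s) (N t) \<longleftrightarrow> D (s \<^bold>< t)" for s t
    unfolding l_def using congr_less rp_N D_sym by blast
  have congr_Mem: "D (t \<^bold>\<in> X)" if "D (s \<^bold>= t)" "D (s \<^bold>\<in> X)" for s t X
    using D_closed2[OF _ that] deriv_congruence(6) by blast
  have M: "M X (N t) \<longleftrightarrow> D (t \<^bold>\<in> X)" for X t
    unfolding M_def using congr_Mem[OF rp_N] congr_Mem[OF D_sym[OF rp_N]] by blast
  have ev: "eval (N \<^bold>0) (N \<^bold>1) a m (\<lambda>n. N (\<sigma> n)) t = N (subst_tm \<sigma> t)" for \<sigma> t
    by (induction t) (simp_all add: a m)
  \<comment> \<open>An environment whose values are named by terms amounts to a substitution. With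
    \<open>\<sigma>\<close> and \<open>\<rho>\<close> arbitrary, the induction passes through a
    quantifier by extending one of them.\<close>
  have truth: "sat (N \<^bold>0) (N \<^bold>1) a m l M (\<lambda>n. N (\<sigma> n)) \<rho> p \<longleftrightarrow> D (substN \<sigma> (substS \<rho> p))" for \<sigma> \<rho> p
  proof (induction p arbitrary: \<sigma> \<rho>)
    case (Eq s t)
    then show ?case by (simp add: ev N)
  next
    case (Less s t)
    then show ?case by (simp add: ev l)
  next
    case (Mem t X)
    then show ?case by (simp add: ev M)
  next
    case Fls
    then show ?case by (simp add: D_Fls)
  next
    case (Imp p q)
    then show ?case by (simp add: D_Imp)
  next
    case (AllN p)
    have "sat (N \<^bold>0) (N \<^bold>1) a m l M (\<lambda>n. N (\<sigma> n)) \<rho> (AllN p) \<longleftrightarrow>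
        (\<forall>t. sat (N \<^bold>0) (N \<^bold>1) a m l M (case_nat (N t) (\<lambda>n. N (\<sigma> n))) \<rho> p)"
      using \<open>surj N\<close> by (metis sat.simps(6) surjD)
    also have "\<dots> \<longleftrightarrow> (\<forall>t. D (substN (case_nat t \<sigma>) (substS \<rho> p)))"
      using AllN[of "case_nat t \<sigma>" \<rho> for t] unfolding case_nat_comp by simp
    finally show ?case by (simp add: D_AllN instN_substN)
  next
    case (AllS p)
    then show ?case by (simp add: D_AllS instS_substS substN_substS)
  qed
  show ?thesis
  proof
    fix p S and e :: "nat \<Rightarrow> nat" assume p: "p \<in> T"
    \<comment> \<open>Every element is named by a term, so the truth lemma reaches every
      environment, as is required for axioms with free variables.\<close>
    have e: "e = (\<lambda>n. N (rp (e n)))" by (simp add: N_rp)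
    show "sat (N \<^bold>0) (N \<^bold>1) a m l M e S p"
      by (subst e) (simp only: truth D_deriv instance_derivable p)
  next
    have "D (\<^bold>\<not> goal)" using in_D[of _ 0] G0 by simp
    then have "\<not> sat (N \<^bold>0) (N \<^bold>1) a m l M (\<lambda>n. N (Var n)) (\<lambda>n. n) goal"
      using truth[of Var "\<lambda>n. n" goal] D_neg by simp
    then show "\<exists>e S. \<not> sat (N \<^bold>0) (N \<^bold>1) a m l M e S goal" by blast
  qed
qed

lemma eval_subst: "eval z u a m e (subst_tm \<sigma> t) = eval z u a m (\<lambda>n. eval z u a m e (\<sigma> n)) t"
  by (induction t) auto

lemma eval_up [simp]: "eval z u a m (case_nat x e) (up t) = eval z u a m e t"
  by (simp add: eval_subst)

lemma sat_substN: "sat z u a m l M e S (substN \<sigma> p) \<longleftrightarrow> sat z u a m l M (\<lambda>n. eval z u a m e (\<sigma> n)) S p"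
proof (induction p arbitrary: e \<sigma> S)
  case (AllN p)
  have "(\<lambda>n. eval z u a m (case_nat x e) (liftN \<sigma> n)) = case_nat x (\<lambda>n. eval z u a m e (\<sigma> n))" for x
    by (auto simp: fun_eq_iff split: nat.split)
  then show ?case using AllN by simp
qed (auto simp: eval_subst)

lemma sat_substS: "sat z u a m l M e S (substS \<rho> p) \<longleftrightarrow> sat z u a m l M e (\<lambda>n. S (\<rho> n)) p"
proof (induction p arbitrary: e \<rho> S)
  case (AllS p)
  have "(\<lambda>n. case_nat X S (liftS \<rho> n)) = case_nat X (\<lambda>n. S (\<rho> n))" for X
    by (auto simp: fun_eq_iff split: nat.split)
  then show ?case using AllS by simp
qed auto

lemma sat_instN [simp]:
  "sat z u a m l M e S (instN t p) \<longleftrightarrow> sat z u a m l M (case_nat (eval z u a m e t) e) S p"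
proof -
  have "(\<lambda>n. eval z u a m e (case_nat t Var n)) = case_nat (eval z u a m e t) e"
    by (auto simp: fun_eq_iff split: nat.split)
  then show ?thesis by (simp add: sat_substN)
qed

lemma sat_instS [simp]: "sat z u a m l M e S (instS Y p) \<longleftrightarrow> sat z u a m l M e (case_nat (S Y) S) p"
  by (simp add: sat_substS case_nat_comp)

lemma sat_induction_axiom:
  "sat z u a m l M e S (induction_axiom p) \<longleftrightarrow>
    (sat z u a m l M (case_nat z e) S p \<and>
      (\<forall>x. sat z u a m l M (case_nat x e) S p \<longrightarrow> sat z u a m l M (case_nat (a x u) e) S p) \<longrightarrow>
    (\<forall>x. sat z u a m l M (case_nat x e) S p))"
proof -
  have "(\<lambda>n. eval z u a m (case_nat x e) (case_nat (Var 0 \<^bold>+ \<^bold>1) (\<lambda>n. Var (Suc n)) n)) =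
      case_nat (a x u) e" for x
    by (auto simp: fun_eq_iff split: nat.split)
  then have "sat z u a m l M (case_nat x e) S (substN (case_nat (Var 0 \<^bold>+ \<^bold>1) (\<lambda>n. Var (Suc n))) p) \<longleftrightarrow>
      sat z u a m l M (case_nat (a x u) e) S p" for x
    by (simp only: sat_substN)
  then show ?thesis by (simp add: induction_axiom_def)
qed

lemma sat_comprehension_axiom:
  "sat z u a m l M e S (comprehension_axiom p q) \<longleftrightarrow>
    ((\<forall>x. sat z u a m l M (case_nat x e) S p \<longleftrightarrow> sat z u a m l M (case_nat x e) S q) \<longrightarrow>
    (\<exists>X. \<forall>x. M X x \<longleftrightarrow> sat z u a m l M (case_nat x e) S p))"
  by (auto simp: comprehension_axiom_def sat_substS)

text \<open>Axioms stand for their universal closures, so their truth is assumed in all environments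
  at once. The consistency of \<open>RCA0\<close> is drawn from this theorem.\<close>

theorem soundness:
  assumes "deriv T \<Gamma> p" "\<And>p e S. p \<in> T \<Longrightarrow> sat z u a m l M e S p"
    "\<And>q. q \<in> set \<Gamma> \<Longrightarrow> sat z u a m l M e S q"
  shows "sat z u a m l M e S p"
  using assms(1,3)
proof (induction arbitrary: e S rule: deriv.induct)
  case (Axm p \<Gamma>)
  then show ?case by (intro assms(2))
next
  case (AllN_I \<Gamma> p)
  have "sat z u a m l M (case_nat x e) S p" for x
    using AllN_I.prems by (intro AllN_I.IH) (auto simp: sat_substN)
  then show ?case by simp
next
  case (AllS_I \<Gamma> p)
  have "sat z u a m l M e (case_nat X S) p" for X
    using AllS_I.prems by (intro AllS_I.IH) (auto simp: sat_substS)
  then show ?case by simp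
next
  case (AllN_E \<Gamma> p t)
  then show ?case by simp
next
  case (AllS_E \<Gamma> p Y)
  then show ?case by simp
next
  case (EqE \<Gamma> s t p)
  have "eval z u a m e s = eval z u a m e t" using EqE.IH(1)[OF EqE.prems] by simp
  then show ?case using EqE.IH(2)[OF EqE.prems] by simp
next
  case (Classical p \<Gamma>)
  then show ?case by (metis sat.simps(4,5) set_ConsD)
qed auto

section \<open>Models of RCA0\<close>

lemma delta0_substN: "delta0 p \<Longrightarrow> delta0 (substN \<sigma> p)"
proof (induction arbitrary: \<sigma> rule: delta0.induct)
  case (6 p t)
  have "subst_tm (liftN \<sigma>) (up t) = up (subst_tm \<sigma> t)" by (simp add: subst_tm_comp)
  then show ?case using 6 delta0.intros(6) by simp
qed (auto intro: delta0.intros)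

lemma delta0_substS: "delta0 p \<Longrightarrow> delta0 (substS \<rho> p)"
  by (induction rule: delta0.induct) (auto intro: delta0.intros)

lemma sigma1_subst: "sigma1 p \<Longrightarrow> sigma1 (substN \<sigma> (substS \<rho> p))"
  unfolding sigma1_def using delta0_substN delta0_substS by fastforce

lemma pi1_subst: "pi1 p \<Longrightarrow> pi1 (substN \<sigma> (substS \<rho> p))"
  unfolding pi1_def using delta0_substN delta0_substS by fastforce

lemma substN_substS_induction_axiom:
  "substN \<sigma> (substS \<rho> (induction_axiom p)) = induction_axiom (substN (liftN \<sigma>) (substS \<rho> p))"
proof -
  have "(\<lambda>n. subst_tm (liftN \<sigma>) (case_nat (Var 0 \<^bold>+ \<^bold>1) (\<lambda>n. Var (Suc n)) n)) =
    (\<lambda>n. subst_tm (case_nat (Var 0 \<^bold>+ \<^bold>1) (\<lambda>n. Var (Suc n))) (liftN \<sigma> n))"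
    by (auto simp: fun_eq_iff subst_tm_comp split: nat.split)
  then show ?thesis
    by (simp add: induction_axiom_def substN_substS[symmetric] substN_instN instN_substN)
      (simp add: substN_comp case_nat_comp)
qed

lemma substN_substS_comprehension_axiom:
  "substN \<sigma> (substS \<rho> (comprehension_axiom p q)) =
    comprehension_axiom (substN (liftN \<sigma>) (substS \<rho> p)) (substN (liftN \<sigma>) (substS \<rho> q))"
  by (simp add: comprehension_axiom_def substS_upS substN_substS)

lemma induction_axiom_RCA0: "sigma1 p \<Longrightarrow> induction_axiom p \<in> RCA0"
  unfolding RCA0_def by blast

lemma comprehension_axiom_RCA0: "sigma1 p \<Longrightarrow> pi1 q \<Longrightarrow> comprehension_axiom p q \<in> RCA0"
  unfolding RCA0_def by blast

interpretation RCA0: substitutive RCA0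
proof
  fix p \<sigma> \<rho> assume "p \<in> RCA0"
  then consider "p \<in> basic_axioms" | q where "p = induction_axiom q" "sigma1 q"
    | q r where "p = comprehension_axiom q r" "sigma1 q" "pi1 r"
    unfolding RCA0_def by blast
  then show "deriv RCA0 [] (substN \<sigma> (substS \<rho> p))"
  proof cases
    case 1
    have "deriv RCA0 [] p" using 1 by (simp add: Axm RCA0_def)
    \<comment> \<open>The basic axioms contain only the number variables \<open>0\<close> and
      \<open>1\<close> and no set variable: closing over these two and instantiating again yields
      every substitution instance.\<close>
    then have "deriv RCA0 [] (AllN (AllN p))" by (simp add: AllN_I)
    then have "deriv RCA0 [] (instN (\<sigma> 0) (substN (liftN (case_nat (\<sigma> 1) Var)) p))"
      using AllN_E[OF AllN_E[of RCA0 "[]" "AllN p" "\<sigma> 1", simplified substN.simps], of "\<sigma> 0"] by simp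
    then have "deriv RCA0 [] (substN (case_nat (\<sigma> 0) (case_nat (\<sigma> 1) Var)) p)"
      unfolding instN_substN .
    moreover have "substN \<sigma> (substS \<rho> p) = substN (case_nat (\<sigma> 0) (case_nat (\<sigma> 1) Var)) p"
      using 1 unfolding basic_axioms_def by auto
    ultimately show ?thesis by simp
  next
    case 2
    then show ?thesis
      unfolding 2 substN_substS_induction_axiom by (intro Axm induction_axiom_RCA0 sigma1_subst)
  next
    case 3
    then show ?thesis
      unfolding 3 substN_substS_comprehension_axiom
      by (intro Axm comprehension_axiom_RCA0 sigma1_subst pi1_subst)
  qed
qed

lemma RCA0_instance: "p \<in> RCA0 \<Longrightarrow> deriv RCA0 \<Gamma> (substN \<sigma> p)"
  using RCA0.instance_derivable[of p \<sigma> "\<lambda>n. n"] deriv_weaken by fastforce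

lemma RCA0_succ_nonzero: "deriv RCA0 \<Gamma> (\<^bold>\<not> (t \<^bold>+ \<^bold>1 \<^bold>= \<^bold>0))"
  using RCA0_instance[of "\<^bold>\<not> (Var 0 \<^bold>+ \<^bold>1 \<^bold>= \<^bold>0)" \<Gamma> "\<lambda>_. t"] by (simp add: RCA0_def basic_axioms_def)

lemma RCA0_succ_inject: "deriv RCA0 \<Gamma> (s \<^bold>+ \<^bold>1 \<^bold>= t \<^bold>+ \<^bold>1 \<^bold>\<longrightarrow> s \<^bold>= t)"
  using RCA0_instance[of "Var 0 \<^bold>+ \<^bold>1 \<^bold>= Var 1 \<^bold>+ \<^bold>1 \<^bold>\<longrightarrow> Var 0 \<^bold>= Var 1" \<Gamma> "case_nat s (\<lambda>_. t)"]
  by (simp add: RCA0_def basic_axioms_def)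

primrec numeral_tm :: "nat \<Rightarrow> tm" where
  "numeral_tm 0 = \<^bold>0"
| "numeral_tm (Suc n) = numeral_tm n \<^bold>+ \<^bold>1"

text \<open>Serves as the family \<open>d\<close> of the completeness theorem.\<close>

lemma numeral_tm_distinct: "i < j \<Longrightarrow> deriv RCA0 [] (\<^bold>\<not> (numeral_tm i \<^bold>= numeral_tm j))"
proof (induction i arbitrary: j)
  case 0
  then obtain k where j: "j = Suc k" by (cases j) auto
  have "deriv RCA0 [\<^bold>0 \<^bold>= numeral_tm j] (numeral_tm j \<^bold>= \<^bold>0)" by (rule deriv_congruence(1)) (simp add: Assm)
  then have "deriv RCA0 [\<^bold>0 \<^bold>= numeral_tm j] Fls"
    using ImpE[OF RCA0_succ_nonzero, of _ "numeral_tm k"] j by simp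
  then show ?case by (simp add: ImpI)
next
  case (Suc i)
  then obtain k where j: "j = Suc k" by (cases j) auto
  let ?\<Gamma> = "[numeral_tm (Suc i) \<^bold>= numeral_tm j]"
  have "deriv RCA0 ?\<Gamma> (numeral_tm i \<^bold>= numeral_tm k)"
    by (rule ImpE[OF RCA0_succ_inject]) (simp add: j Assm)
  moreover have "deriv RCA0 ?\<Gamma> (\<^bold>\<not> (numeral_tm i \<^bold>= numeral_tm k))"
    by (rule deriv_weaken[OF Suc.IH]) (use Suc.prems j in auto)
  ultimately show ?case by (blast intro: ImpI ImpE)
qed

text \<open>By the standard model, with all sets of natural numbers as sets. Consistency guarantees
  that some model exists, so that \<open>countermodel\<close> is a model even if both goals are
  provable.\<close>

lemma RCA0_consistent: "\<not> RCA0 \<turnstile> Fls"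
proof
  assume "RCA0 \<turnstile> Fls"
  moreover have "sat (0::nat) 1 (+) (*) (<) (\<lambda>X x. x \<in> X) e S p" if "p \<in> RCA0" for p e S
  proof -
    consider "p \<in> basic_axioms" | q where "p = induction_axiom q"
      | q r where "p = comprehension_axiom q r"
      using \<open>p \<in> RCA0\<close> unfolding RCA0_def by blast
    then show ?thesis
    proof cases
      case 1
      then show ?thesis unfolding basic_axioms_def by auto
    next
      case 2
      let ?P = "\<lambda>x. sat (0::nat) 1 (+) (*) (<) (\<lambda>X x. x \<in> X) (case_nat x e) S q"
      show ?thesis
        unfolding 2 sat_induction_axiom
      proof (intro impI allI)
        fix x assume P: "?P 0 \<and> (\<forall>x. ?P x \<longrightarrow> ?P (x + 1))"
        show "?P x"
        proof (induction x)
          case 0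
          from P show ?case ..
        next
          case (Suc x)
          then show ?case using P[THEN conjunct2, rule_format, of x] by (simp only: Suc_eq_plus1)
        qed
      qed
    next
      case 3
      let ?Q = "\<lambda>x. sat (0::nat) 1 (+) (*) (<) (\<lambda>X x. x \<in> X) (case_nat x e) S q"
      have "\<forall>x. x \<in> {x. ?Q x} \<longleftrightarrow> ?Q x" by (simp only: mem_Collect_eq) simp
      then show ?thesis unfolding 3 sat_comprehension_axiom by blast
    qed
  qed
  ultimately have "sat (0::nat) 1 (+) (*) (<) (\<lambda>X x. x \<in> X) e S Fls" for e S
    unfolding proves_def by (rule soundness) auto
  then show False by simp
qed

section \<open>Models as a type class, and a countermodel as a type\<close>

class RCA0_structure = zero + one + plus + times + ord +
  fixes mem :: "nat \<Rightarrow> 'a \<Rightarrow> bool"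

abbreviation holds :: "(nat \<Rightarrow> 'a::RCA0_structure) \<Rightarrow> (nat \<Rightarrow> nat) \<Rightarrow> fm \<Rightarrow> bool" where
  "holds \<equiv> sat 0 1 (+) (*) (<) mem"

abbreviation val :: "(nat \<Rightarrow> 'a::RCA0_structure) \<Rightarrow> tm \<Rightarrow> 'a" where
  "val \<equiv> eval 0 1 (+) (*)"

text \<open>The class \<open>ord\<close> brings along an operation \<open>\<le>\<close> for which
  the language has no symbol; the second assumption ties it to \<open><\<close>.\<close>

class RCA0_model = RCA0_structure +
  assumes holds_RCA0: "p \<in> RCA0 \<Longrightarrow> sat 0 1 (+) (*) (<) mem e S p"
    and le_iff_less_or_eq: "x \<le> y \<longleftrightarrow> x < y \<or> x = y"

definition nat_model :: "nat \<times> nat \<times> (nat \<Rightarrow> nat \<Rightarrow> nat) \<times> (nat \<Rightarrow> nat \<Rightarrow> nat) \<times>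
    (nat \<Rightarrow> nat \<Rightarrow> bool) \<times> (nat \<Rightarrow> nat \<Rightarrow> bool) \<Rightarrow> bool" where
  "nat_model = (\<lambda>(z, u, a, m, l, M). \<forall>p\<in>RCA0. \<forall>e S. sat z u a m l M e S p)"

definition refutes :: "nat \<times> nat \<times> (nat \<Rightarrow> nat \<Rightarrow> nat) \<times> (nat \<Rightarrow> nat \<Rightarrow> nat) \<times>
    (nat \<Rightarrow> nat \<Rightarrow> bool) \<times> (nat \<Rightarrow> nat \<Rightarrow> bool) \<Rightarrow> fm \<Rightarrow> bool" where
  "refutes = (\<lambda>(z, u, a, m, l, M) p. \<exists>e S. \<not> sat z u a m l M e S p)"

lemma refuting_model: "\<not> RCA0 \<turnstile> p \<Longrightarrow> \<exists>K. nat_model K \<and> refutes K p"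
proof (rule RCA0.completeness[of numeral_tm p])
  fix z u :: nat and a m l and M :: "nat \<Rightarrow> nat \<Rightarrow> bool"
  assume "\<And>p e S. p \<in> RCA0 \<Longrightarrow> sat z u a m l M e S p" "\<exists>e S. \<not> sat z u a m l M e S p"
  then have "nat_model (z, u, a, m, l, M) \<and> refutes (z, u, a, m, l, M) p"
    unfolding nat_model_def refutes_def by simp
  then show "\<exists>K. nat_model K \<and> refutes K p" ..
qed (simp_all add: numeral_tm_distinct)

text \<open>The two sentences are collected because only one type of numbers is defined: it has to
  serve as a countermodel if either of them is unprovable.\<close>

definition goals :: "fm set" where
  "goals = {AllN (AHT_k (Var 0) \<^bold>\<longrightarrow> IPT2_k (Var 0)), AHT \<^bold>\<longrightarrow> IPT2}"

definition countermodel :: "nat \<times> nat \<times> (nat \<Rightarrow> nat \<Rightarrow> nat) \<times> (nat \<Rightarrow> nat \<Rightarrow> nat) \<times>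
    (nat \<Rightarrow> nat \<Rightarrow> bool) \<times> (nat \<Rightarrow> nat \<Rightarrow> bool)" where
  "countermodel = (SOME K. nat_model K \<and>
    ((\<exists>L. nat_model L \<and> (\<exists>p\<in>goals. refutes L p)) \<longrightarrow> (\<exists>p\<in>goals. refutes K p)))"

lemma countermodel: "nat_model countermodel"
  "nat_model L \<Longrightarrow> p \<in> goals \<Longrightarrow> refutes L p \<Longrightarrow> \<exists>q\<in>goals. refutes countermodel q"
proof -
  have "\<exists>K. nat_model K" using refuting_model[OF RCA0_consistent] by blast
  then have "\<exists>K. nat_model K \<and>
      ((\<exists>L. nat_model L \<and> (\<exists>p\<in>goals. refutes L p)) \<longrightarrow> (\<exists>p\<in>goals. refutes K p))" by blast
  from someI_ex[OF this, folded countermodel_def] 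
  show "nat_model countermodel" 
    "nat_model L \<Longrightarrow> p \<in> goals \<Longrightarrow> refutes L p \<Longrightarrow> \<exists>q\<in>goals. refutes countermodel q" by blast+
qed

text \<open>
  The numbers of a countermodel form a type, so that the algebraic type classes apply to them.
  A type cannot depend on the hypothesis that there is a countermodel; without one, any model is taken.
\<close>

typedef number = "UNIV :: nat set" ..

instantiation number :: RCA0_structure
begin

definition "0 = (case countermodel of (z, u, a, m, l, M) \<Rightarrow> Abs_number z)"
definition "1 = (case countermodel of (z, u, a, m, l, M) \<Rightarrow> Abs_number u)"
definition "x + y = (case countermodel of (z, u, a, m, l, M) \<Rightarrow> Abs_number (a (Rep_number x) (Rep_number y)))"
definition "x * y = (case countermodel of (z, u, a, m, l, M) \<Rightarrow> Abs_number (m (Rep_number x) (Rep_number y)))"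
definition "x < y \<longleftrightarrow> (case countermodel of (z, u, a, m, l, M) \<Rightarrow> l (Rep_number x) (Rep_number y))"
definition "x \<le> y \<longleftrightarrow> x < y \<or> x = (y::number)"
definition "mem X x \<longleftrightarrow> (case countermodel of (z, u, a, m, l, M) \<Rightarrow> M X (Rep_number x))"

instance ..

end

lemmas number_defs = zero_number_def one_number_def plus_number_def times_number_def less_number_def mem_number_def

lemma holds_number:
  assumes K: "countermodel = (z, u, a, m, l, M)"
  shows "holds (e :: nat \<Rightarrow> number) S p \<longleftrightarrow> sat z u a m l M (\<lambda>n. Rep_number (e n)) S p"
proof -
  have val: "Rep_number (val e t) = eval z u a m (\<lambda>n. Rep_number (e n)) t" for e :: "nat \<Rightarrow> number" and t
    by (induction t) (simp_all add: number_defs K Abs_number_inverse)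
  have inj: "x = y \<longleftrightarrow> Rep_number x = Rep_number y" for x y by (simp add: Rep_number_inject)
  have surj: "\<exists>y. x = Rep_number y" for x
    by (rule exI[of _ "Abs_number x"]) (simp add: Abs_number_inverse)
  show ?thesis
  proof (induction p arbitrary: e S)
    case (AllN p)
    have "(\<forall>x. sat z u a m l M (case_nat (Rep_number x) (\<lambda>n. Rep_number (e n))) S p) \<longleftrightarrow>
        (\<forall>x. sat z u a m l M (case_nat x (\<lambda>n. Rep_number (e n))) S p)"
      using surj by metis
    then show ?case using AllN by (simp add: case_nat_comp[of Rep_number])
  qed (simp_all add: inj val less_number_def mem_number_def K)
qed

instance number :: RCA0_model
proof
  obtain z u a m l M where K: "countermodel = (z, u, a, m, l, M)" by (cases countermodel)
  show "holds e S p" if "p \<in> RCA0" for p S and e :: "nat \<Rightarrow> number"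
    using countermodel(1) that unfolding holds_number[OF K] nat_model_def K by simp
qed (simp add: less_eq_number_def)

text \<open>The sentence refuted by the countermodel may be the other one of the two, which is why
  all goals are assumed to hold there.\<close>

lemma RCA0_proves_goals:
  assumes "\<And>p e S. p \<in> goals \<Longrightarrow> holds (e :: nat \<Rightarrow> number) S p" "p \<in> goals"
  shows "RCA0 \<turnstile> p"
proof (rule ccontr)
  assume "\<not> RCA0 \<turnstile> p"
  then obtain L where "nat_model L" "refutes L p" using refuting_model by blast
  then obtain q where q: "q \<in> goals" "refutes countermodel q" using countermodel(2) assms(2) by blast
  obtain z u a m l M where K: "countermodel = (z, u, a, m, l, M)" by (cases countermodel)
  obtain e S where "\<not> sat z u a m l M e S q" using q(2) unfolding refutes_def K by auto
  moreover have "e = (\<lambda>n. Rep_number (Abs_number (e n)))" by (simp add: Abs_number_inverse)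
  ultimately have "\<not> holds (\<lambda>n. Abs_number (e n)) S q" unfolding holds_number[OF K] by simp
  then show False using assms(1) q(1) by blast
qed

lemma holds_sigma1_induct:
  fixes e :: "nat \<Rightarrow> 'a::RCA0_model"
  assumes "sigma1 p" "holds (case_nat 0 e) S p"
    and "\<And>x. holds (case_nat x e) S p \<Longrightarrow> holds (case_nat (x + 1) e) S p"
  shows "holds (case_nat x e) S p"
  using holds_RCA0[OF induction_axiom_RCA0[OF assms(1)], of e S] assms(2,3)
  unfolding sat_induction_axiom by blast

lemma
  fixes x y :: "'a::RCA0_model"
  shows succ_nonzero: "x + 1 \<noteq> 0"
    and succ_inject: "x + 1 = y + 1 \<Longrightarrow> x = y"
    and plus_zero: "x + 0 = x"
    and plus_succ: "x + (y + 1) = (x + y) + 1"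
    and times_zero: "x * 0 = 0"
    and times_succ: "x * (y + 1) = x * y + x"
    and not_less_zero: "\<not> x < 0"
    and less_succ: "x < y + 1 \<longleftrightarrow> x < y \<or> x = y"
proof -
  have *: "holds (case_nat x (\<lambda>_. y)) S p" if "p \<in> basic_axioms" for p S
    using that by (intro holds_RCA0) (simp add: RCA0_def)
  note ax = *[unfolded basic_axioms_def]
  show "x + 1 \<noteq> 0" using ax[of "\<^bold>\<not> (Var 0 \<^bold>+ \<^bold>1 \<^bold>= \<^bold>0)"] by simp
  show "x + 1 = y + 1 \<Longrightarrow> x = y" using ax[of "Var 0 \<^bold>+ \<^bold>1 \<^bold>= Var 1 \<^bold>+ \<^bold>1 \<^bold>\<longrightarrow> Var 0 \<^bold>= Var 1"] by simp
  show "x + 0 = x" using ax[of "Var 0 \<^bold>+ \<^bold>0 \<^bold>= Var 0"] by simp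
  show "x + (y + 1) = (x + y) + 1" using ax[of "Var 0 \<^bold>+ (Var 1 \<^bold>+ \<^bold>1) \<^bold>= (Var 0 \<^bold>+ Var 1) \<^bold>+ \<^bold>1"] by simp
  show "x * 0 = 0" using ax[of "Var 0 \<^bold>* \<^bold>0 \<^bold>= \<^bold>0"] by simp
  show "x * (y + 1) = x * y + x" using ax[of "Var 0 \<^bold>* (Var 1 \<^bold>+ \<^bold>1) \<^bold>= (Var 0 \<^bold>* Var 1) \<^bold>+ Var 0"] by simp
  show "\<not> x < 0" using ax[of "\<^bold>\<not> (Var 0 \<^bold>< \<^bold>0)"] by simp
  show "x < y + 1 \<longleftrightarrow> x < y \<or> x = y"
    using ax[of "Var 0 \<^bold>< Var 1 \<^bold>+ \<^bold>1 \<^bold>\<longleftrightarrow> Var 0 \<^bold>< Var 1 \<^bold>\<or> Var 0 \<^bold>= Var 1"] by auto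
qed

section \<open>Definable predicates\<close>

text \<open>
  The formulas stay implicit: a predicate on environments is \<open>delta\<close> if it is given by a bounded
  formula with number and set parameters. Each variable of that formula stands for a variable of
  the environment or for a parameter; this is the meaning of \<open>coord\<close>.
\<close>

definition coord :: "((nat \<Rightarrow> 'a) \<Rightarrow> nat \<Rightarrow> 'a) \<Rightarrow> bool" where
  "coord \<eta> \<longleftrightarrow> (\<forall>i. (\<exists>n. \<forall>e. \<eta> e i = e n) \<or> (\<exists>c. \<forall>e. \<eta> e i = c))"

definition trm :: "((nat \<Rightarrow> 'a::RCA0_model) \<Rightarrow> 'a) \<Rightarrow> bool" where
  "trm f \<longleftrightarrow> (\<exists>t \<eta>. coord \<eta> \<and> (\<forall>e. val (\<eta> e) t = f e))"

definition delta :: "((nat \<Rightarrow> 'a::RCA0_model) \<Rightarrow> bool) \<Rightarrow> bool" where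
  "delta P \<longleftrightarrow> (\<exists>p \<eta> S. delta0 p \<and> coord \<eta> \<and> (\<forall>e. holds (\<eta> e) S p \<longleftrightarrow> P e))"

text \<open>The convention for all quantifiers below: in the matrix \<open>e 0\<close> is the bound
  variable, and \<open>\<lambda>n. e (Suc n)\<close> is the environment outside of the
  quantifier.\<close>

definition sigma :: "((nat \<Rightarrow> 'a::RCA0_model) \<Rightarrow> bool) \<Rightarrow> bool" where
  "sigma P \<longleftrightarrow> (\<exists>Q. delta (\<lambda>e. Q (e 0) (\<lambda>n. e (Suc n))) \<and> (\<forall>e. P e \<longleftrightarrow> (\<exists>y. Q y e)))"

text \<open>Makes room for two formulas in one environment: the variables of one move to the even
  places, those of the other to the odd places.\<close>

definition interleave :: "(nat \<Rightarrow> 'b) \<Rightarrow> (nat \<Rightarrow> 'b) \<Rightarrow> nat \<Rightarrow> 'b" where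
  "interleave f g n = (if even n then f (n div 2) else g (n div 2))"

lemma interleave_simps [simp]: "interleave f g (2 * n) = f n" "interleave f g (Suc (2 * n)) = g n"
  by (simp_all add: interleave_def)

lemma coord_interleave: "coord \<eta> \<Longrightarrow> coord \<theta> \<Longrightarrow> coord (\<lambda>e. interleave (\<eta> e) (\<theta> e))"
  unfolding coord_def interleave_def by (intro allI, rename_tac i, case_tac "even i") auto

lemma trmI: "coord \<eta> \<Longrightarrow> (\<And>e. val (\<eta> e) t = f e) \<Longrightarrow> trm f"
  unfolding trm_def by blast

lemma deltaI: "delta0 p \<Longrightarrow> coord \<eta> \<Longrightarrow> (\<And>e. holds (\<eta> e) S p \<longleftrightarrow> P e) \<Longrightarrow> delta P"
  unfolding delta_def by blast

lemma coord_comp: "coord \<eta> \<Longrightarrow> coord \<theta> \<Longrightarrow> coord (\<lambda>e. \<eta> (\<theta> e))"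
  unfolding coord_def by metis

lemma coord_reindex: "coord (\<lambda>e n. e (k n))"
  unfolding coord_def by blast

lemma delta_common:
  fixes P Q :: "(nat \<Rightarrow> 'a::RCA0_model) \<Rightarrow> bool"
  assumes "delta P" "delta Q"
  obtains p q \<eta> S where "delta0 p" "delta0 q" "coord \<eta>"
    "\<And>e. holds (\<eta> e) S p \<longleftrightarrow> P e" "\<And>e. holds (\<eta> e) S q \<longleftrightarrow> Q e"
proof -
  from assms obtain p q \<eta> \<theta> S R where *: "delta0 p" "delta0 q" "coord \<eta>" "coord \<theta>"
    "\<And>e. holds (\<eta> e) S p \<longleftrightarrow> P e" "\<And>e. holds (\<theta> e) R q \<longleftrightarrow> Q e"
    unfolding delta_def by metis
  show ?thesis
  proof
    show "delta0 (substN (\<lambda>n. Var (2 * n)) (substS (\<lambda>n. 2 * n) p))"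
      "delta0 (substN (\<lambda>n. Var (Suc (2 * n))) (substS (\<lambda>n. Suc (2 * n)) q))"
      by (simp_all add: * delta0_substN delta0_substS)
    show "coord (\<lambda>e. interleave (\<eta> e) (\<theta> e))" by (rule coord_interleave) fact+
    show "holds (interleave (\<eta> e) (\<theta> e)) (interleave S R)
        (substN (\<lambda>n. Var (2 * n)) (substS (\<lambda>n. 2 * n) p)) \<longleftrightarrow> P e" for e
      by (simp add: sat_substN sat_substS *)
    show "holds (interleave (\<eta> e) (\<theta> e)) (interleave S R)
        (substN (\<lambda>n. Var (Suc (2 * n))) (substS (\<lambda>n. Suc (2 * n)) q)) \<longleftrightarrow> Q e" for e
      by (simp add: sat_substN sat_substS *)
  qed
qed

lemma trm_common:
  fixes f g :: "(nat \<Rightarrow> 'a::RCA0_model) \<Rightarrow> 'a"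
  assumes "trm f" "trm g"
  obtains s t \<eta> where "coord \<eta>" "\<And>e. val (\<eta> e) s = f e" "\<And>e. val (\<eta> e) t = g e"
proof -
  from assms obtain s t \<eta> \<theta> where *: "coord \<eta>" "coord \<theta>"
    "\<And>e. val (\<eta> e) s = f e" "\<And>e. val (\<theta> e) t = g e"
    unfolding trm_def by metis
  show ?thesis
  proof
    show "coord (\<lambda>e. interleave (\<eta> e) (\<theta> e))" by (rule coord_interleave) fact+
    show "val (interleave (\<eta> e) (\<theta> e)) (subst_tm (\<lambda>n. Var (2 * n)) s) = f e"
      "val (interleave (\<eta> e) (\<theta> e)) (subst_tm (\<lambda>n. Var (Suc (2 * n))) t) = g e" for e
      by (simp_all add: eval_subst *)
  qed
qed

lemma trm_var: "trm (\<lambda>e. e n)"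
  unfolding trm_def coord_def by (intro exI[of _ "Var n"] exI[of _ "\<lambda>e. e"]) auto

lemma trm_const: "trm (\<lambda>e. c)"
  unfolding trm_def coord_def by (intro exI[of _ "Var 0"] exI[of _ "\<lambda>e n. c"]) auto

lemma trm_add: "trm f \<Longrightarrow> trm g \<Longrightarrow> trm (\<lambda>e. f e + g e)"
proof (erule (1) trm_common)
  fix \<eta> s t assume "coord \<eta>" "\<And>e. val (\<eta> e) s = f e" "\<And>e. val (\<eta> e) t = g e"
  then show "trm (\<lambda>e. f e + g e)" by (intro trmI[of \<eta> "s \<^bold>+ t"]) simp_all
qed

lemma trm_mult: "trm f \<Longrightarrow> trm g \<Longrightarrow> trm (\<lambda>e. f e * g e)"
proof (erule (1) trm_common)
  fix \<eta> s t assume "coord \<eta>" "\<And>e. val (\<eta> e) s = f e" "\<And>e. val (\<eta> e) t = g e"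
  then show "trm (\<lambda>e. f e * g e)" by (intro trmI[of \<eta> "s \<^bold>* t"]) simp_all
qed

lemma delta_eq: "trm f \<Longrightarrow> trm g \<Longrightarrow> delta (\<lambda>e. f e = g e)"
proof (erule (1) trm_common)
  fix \<eta> s t assume "coord \<eta>" "\<And>e. val (\<eta> e) s = f e" "\<And>e. val (\<eta> e) t = g e"
  then show "delta (\<lambda>e. f e = g e)" by (intro deltaI[of "s \<^bold>= t" \<eta>]) (simp_all add: delta0.intros)
qed

lemma delta_less: "trm f \<Longrightarrow> trm g \<Longrightarrow> delta (\<lambda>e. f e < g e)"
proof (erule (1) trm_common)
  fix \<eta> s t assume "coord \<eta>" "\<And>e. val (\<eta> e) s = f e" "\<And>e. val (\<eta> e) t = g e"
  then show "delta (\<lambda>e. f e < g e)" by (intro deltaI[of "s \<^bold>< t" \<eta>]) (simp_all add: delta0.intros)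
qed

lemma delta_mem: "trm f \<Longrightarrow> delta (\<lambda>e. mem X (f e))"
proof -
  assume "trm f"
  then obtain t \<eta> where "coord \<eta>" "\<And>e. val (\<eta> e) t = f e" unfolding trm_def by blast
  then show ?thesis
    unfolding delta_def
    by (intro exI[of _ "t \<^bold>\<in> 0"] exI[of _ \<eta>] exI[of _ "\<lambda>_. X"]) (simp add: delta0.intros)
qed

lemma delta_imp: "delta P \<Longrightarrow> delta Q \<Longrightarrow> delta (\<lambda>e. P e \<longrightarrow> Q e)"
proof (erule (1) delta_common)
  fix p q \<eta> S
  assume "delta0 p" "delta0 q" "coord \<eta>"
    "\<And>e. holds (\<eta> e) S p \<longleftrightarrow> P e" "\<And>e. holds (\<eta> e) S q \<longleftrightarrow> Q e"
  then show "delta (\<lambda>e. P e \<longrightarrow> Q e)"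
    by (intro deltaI[of "p \<^bold>\<longrightarrow> q" \<eta> S]) (simp_all add: delta0.intros)
qed

lemma delta_False: "delta (\<lambda>e. False)"
  unfolding delta_def by (intro exI[of _ Fls] exI[of _ "\<lambda>e. e"]) (auto simp: coord_def delta0.intros)

lemma delta_not: "delta P \<Longrightarrow> delta (\<lambda>e. \<not> P e)"
  using delta_imp[OF _ delta_False] by simp

lemma delta_bool: "delta (\<lambda>e. b)"
  by (cases b) (use delta_False delta_not[OF delta_False] in simp_all)

lemma delta_conj: "delta P \<Longrightarrow> delta Q \<Longrightarrow> delta (\<lambda>e. P e \<and> Q e)"
  using delta_not[OF delta_imp[OF _ delta_not]] by simp

lemma delta_disj: "delta P \<Longrightarrow> delta Q \<Longrightarrow> delta (\<lambda>e. P e \<or> Q e)"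
  using delta_imp[OF delta_not] by (simp add: disj_imp)

lemma delta_le: "trm f \<Longrightarrow> trm g \<Longrightarrow> delta (\<lambda>e. f e \<le> g e)"
  unfolding le_iff_less_or_eq by (intro delta_disj delta_eq delta_less)

lemma delta_all:
  fixes Q :: "'a::RCA0_model \<Rightarrow> (nat \<Rightarrow> 'a) \<Rightarrow> bool"
  assumes "trm f" "delta (\<lambda>e. Q (e 0) (\<lambda>n. e (Suc n)))"
  shows "delta (\<lambda>e. \<forall>y<f e. Q y e)"
proof -
  from assms obtain t \<theta> where f: "coord \<theta>" "\<And>e. val (\<theta> e) t = f e" unfolding trm_def by blast
  from assms obtain p \<eta> S where p: "delta0 p" "coord \<eta>"
    "\<And>e. holds (\<eta> e) S p \<longleftrightarrow> Q (e 0) (\<lambda>n. e (Suc n))"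
    unfolding delta_def by blast
  \<comment> \<open>\<open>z i\<close> says that variable \<open>i\<close> of \<open>p\<close>
    stands for the quantified variable. Several variables may do so, and \<open>\<sigma>\<close>
    sends them all to the one that \<open>AllN\<close> binds; the \<open>Suc\<close> for the others
    steps over this binder.\<close>
  define z where "z i \<longleftrightarrow> (\<forall>e. \<eta> e i = e 0)" for i
  define \<sigma> where "\<sigma> i = Var (if z i then 0 else Suc (2 * i))" for i
  define t' where "t' = subst_tm (\<lambda>n. Var (Suc (2 * n))) t"
  \<comment> \<open>The \<open>0\<close> in \<open>case_nat 0 e\<close> is a dummy: the even half is
    read only at places \<open>i\<close> where \<open>z i\<close> fails, and these do not depend on
    it.\<close>
  define \<zeta> where "\<zeta> e = interleave (\<eta> (case_nat 0 e)) (\<theta> e)" for e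
  have cases: "z i \<or> (\<exists>n. \<forall>e. \<eta> e i = e (Suc n)) \<or> (\<exists>c. \<forall>e. \<eta> e i = c)" for i
    using p(2) unfolding coord_def z_def by (metis not0_implies_Suc)
  have "coord (\<lambda>e. \<eta> (case_nat 0 e))"
    unfolding coord_def using cases unfolding z_def by (metis nat.case)
  then have \<zeta>: "coord \<zeta>" unfolding \<zeta>_def using f(1) by (rule coord_interleave)
  have "val (case_nat y (\<zeta> e)) (\<sigma> i) = \<eta> (case_nat y e) i" for y e i
    using cases[of i] by (auto simp: \<sigma>_def \<zeta>_def z_def)
  then have "holds (\<zeta> e) S (AllN (Var 0 \<^bold>< up t' \<^bold>\<longrightarrow> substN \<sigma> p)) \<longleftrightarrow> (\<forall>y<f e. Q y e)" for e
    by (simp add: sat_substN p(3)) (simp add: t'_def eval_subst \<zeta>_def f(2))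
  moreover have "delta0 (AllN (Var 0 \<^bold>< up t' \<^bold>\<longrightarrow> substN \<sigma> p))"
    by (intro delta0.intros delta0_substN p(1))
  ultimately show ?thesis unfolding delta_def using \<zeta> by blast
qed

lemma delta_ex:
  "trm f \<Longrightarrow> delta (\<lambda>e. Q (e 0) (\<lambda>n. e (Suc n))) \<Longrightarrow> delta (\<lambda>e. \<exists>y<f e. Q y e)"
  using delta_not[OF delta_all[of f "\<lambda>y e. \<not> Q y e", OF _ delta_not]] by simp

lemma delta_coord: "delta P \<Longrightarrow> coord \<theta> \<Longrightarrow> delta (\<lambda>e. P (\<theta> e))"
  unfolding delta_def by (metis coord_comp)

lemmas delta_intros = trm_var trm_const trm_add trm_mult delta_eq delta_less delta_mem delta_imp
  delta_not delta_bool delta_conj delta_disj delta_le delta_all delta_ex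

lemma sigma_delta: "delta P \<Longrightarrow> sigma P"
  unfolding sigma_def using delta_coord[OF _ coord_reindex, of P Suc] by (intro exI[of _ "\<lambda>_. P"]) simp

text \<open>Brings implicit predicates back to genuine formulas, to which the axioms apply. There
  are two of them over a common \<open>a\<close> and \<open>S\<close> because comprehension takes a
  predicate along with its complement.\<close>

lemma sigma_normal_form:
  fixes P R :: "'a::RCA0_model \<Rightarrow> bool"
  assumes "sigma (\<lambda>e. P (e 0))" "sigma (\<lambda>e. R (e 0))"
  obtains p q a S where "sigma1 (ExN p)" "sigma1 (ExN q)"
    "\<And>x. holds (case_nat x a) S (ExN p) \<longleftrightarrow> P x" "\<And>x. holds (case_nat x a) S (ExN q) \<longleftrightarrow> R x"
proof -
  from assms(1) obtain Q where Q: "delta (\<lambda>e. Q (e 0) (\<lambda>n. e (Suc n)))" "\<forall>e. P (e 0) \<longleftrightarrow> (\<exists>y. Q y e)"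
    unfolding sigma_def by blast
  from assms(2) obtain Q' where Q': "delta (\<lambda>e. Q' (e 0) (\<lambda>n. e (Suc n)))" "\<forall>e. R (e 0) \<longleftrightarrow> (\<exists>y. Q' y e)"
    unfolding sigma_def by blast
  obtain p q \<eta> S where p: "delta0 p" "delta0 q" "coord \<eta>"
    "\<And>e. holds (\<eta> e) S p \<longleftrightarrow> Q (e 0) (\<lambda>n. e (Suc n))"
    "\<And>e. holds (\<eta> e) S q \<longleftrightarrow> Q' (e 0) (\<lambda>n. e (Suc n))"
    by (rule delta_common[OF Q(1) Q'(1)]) (rule that)
  \<comment> \<open>Variable \<open>0\<close> becomes the witness and variable \<open>1\<close> the
    argument. Everything else is read off from \<open>a\<close>, where the rest of the environment
    is fixed at \<open>0\<close>; this is harmless as \<open>P\<close> and \<open>R\<close> look at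
    \<open>e 0\<close> only.\<close>
  define \<sigma> where "\<sigma> i = Var (if \<forall>e. \<eta> e i = e 0 then 0 else if \<forall>e. \<eta> e i = e 1 then 1 else Suc (Suc i))" for i
  define a where "a = \<eta> (\<lambda>_. 0)"
  have cases: "(\<forall>e. \<eta> e i = e 0) \<or> (\<forall>e. \<eta> e i = e 1) \<or> (\<exists>n. \<forall>e. \<eta> e i = e (Suc (Suc n))) \<or> (\<exists>c. \<forall>e. \<eta> e i = c)" for i
  proof -
    consider n where "\<forall>e. \<eta> e i = e n" | c where "\<forall>e. \<eta> e i = c"
      using p(3) unfolding coord_def by blast
    then show ?thesis
    proof cases
      case (1 n)
      then show ?thesis by (cases n; cases "n - 1") auto
    qed blast
  qed
  have "val (case_nat y (case_nat x a)) (\<sigma> i) = \<eta> (case_nat y (case_nat x (\<lambda>_. 0))) i" for x y i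
    using cases[of i] by (auto simp: \<sigma>_def a_def)
  then have *: "holds (case_nat y (case_nat x a)) S (substN \<sigma> p) \<longleftrightarrow> Q y (case_nat x (\<lambda>_. 0))"
    "holds (case_nat y (case_nat x a)) S (substN \<sigma> q) \<longleftrightarrow> Q' y (case_nat x (\<lambda>_. 0))" for x y
    by (simp_all add: sat_substN p)
  show ?thesis
  proof
    show "sigma1 (ExN (substN \<sigma> p))" "sigma1 (ExN (substN \<sigma> q))"
      unfolding sigma1_def using p(1,2) delta0_substN by blast+
    show "holds (case_nat x a) S (ExN (substN \<sigma> p)) \<longleftrightarrow> P x" 
      "holds (case_nat x a) S (ExN (substN \<sigma> q)) \<longleftrightarrow> R x" for x
      using Q(2)[rule_format, of "case_nat x (\<lambda>_. 0)"] Q'(2)[rule_format, of "case_nat x (\<lambda>_. 0)"] by (simp_all add: *)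
  qed
qed

lemma sigma_induct:
  fixes x :: "'a::RCA0_model"
  assumes "sigma (\<lambda>e. P (e 0))" "P 0" "\<And>x. P x \<Longrightarrow> P (x + 1)"
  shows "P x"
proof -
  obtain p a S where p: "sigma1 (ExN p)" "\<And>x. holds (case_nat x a) S (ExN p) \<longleftrightarrow> P x"
    by (rule sigma_normal_form[OF assms(1) assms(1)]) (rule that)
  show ?thesis
    using holds_sigma1_induct[OF p(1), of a S x] assms(2,3) unfolding p(2) by blast
qed

lemmas delta_induct = sigma_induct[OF sigma_delta]

lemma comprehension:
  fixes P :: "'a::RCA0_model \<Rightarrow> bool"
  assumes "sigma (\<lambda>e. P (e 0))" "sigma (\<lambda>e. \<not> P (e 0))"
  obtains X where "\<And>x. mem X x \<longleftrightarrow> P x"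
proof -
  obtain p q a S where p: "sigma1 (ExN p)" "sigma1 (ExN q)"
    "\<And>x. holds (case_nat x a) S (ExN p) \<longleftrightarrow> P x" "\<And>x. holds (case_nat x a) S (ExN q) \<longleftrightarrow> \<not> P x"
    by (rule sigma_normal_form[OF assms]) (rule that)
  have "delta0 q" using p(2) unfolding sigma1_def by auto
  \<comment> \<open>As \<open>q\<close> is the matrix of the complement, this is the \<Pi>1 form of
    \<open>P\<close>.\<close>
  then have "pi1 (AllN (\<^bold>\<not> q))" unfolding pi1_def by (auto intro: delta0.intros)
  from holds_RCA0[OF comprehension_axiom_RCA0[OF p(1) this], of a S]
  have "(\<forall>x. P x \<longleftrightarrow> holds (case_nat x a) S (AllN (\<^bold>\<not> q))) \<longrightarrow> (\<exists>X. \<forall>x. mem X x \<longleftrightarrow> P x)"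
    unfolding sat_comprehension_axiom p(3) .
  moreover have "P x \<longleftrightarrow> holds (case_nat x a) S (AllN (\<^bold>\<not> q))" for x
    using p(4)[of x] by auto
  ultimately have "\<exists>X. \<forall>x. mem X x \<longleftrightarrow> P x" by blast
  then show ?thesis using that by blast
qed

section \<open>Arithmetic in models of RCA0\<close>

lemma plus_assoc: "(x + y) + z = x + (y + z)" for x y z :: "'a::RCA0_model"
  by (rule delta_induct[where x = z]) (intro delta_intros, simp_all add: plus_zero plus_succ)

lemma zero_plus: "0 + x = x" for x :: "'a::RCA0_model"
  by (rule delta_induct[where x = x]) (intro delta_intros, simp_all add: plus_zero plus_succ)

lemma succ_plus: "(x + 1) + y = (x + y) + 1" for x y :: "'a::RCA0_model"
  by (rule delta_induct[where x = y]) (intro delta_intros, simp_all add: plus_zero plus_succ)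

lemma plus_commute: "x + y = y + x" for x y :: "'a::RCA0_model"
  by (rule delta_induct[where x = y]) (intro delta_intros, simp_all add: plus_zero zero_plus plus_succ succ_plus)

lemma plus_left_commute: "x + (y + z) = y + (x + z)" for x y z :: "'a::RCA0_model"
  by (metis plus_assoc plus_commute)

lemmas plus_ac = plus_assoc plus_commute plus_left_commute

lemma times_plus: "x * (y + z) = x * y + x * z" for x y z :: "'a::RCA0_model"
proof (rule delta_induct[where x = z])
  fix z assume "x * (y + z) = x * y + x * z"
  then show "x * (y + (z + 1)) = x * y + x * (z + 1)"
    by (simp add: plus_succ times_succ) (simp add: plus_assoc)
qed (intro delta_intros, simp add: plus_zero times_zero)

lemma zero_times: "0 * x = 0" for x :: "'a::RCA0_model"
  by (rule delta_induct[where x = x]) (intro delta_intros, simp_all add: times_zero times_succ plus_zero)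

lemma succ_times: "(x + 1) * y = x * y + y" for x y :: "'a::RCA0_model"
proof (rule delta_induct[where x = y])
  fix y assume "(x + 1) * y = x * y + y"
  then show "(x + 1) * (y + 1) = x * (y + 1) + (y + 1)"
    by (simp add: times_succ plus_succ) (simp add: plus_ac)
qed (intro delta_intros, simp add: times_zero plus_zero)

lemma times_commute: "x * y = y * x" for x y :: "'a::RCA0_model"
  by (rule delta_induct[where x = y])
    (intro delta_intros, simp_all add: times_zero zero_times times_succ succ_times)

lemma one_times: "1 * x = x" for x :: "'a::RCA0_model"
  by (metis plus_commute plus_zero succ_times zero_times)

lemma times_one: "x * 1 = x" for x :: "'a::RCA0_model"
  using times_commute one_times by metis

lemma times_assoc: "(x * y) * z = x * (y * z)" for x y z :: "'a::RCA0_model"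
  by (rule delta_induct[where x = z])
    (intro delta_intros, simp_all add: times_zero times_succ times_plus times_one)

lemma plus_cancel: "x + z = y + z \<Longrightarrow> x = y" for x y z :: "'a::RCA0_model"
proof -
  have "x + z = y + z \<longrightarrow> x = y"
    by (rule delta_induct[where x = z])
      (intro delta_intros, use succ_inject in \<open>auto simp: plus_zero plus_succ\<close>)
  then show "x + z = y + z \<Longrightarrow> x = y" ..
qed

lemma zero_or_succ: "x = 0 \<or> (\<exists>y. x = y + 1)" for x :: "'a::RCA0_model"
proof -
  \<comment> \<open>The predecessor is searched below \<open>x\<close>, so that the induction
    formula is bounded.\<close>
  have "x = 0 \<or> (\<exists>y<x. x = y + 1)"
    by (rule delta_induct[where x = x]) (intro delta_intros, auto simp: less_succ)
  then show ?thesis by blast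
qed

lemma less_plus_succ: "x < x + (d + 1)" for x d :: "'a::RCA0_model"
  by (rule delta_induct[where x = d])
    (intro delta_intros, simp_all add: zero_plus less_succ plus_succ plus_zero)

lemma sigma_ex0: "delta (\<lambda>e. Q (e 0) (\<lambda>n. e (Suc n))) \<Longrightarrow> sigma (\<lambda>e. \<exists>y. Q y e)"
  unfolding sigma_def by blast

lemma less_iff_plus: "x < y \<longleftrightarrow> (\<exists>d. y = x + (d + 1))" for x y :: "'a::RCA0_model"
proof -
  \<comment> \<open>The quantifier stands in front of the implication to put the induction formula
    into \<Sigma>1 form.\<close>
  have "\<exists>d. x < y \<longrightarrow> y = x + (d + 1)"
  proof (rule sigma_induct[where x = y])
    fix y assume "\<exists>d. x < y \<longrightarrow> y = x + (d + 1)"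
    then obtain d where d: "x < y \<longrightarrow> y = x + (d + 1)" ..
    show "\<exists>d. x < y + 1 \<longrightarrow> y + 1 = x + (d + 1)"
    proof (cases "x < y")
      case True
      then have "y + 1 = x + ((d + 1) + 1)" using d plus_assoc by simp
      then show ?thesis by blast
    next
      case False
      then show ?thesis by (intro exI[of _ 0]) (simp add: less_succ zero_plus)
    qed
  next
    show "\<exists>d. x < 0 \<longrightarrow> 0 = x + (d + 1)" by (simp add: not_less_zero)
  qed (intro sigma_ex0 delta_intros)
  then show ?thesis using less_plus_succ by blast
qed

lemma less_irrefl: "\<not> x < x" for x :: "'a::RCA0_model"
proof
  assume "x < x"
  then obtain d where "x = x + (d + 1)" unfolding less_iff_plus ..
  then have "0 + x = (d + 1) + x" by (simp add: zero_plus plus_commute)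
  then show False using plus_cancel succ_nonzero by metis
qed

lemma less_trans: "x < y \<Longrightarrow> y < z \<Longrightarrow> x < z" for x y z :: "'a::RCA0_model"
  unfolding less_iff_plus by (metis plus_assoc)

lemma less_linear: "x < y \<or> x = y \<or> y < x" for x y :: "'a::RCA0_model"
proof (rule delta_induct[where x = y])
  show "x < 0 \<or> x = 0 \<or> 0 < x"
    using zero_or_succ[of x] unfolding less_iff_plus by (auto simp: zero_plus)
next
  fix y assume "x < y \<or> x = y \<or> y < x"
  then show "x < y + 1 \<or> x = y + 1 \<or> y + 1 < x"
  proof (elim disjE)
    assume "y < x"
    then obtain d where d: "x = y + (d + 1)" unfolding less_iff_plus ..
    from zero_or_succ[of d] show ?thesis
    proof (elim disjE exE)
      fix c assume "d = c + 1"
      then have "x = (y + 1) + (c + 1)" using d by (simp add: plus_ac)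
      then show ?thesis using less_iff_plus by blast
    qed (simp add: d zero_plus)
  qed (simp_all add: less_succ)
qed (intro delta_intros)

lemma le_iff_plus: "x \<le> y \<longleftrightarrow> (\<exists>d. y = x + d)" for x y :: "'a::RCA0_model"
proof
  show "x \<le> y \<Longrightarrow> \<exists>d. y = x + d" 
    unfolding le_iff_less_or_eq less_iff_plus by (metis plus_zero)
  assume "\<exists>d. y = x + d"
  then obtain d where d: "y = x + d" ..
  from zero_or_succ[of d] show "x \<le> y"
    unfolding le_iff_less_or_eq d using less_plus_succ by (auto simp: plus_zero)
qed

instance RCA0_model \<subseteq> comm_semiring_1
proof
  fix a b c :: "'a::RCA0_model"
  show "a + b + c = a + (b + c)" by (rule plus_assoc)
  show "a + b = b + a" by (rule plus_commute)
  show "0 + a = a" by (rule zero_plus)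
  show "a * b * c = a * (b * c)" by (rule times_assoc)
  show "a * b = b * a" by (rule times_commute)
  show "1 * a = a" by (rule one_times)
  show "(a + b) * c = a * c + b * c" by (simp only: times_commute[of _ c] times_plus)
  show "0 * a = 0" by (rule zero_times)
  show "a * 0 = 0" by (rule times_zero)
  show "(0::'a) \<noteq> 1" using succ_nonzero[of "0::'a"] by (metis zero_plus)
qed

instance RCA0_model \<subseteq> linorder
proof
  fix a b c :: "'a::RCA0_model"
  show "(a < b) = (a \<le> b \<and> \<not> b \<le> a)"
    unfolding le_iff_less_or_eq by (metis less_irrefl less_trans)
  show "a \<le> a" unfolding le_iff_less_or_eq by blast
  show "a \<le> b \<Longrightarrow> b \<le> c \<Longrightarrow> a \<le> c" unfolding le_iff_less_or_eq by (metis less_trans)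
  show "a \<le> b \<Longrightarrow> b \<le> a \<Longrightarrow> a = b" unfolding le_iff_less_or_eq by (metis less_irrefl less_trans)
  show "a \<le> b \<or> b \<le> a" unfolding le_iff_less_or_eq using less_linear[of a b] by blast
qed

instance RCA0_model \<subseteq> canonically_ordered_monoid_add
  by standard (rule le_iff_plus)

lemma discrete: "x < y \<longleftrightarrow> x + 1 \<le> y" for x y :: "'a::RCA0_model"
  unfolding less_iff_plus le_iff_plus by (simp only: ac_simps)

lemma plus_less_cancel: "x + z < y + z \<longleftrightarrow> x < y" for x y z :: "'a::RCA0_model"
proof
  assume "x + z < y + z"
  then obtain d where "y + z = (x + z) + (d + 1)" unfolding less_iff_plus ..
  then have "y + z = (x + (d + 1)) + z" by (simp only: ac_simps)
  then show "x < y" unfolding less_iff_plus using plus_cancel by blast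
next
  assume "x < y"
  then obtain d where "y = x + (d + 1)" unfolding less_iff_plus ..
  then have "y + z = (x + z) + (d + 1)" by (simp only: ac_simps)
  then show "x + z < y + z" unfolding less_iff_plus ..
qed

lemma plus_le_cancel: "x + z \<le> y + z \<longleftrightarrow> x \<le> y" for x y z :: "'a::RCA0_model"
  using plus_less_cancel[of y z x] by (simp only: not_less[symmetric])

subsection \<open>The ring of differences\<close>

text \<open>Linear arithmetic is decided in an ordered ring, into which the numbers embed.\<close>

quotient_type (overloaded) 'a diff = "'a::RCA0_model \<times> 'a" / "\<lambda>(x, y) (u, v). x + v = u + y"
proof (intro equivpI reflpI sympI transpI; clarify)
  fix a b c d e f :: 'a
  assume "a + d = c + b" "c + f = e + d"
  then have "(a + f) + d = (e + b) + d" by (metis add.assoc add.commute)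
  then show "a + f = e + b" by (rule plus_cancel)
qed auto

instantiation diff :: (RCA0_model) linordered_idom
begin

lift_definition zero_diff :: "'a diff" is "(0, 0)" .
lift_definition one_diff :: "'a diff" is "(1, 0)" .
lift_definition plus_diff :: "'a diff \<Rightarrow> 'a diff \<Rightarrow> 'a diff" is "\<lambda>(x, y) (u, v). (x + u, y + v)"
proof clarify
  fix x y u v x' y' u' v' :: 'a
  assume "x + y' = x' + y" "u + v' = u' + v"
  then have "(x + y') + (u + v') = (x' + y) + (u' + v)" by simp
  then show "(x + u) + (y' + v') = (x' + u') + (y + v)" by (simp only: ac_simps)
qed
lift_definition uminus_diff :: "'a diff \<Rightarrow> 'a diff" is "\<lambda>(x, y). (y, x)"
  by clarify (simp only: add.commute)
lift_definition minus_diff :: "'a diff \<Rightarrow> 'a diff \<Rightarrow> 'a diff" is "\<lambda>(x, y) (u, v). (x + v, y + u)"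
proof clarify
  fix x y u v x' y' u' v' :: 'a
  assume "x + y' = x' + y" "u + v' = u' + v"
  then have "(x + y') + (u' + v) = (x' + y) + (u + v')" by simp
  then show "(x + v) + (y' + u') = (x' + v') + (y + u)" by (simp only: ac_simps)
qed
lift_definition times_diff :: "'a diff \<Rightarrow> 'a diff \<Rightarrow> 'a diff"
  is "\<lambda>(x, y) (u, v). (x * u + y * v, x * v + y * u)"
proof clarify
  fix x y u v x' y' u' v' :: 'a
  assume 1: "x + y' = x' + y" and 2: "u + v' = u' + v"
  \<comment> \<open>One factor is exchanged at a time, by way of the product of
    \<open>(x', y')\<close> and \<open>(u, v)\<close>. The two resulting equations are added, and
    the terms of the middle product cancel.\<close>
  have "(x * u + y * v) + (x' * v + y' * u) = (x + y') * u + (x' + y) * v"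
    and "(x' * u + y' * v) + (x * v + y * u) = (x' + y) * u + (x + y') * v"
    and "(x' * u + y' * v) + (x' * v' + y' * u') = x' * (u + v') + y' * (u' + v)"
    and "(x' * u' + y' * v') + (x' * v + y' * u) = x' * (u' + v) + y' * (u + v')"
    by (simp_all add: algebra_simps)
  then have "(x * u + y * v) + (x' * v + y' * u) = (x' * u + y' * v) + (x * v + y * u)"
    and "(x' * u + y' * v) + (x' * v' + y' * u') = (x' * u' + y' * v') + (x' * v + y' * u)"
    using 1 2 by simp_all
  then have "((x * u + y * v) + (x' * v + y' * u)) + ((x' * u + y' * v) + (x' * v' + y' * u')) =
      ((x' * u + y' * v) + (x * v + y * u)) + ((x' * u' + y' * v') + (x' * v + y' * u))"
    by simp
  then have "((x * u + y * v) + (x' * v' + y' * u')) + ((x' * v + y' * u) + (x' * u + y' * v)) =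
      ((x' * u' + y' * v') + (x * v + y * u)) + ((x' * v + y' * u) + (x' * u + y' * v))"
    by (simp only: ac_simps)
  then show "(x * u + y * v) + (x' * v' + y' * u') = (x' * u' + y' * v') + (x * v + y * u)"
    by (rule plus_cancel)
qed
lift_definition less_eq_diff :: "'a diff \<Rightarrow> 'a diff \<Rightarrow> bool" is "\<lambda>(x, y) (u, v). x + v \<le> u + y"
proof clarify
  fix x y u v x' y' u' v' :: 'a
  assume "x + y' = x' + y" "u + v' = u' + v"
  then have "(x + y') + (v + v') \<le> (u + v') + (y + y') \<longleftrightarrow> (x' + y) + (v + v') \<le> (u' + v) + (y + y')"
    by simp
  then have "(x + v) + (y' + v') \<le> (u + y) + (y' + v') \<longleftrightarrow> (x' + v') + (y + v) \<le> (u' + y') + (y + v)"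
    by (simp only: ac_simps)
  then show "x + v \<le> u + y \<longleftrightarrow> x' + v' \<le> u' + y'" by (simp only: plus_le_cancel)
qed
lift_definition less_diff :: "'a diff \<Rightarrow> 'a diff \<Rightarrow> bool" is "\<lambda>(x, y) (u, v). x + v < u + y"
proof clarify
  fix x y u v x' y' u' v' :: 'a
  assume "x + y' = x' + y" "u + v' = u' + v"
  then have "(x + y') + (v + v') < (u + v') + (y + y') \<longleftrightarrow> (x' + y) + (v + v') < (u' + v) + (y + y')"
    by simp
  then have "(x + v) + (y' + v') < (u + y) + (y' + v') \<longleftrightarrow> (x' + v') + (y + v) < (u' + y') + (y + v)"
    by (simp only: ac_simps)
  then show "x + v < u + y \<longleftrightarrow> x' + v' < u' + y'" by (simp only: plus_less_cancel)
qed
definition diff_abs: "\<bar>x :: 'a diff\<bar> = (if x < 0 then - x else x)"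
definition diff_sgn: "sgn (x :: 'a diff) = (if x = 0 then 0 else if 0 < x then 1 else - 1)"

instance
proof
  fix a b c :: "'a diff"
  show "a + b + c = a + (b + c)" by transfer (auto simp: algebra_simps)
  show "a + b = b + a" by transfer (auto simp: algebra_simps)
  show "0 + a = a" by transfer auto
  show "- a + a = 0" by transfer (auto simp: algebra_simps)
  show "a - b = a + - b" by transfer auto
  show "a * b * c = a * (b * c)" by transfer (auto simp: algebra_simps)
  show "a * b = b * a" by transfer (auto simp: algebra_simps)
  show "1 * a = a" by transfer auto
  show "(a + b) * c = a * c + b * c" by transfer (auto simp: algebra_simps)
  show "(0::'a diff) \<noteq> 1" by transfer auto
  show "a + b - a = b" by transfer (auto simp: algebra_simps)
  show "a - b - c = a - (b + c)" by transfer (auto simp: algebra_simps)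
  show "0 * a = 0" by transfer auto
  show "a * 0 = 0" by transfer auto
  show "(a < b) = (a \<le> b \<and> \<not> b \<le> a)" by transfer auto
  show "a \<le> a" by transfer auto
  show "a \<le> b \<Longrightarrow> b \<le> c \<Longrightarrow> a \<le> c"
  proof (transfer, clarify)
    fix x y u v w t :: 'a
    assume "x + v \<le> u + y" "u + t \<le> w + v"
    then have "(x + v) + (u + t) \<le> (u + y) + (w + v)" by (rule add_mono)
    then have "(x + t) + (u + v) \<le> (w + y) + (u + v)" by (simp only: ac_simps)
    then show "x + t \<le> w + y" by (simp only: plus_le_cancel)
  qed
  show "a \<le> b \<Longrightarrow> b \<le> a \<Longrightarrow> a = b" by transfer auto
  show "a \<le> b \<or> b \<le> a" by transfer auto
  show "a \<le> b \<Longrightarrow> c + a \<le> c + b"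
  proof (transfer, clarify)
    fix x y u v w t :: 'a
    assume "x + v \<le> u + y"
    then have "(x + v) + (w + t) \<le> (u + y) + (w + t)" by (simp only: plus_le_cancel)
    then show "(w + x) + (t + v) \<le> (w + u) + (t + y)" by (simp only: ac_simps)
  qed
  show "a < b \<Longrightarrow> 0 < c \<Longrightarrow> c * a < c * b"
  proof (transfer, clarify)
    fix x y u v w t :: 'a
    assume "x + v < u + y" "0 + t < w + 0"
    then obtain d k where "u + y = (x + v) + (d + 1)" "w = t + (k + 1)"
      unfolding less_iff_plus by auto
    \<comment> \<open>The two sides of the claim differ by \<open>(k + 1) * (d + 1)\<close>, which
      is visibly a successor.\<close>
    have "(w * u + t * v) + (w * y + t * x) = w * (u + y) + t * (x + v)" by (simp only: algebra_simps)
    also have "\<dots> = (t + (k + 1)) * ((x + v) + (d + 1)) + t * (x + v)"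
      by (simp only: \<open>u + y = _\<close> \<open>w = _\<close>)
    also have "\<dots> = ((t + (k + 1)) * (x + v) + t * ((x + v) + (d + 1))) + ((k + d + k * d) + 1)"
      by (simp only: algebra_simps mult_1_left mult_1_right)
    also have "\<dots> = (w * (x + v) + t * (u + y)) + ((k + d + k * d) + 1)"
      by (simp only: \<open>u + y = _\<close> \<open>w = _\<close>)
    also have "w * (x + v) + t * (u + y) = (w * x + t * y) + (w * v + t * u)" by (simp only: algebra_simps)
    finally show "(w * x + t * y) + (w * v + t * u) < (w * u + t * v) + (w * y + t * x)"
      unfolding less_iff_plus by blast
  qed
  show "\<bar>a\<bar> = (if a < 0 then - a else a)" by (rule diff_abs)
  show "sgn a = (if a = 0 then 0 else if 0 < a then 1 else - 1)" by (rule diff_sgn)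
qed

end

lift_definition to_diff :: "'a::RCA0_model \<Rightarrow> 'a diff" is "\<lambda>x. (x, 0)" .

lemma to_diff_add: "to_diff (x + y) = to_diff x + to_diff y" by transfer simp
lemma to_diff_mult: "to_diff (x * y) = to_diff x * to_diff y" by transfer simp
lemma to_diff_zero: "to_diff 0 = 0" by transfer simp
lemma to_diff_one: "to_diff 1 = 1" by transfer simp
lemma to_diff_numeral: "to_diff (numeral n) = numeral n"
  by (induction n) (simp_all only: numeral.simps to_diff_add to_diff_one)
lemma eq_to_diff: "x = y \<longleftrightarrow> to_diff x = to_diff y" by transfer simp
lemma less_to_diff: "x < y \<longleftrightarrow> to_diff x < to_diff y" by transfer simp
lemma le_to_diff: "x \<le> y \<longleftrightarrow> to_diff x \<le> to_diff y" by transfer simp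
lemma to_diff_nonneg: "0 \<le> to_diff x" by transfer simp

text \<open>Rewriting with these carries a goal about numbers into the ring, where
  \<open>linarith\<close> applies; it stops there because \<open>diff\<close> is not of class
  \<open>RCA0_model\<close>. Nonnegativity is lost on the way and supplied by
  \<open>to_diff_nonneg\<close> or \<open>zero_le\<close>.\<close>

lemmas to_diff = eq_to_diff less_to_diff le_to_diff
  to_diff_add to_diff_mult to_diff_zero to_diff_one to_diff_numeral

section \<open>Recursive predicates and functions\<close>

lemma coord_var: "coord \<theta> \<Longrightarrow> coord (\<lambda>e. case_nat (e k) (\<theta> e))"
  unfolding coord_def by (metis nat.exhaust nat.simps(4) nat.simps(5))

lemma coord_Suc: "coord \<theta> \<Longrightarrow> coord (\<lambda>e. \<theta> (\<lambda>n. e (Suc n)))"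
  unfolding coord_def by metis

lemma coord_fixed: "coord (\<lambda>e. c)"
  unfolding coord_def by blast

lemma trm_coord: "trm f \<Longrightarrow> coord \<theta> \<Longrightarrow> trm (\<lambda>e. f (\<theta> e))"
  unfolding trm_def using coord_comp by blast

lemmas coord_intros = coord_var coord_reindex coord_fixed

lemma sigmaE:
  assumes "sigma P"
  obtains Q where "delta (\<lambda>e. Q (e 0) (\<lambda>n. e (Suc n)))" "\<And>e. P e \<longleftrightarrow> (\<exists>y. Q y e)"
proof -
  from assms obtain Q where Q: "delta (\<lambda>e. Q (e 0) (\<lambda>n. e (Suc n))) \<and> (\<forall>e. P e \<longleftrightarrow> (\<exists>y. Q y e))"
    unfolding sigma_def ..
  show ?thesis by (rule that[OF conjunct1[OF Q] conjunct2[OF Q, rule_format]])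
qed

lemma sigma_coord:
  assumes "sigma P" "coord \<theta>"
  shows "sigma (\<lambda>e. P (\<theta> e))"
proof -
  obtain Q where Q: "delta (\<lambda>e. Q (e 0) (\<lambda>n. e (Suc n)))" "\<And>e. P e \<longleftrightarrow> (\<exists>y. Q y e)"
    by (rule sigmaE[OF assms(1)]) (rule that)
  have "coord (\<lambda>e. case_nat (e 0) (\<theta> (\<lambda>n. e (Suc n))))"
    by (rule coord_var[OF coord_Suc[OF assms(2)]])
  from delta_coord[OF Q(1) this] show ?thesis
    unfolding Q(2) by (intro sigma_ex0) simp
qed

lemma sigma_cases:
  assumes "sigma (\<lambda>e. P (e 0) (\<lambda>n. e (Suc n)))"
  obtains Q where "delta (\<lambda>e. Q (e 0) (e (Suc 0)) (\<lambda>n. e (Suc (Suc n))))" "\<And>x e. P x e \<longleftrightarrow> (\<exists>y. Q y x e)"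
proof -
  obtain Q where Q: "delta (\<lambda>e. Q (e 0) (\<lambda>n. e (Suc n)))"
    "\<And>e. P (e 0) (\<lambda>n. e (Suc n)) \<longleftrightarrow> (\<exists>y. Q y e)"
    by (rule sigmaE[OF assms]) (rule that)
  show ?thesis
  proof
    have "coord (\<lambda>e. case_nat (e 0) (case_nat (e (Suc 0)) (\<lambda>n. e (Suc (Suc n)))))"
      by (intro coord_intros)
    from delta_coord[OF Q(1) this]
    show "delta (\<lambda>e. Q (e 0) (case_nat (e (Suc 0)) (\<lambda>n. e (Suc (Suc n)))))" by simp
    show "P x e \<longleftrightarrow> (\<exists>y. Q y (case_nat x e))" for x e using Q(2)[of "case_nat x e"] by simp
  qed
qed

lemma bound_pair: "\<exists>z. x < z \<and> y < z" for x y :: "'a::RCA0_model"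
proof (intro exI conjI)
  show "x < x + y + 1" "y < x + y + 1"
    using to_diff_nonneg[of x] to_diff_nonneg[of y] by (simp_all only: to_diff; linarith)+
qed

text \<open>Both witnesses are placed below one new number, which is the only unbounded one that
  remains.\<close>

lemma sigma_ex:
  assumes "sigma (\<lambda>e. P (e 0) (\<lambda>n. e (Suc n)))"
  shows "sigma (\<lambda>e. \<exists>x. P x e)"
proof -
  obtain Q where Q: "delta (\<lambda>e. Q (e 0) (e (Suc 0)) (\<lambda>n. e (Suc (Suc n))))" "\<And>x e. P x e \<longleftrightarrow> (\<exists>y. Q y x e)"
    by (rule sigma_cases[OF assms]) (rule that)
  have *: "(\<exists>x. P x e) \<longleftrightarrow> (\<exists>z. \<exists>x<z. \<exists>y<z. Q y x e)" for e
    unfolding Q(2) using bound_pair by meson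
  have "coord (\<lambda>e. case_nat (e 0) (case_nat (e (Suc 0)) (\<lambda>n. e (Suc (Suc (Suc n))))))"
    by (intro coord_intros)
  from delta_coord[OF Q(1) this] show ?thesis
    unfolding * by (intro sigma_ex0 delta_ex trm_var) simp
qed

text \<open>\<Sigma>1 bounding, by \<Sigma>1 induction on the length \<open>v\<close> of the initial
  segment. The guard \<open>x < u\<close> makes the claim trivial beyond \<open>u\<close>, where no
  witnesses are supplied.\<close>

lemma sigma_bounding:
  fixes u :: "'a::RCA0_model"
  assumes "delta (\<lambda>e. Q (e 0) (e (Suc 0)))" "\<And>x. x < u \<Longrightarrow> \<exists>y. Q y x"
  shows "\<exists>b. \<forall>x<u. \<exists>y<b. Q y x"
proof -
  have "\<exists>b. \<forall>x<v. x < u \<longrightarrow> (\<exists>y<b. Q y x)" for v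
  proof (rule sigma_induct[where x = v])
    have "delta (\<lambda>e. Q (e 0) (e (Suc 0)))" by fact
    then show "sigma (\<lambda>e. \<exists>b. \<forall>x<e 0. x < u \<longrightarrow> (\<exists>y<b. Q y x))"
      by (intro sigma_ex0 delta_all delta_imp delta_less delta_ex trm_var trm_const)
  next
    show "\<exists>b. \<forall>x<0. x < u \<longrightarrow> (\<exists>y<b. Q y x)" by (simp add: not_less_zero)
  next
    fix v assume "\<exists>b. \<forall>x<v. x < u \<longrightarrow> (\<exists>y<b. Q y x)"
    then obtain b where b: "\<And>x. x < v \<Longrightarrow> x < u \<Longrightarrow> \<exists>y<b. Q y x" by blast
    obtain y where y: "v < u \<longrightarrow> Q y v" using assms(2) by blast
    obtain c where c: "b < c" "y < c" using bound_pair by blast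
    have "\<forall>x<v + 1. x < u \<longrightarrow> (\<exists>y<c. Q y x)"
      unfolding less_succ using b y c less_trans by metis
    then show "\<exists>b. \<forall>x<v + 1. x < u \<longrightarrow> (\<exists>y<b. Q y x)" ..
  qed
  from this[of u] show ?thesis by blast
qed

lemma sigma_all:
  assumes "trm f" "sigma (\<lambda>e. P (e 0) (\<lambda>n. e (Suc n)))"
  shows "sigma (\<lambda>e. \<forall>x<f e. P x e)"
proof -
  obtain Q where Q: "delta (\<lambda>e. Q (e 0) (e (Suc 0)) (\<lambda>n. e (Suc (Suc n))))" "\<And>x e. P x e \<longleftrightarrow> (\<exists>y. Q y x e)"
    by (rule sigma_cases[OF assms(2)]) (rule that)
  have *: "(\<forall>x<f e. P x e) \<longleftrightarrow> (\<exists>b. \<forall>x<f e. \<exists>y<b. Q y x e)" for e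
  proof
    \<comment> \<open>The environment \<open>e\<close> is frozen into parameters, so that bounding
      sees a relation between \<open>x\<close> and \<open>y\<close> alone.\<close>
    have "coord (\<lambda>e'. case_nat (e' 0) (case_nat (e' (Suc 0)) e))" by (intro coord_intros)
    from delta_coord[OF Q(1) this] have "delta (\<lambda>e'. Q (e' 0) (e' (Suc 0)) e)" by simp
    then show "\<forall>x<f e. P x e \<Longrightarrow> \<exists>b. \<forall>x<f e. \<exists>y<b. Q y x e"
      unfolding Q(2) by (intro sigma_bounding) blast+
  qed (use Q(2) in blast)
  have "coord (\<lambda>e. case_nat (e 0) (case_nat (e (Suc 0)) (\<lambda>n. e (Suc (Suc (Suc n))))))"
    by (intro coord_intros)
  from delta_coord[OF Q(1) this]
  have "delta (\<lambda>e. Q (e 0) (e (Suc 0)) (\<lambda>n. e (Suc (Suc (Suc n)))))" by simp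
  moreover have "trm (\<lambda>e. f (\<lambda>n. e (Suc n)))"
    by (rule trm_coord[OF assms(1) coord_reindex])
  ultimately show ?thesis unfolding * by (intro sigma_ex0 delta_all delta_ex trm_var) simp_all
qed

lemma sigma_conj:
  assumes "sigma P" "sigma Q"
  shows "sigma (\<lambda>e. P e \<and> Q e)"
proof -
  obtain P' where P: "delta (\<lambda>e. P' (e 0) (\<lambda>n. e (Suc n)))" "\<And>e. P e \<longleftrightarrow> (\<exists>y. P' y e)"
    by (rule sigmaE[OF assms(1)]) (rule that)
  obtain Q' where Q: "delta (\<lambda>e. Q' (e 0) (\<lambda>n. e (Suc n)))" "\<And>e. Q e \<longleftrightarrow> (\<exists>y. Q' y e)"
    by (rule sigmaE[OF assms(2)]) (rule that)
  have "coord (\<lambda>e. case_nat (e k) (\<lambda>n. e (Suc (Suc n))))" for k by (intro coord_intros)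
  note * = delta_coord[OF P(1) this[of "Suc 0"]] delta_coord[OF Q(1) this[of 0]]
  have "(P e \<and> Q e) \<longleftrightarrow> (\<exists>y. \<exists>z. P' y e \<and> Q' z e)" for e using P(2) Q(2) by blast
  then show ?thesis using * by (simp only:) (intro sigma_ex sigma_delta delta_conj, simp_all)
qed

lemma sigma_disj:
  assumes "sigma P" "sigma Q"
  shows "sigma (\<lambda>e. P e \<or> Q e)"
proof -
  obtain P' where P: "delta (\<lambda>e. P' (e 0) (\<lambda>n. e (Suc n)))" "\<And>e. P e \<longleftrightarrow> (\<exists>y. P' y e)"
    by (rule sigmaE[OF assms(1)]) (rule that)
  obtain Q' where Q: "delta (\<lambda>e. Q' (e 0) (\<lambda>n. e (Suc n)))" "\<And>e. Q e \<longleftrightarrow> (\<exists>y. Q' y e)"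
    by (rule sigmaE[OF assms(2)]) (rule that)
  have "(P e \<or> Q e) \<longleftrightarrow> (\<exists>y. P' y e \<or> Q' y e)" for e using P(2) Q(2) by blast
  then show ?thesis using P(1) Q(1) by (simp only:) (intro sigma_ex0 delta_disj)
qed

definition recp :: "((nat \<Rightarrow> 'a::RCA0_model) \<Rightarrow> bool) \<Rightarrow> bool" where
  "recp P \<longleftrightarrow> sigma P \<and> sigma (\<lambda>e. \<not> P e)"

text \<open>A \<Sigma>1 graph is enough: as \<open>f\<close> is total, \<open>y\<close> fails to be
  the value iff the value is some other number, so the graph is automatically \<Delta>1.\<close>

definition recf :: "((nat \<Rightarrow> 'a::RCA0_model) \<Rightarrow> 'a) \<Rightarrow> bool" where
  "recf f \<longleftrightarrow> sigma (\<lambda>e. e 0 = f (\<lambda>n. e (Suc n)))"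

lemma recp_delta: "delta P \<Longrightarrow> recp P"
  unfolding recp_def by (intro conjI sigma_delta delta_not)

lemma recp_coord: "recp P \<Longrightarrow> coord \<theta> \<Longrightarrow> recp (\<lambda>e. P (\<theta> e))"
  unfolding recp_def using sigma_coord by blast

lemma recf_coord:
  assumes "recf f" "coord \<theta>"
  shows "recf (\<lambda>e. f (\<theta> e))"
proof -
  have "coord (\<lambda>e. case_nat (e 0) (\<theta> (\<lambda>n. e (Suc n))))"
    by (rule coord_var[OF coord_Suc[OF assms(2)]])
  from sigma_coord[OF assms(1)[unfolded recf_def] this] show ?thesis unfolding recf_def by simp
qed

lemma sigma_let:
  assumes "recf f" "sigma (\<lambda>e. P (e 0) (\<lambda>n. e (Suc n)))"
  shows "sigma (\<lambda>e. P (f e) e)"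
proof -
  have "sigma (\<lambda>e. \<exists>y. y = f e \<and> P y e)"
    using assms unfolding recf_def by (intro sigma_ex sigma_conj)
  then show ?thesis by simp
qed

text \<open>The value of \<open>f\<close> is introduced by an existential quantifier, once for
  \<open>P\<close> and once for its negation, and so both remain \<Sigma>1.\<close>

lemma recp_let:
  assumes "recf f" "recp (\<lambda>e. P (e 0) (\<lambda>n. e (Suc n)))"
  shows "recp (\<lambda>e. P (f e) e)"
  using assms sigma_let[of f P] sigma_let[of f "\<lambda>y e. \<not> P y e"] unfolding recp_def by blast

lemma recf_let:
  assumes "recf f" "recf (\<lambda>e. g (e 0) (\<lambda>n. e (Suc n)))"
  shows "recf (\<lambda>e. g (f e) e)"
  unfolding recf_def
proof (rule sigma_let[where P = "\<lambda>y e. e 0 = g y (\<lambda>n. e (Suc n))"])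
  show "recf (\<lambda>e. f (\<lambda>n. e (Suc n)))" by (rule recf_coord[OF assms(1) coord_reindex])
  have "coord (\<lambda>e. case_nat (e (Suc 0)) (case_nat (e 0) (\<lambda>n. e (Suc (Suc n)))))" by (intro coord_intros)
  from sigma_coord[OF assms(2)[unfolded recf_def] this]
  show "sigma (\<lambda>e. e (Suc 0) = g (e 0) (\<lambda>n. e (Suc (Suc n))))" by simp
qed

lemma recf_trm: "trm f \<Longrightarrow> recf f"
  unfolding recf_def
  by (intro sigma_delta delta_eq trm_var trm_coord[OF _ coord_reindex[of Suc], of f])

lemma recf_var: "recf (\<lambda>e. e n)" by (intro recf_trm trm_var)
lemma recf_const: "recf (\<lambda>e. c)" by (intro recf_trm trm_const)

lemma recf_app1: "recf (\<lambda>e. g (e 0)) \<Longrightarrow> recf f \<Longrightarrow> recf (\<lambda>e. g (f e))"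
  using recf_let[of f "\<lambda>y e. g y"] by simp

lemma recp_app1: "recp (\<lambda>e. P (e 0)) \<Longrightarrow> recf f \<Longrightarrow> recp (\<lambda>e. P (f e))"
  using recp_let[of f "\<lambda>y e. P y"] by simp

lemma recp_app2:
  assumes "recp (\<lambda>e. P (e 0) (e (Suc 0)))" "recf f" "recf g"
  shows "recp (\<lambda>e. P (f e) (g e))"
proof (rule recp_let[where P = "\<lambda>y e. P y (g e)"])
  show "recp (\<lambda>e. P (e 0) (g (\<lambda>n. e (Suc n))))"
  proof (rule recp_let[where P = "\<lambda>y e. P (e 0) y"])
    show "recf (\<lambda>e. g (\<lambda>n. e (Suc n)))" by (rule recf_coord[OF assms(3) coord_reindex])
    have "coord (\<lambda>e. case_nat (e (Suc 0)) (case_nat (e 0) (\<lambda>n. e n)))" by (intro coord_intros)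
    from recp_coord[OF assms(1) this] show "recp (\<lambda>e. P (e (Suc 0)) (e 0))" by simp
  qed
qed fact

lemma recf_app2:
  assumes "recf (\<lambda>e. h (e 0) (e (Suc 0)))" "recf f" "recf g"
  shows "recf (\<lambda>e. h (f e) (g e))"
proof (rule recf_let[where g = "\<lambda>y e. h y (g e)"])
  show "recf (\<lambda>e. h (e 0) (g (\<lambda>n. e (Suc n))))"
  proof (rule recf_let[where g = "\<lambda>y e. h (e 0) y"])
    show "recf (\<lambda>e. g (\<lambda>n. e (Suc n)))" by (rule recf_coord[OF assms(3) coord_reindex])
    have "coord (\<lambda>e. case_nat (e (Suc 0)) (case_nat (e 0) (\<lambda>n. e n)))" by (intro coord_intros)
    from recf_coord[OF assms(1) this] show "recf (\<lambda>e. h (e (Suc 0)) (e 0))" by simp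
  qed
qed fact

lemma recf_add: "recf f \<Longrightarrow> recf g \<Longrightarrow> recf (\<lambda>e. f e + g e)"
  by (rule recf_app2[where h = "(+)"]) (intro recf_trm delta_intros)

lemma recf_mult: "recf f \<Longrightarrow> recf g \<Longrightarrow> recf (\<lambda>e. f e * g e)"
  by (rule recf_app2[where h = "(*)"]) (intro recf_trm delta_intros)

lemma recp_eq: "recf f \<Longrightarrow> recf g \<Longrightarrow> recp (\<lambda>e. f e = g e)"
  by (rule recp_app2[where P = "(=)"]) (intro recp_delta delta_intros)

lemma recp_less: "recf f \<Longrightarrow> recf g \<Longrightarrow> recp (\<lambda>e. f e < g e)"
  by (rule recp_app2[where P = "(<)"]) (intro recp_delta delta_intros)

lemma recp_le: "recf f \<Longrightarrow> recf g \<Longrightarrow> recp (\<lambda>e. f e \<le> g e)"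
  by (rule recp_app2[where P = "(\<le>)"]) (intro recp_delta delta_intros)

lemma recp_mem: "recf f \<Longrightarrow> recp (\<lambda>e. mem X (f e))"
  by (rule recp_app1) (intro recp_delta delta_intros)

lemma recp_bool: "recp (\<lambda>e. b)"
  by (intro recp_delta delta_bool)

lemma recp_not: "recp P \<Longrightarrow> recp (\<lambda>e. \<not> P e)"
  unfolding recp_def by simp

lemma recp_conj: "recp P \<Longrightarrow> recp Q \<Longrightarrow> recp (\<lambda>e. P e \<and> Q e)"
  unfolding recp_def de_Morgan_conj by (intro conjI sigma_conj sigma_disj) simp_all

lemma recp_disj: "recp P \<Longrightarrow> recp Q \<Longrightarrow> recp (\<lambda>e. P e \<or> Q e)"
  unfolding recp_def de_Morgan_disj by (intro conjI sigma_conj sigma_disj) simp_all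

lemma recp_imp: "recp P \<Longrightarrow> recp Q \<Longrightarrow> recp (\<lambda>e. P e \<longrightarrow> Q e)"
  unfolding imp_conv_disj by (intro recp_disj recp_not)

lemma recp_all:
  assumes "recf f" "recp (\<lambda>e. P (e 0) (\<lambda>n. e (Suc n)))"
  shows "recp (\<lambda>e. \<forall>x<f e. P x e)"
proof (rule recp_let[where P = "\<lambda>y e. \<forall>x<y. P x e", OF assms(1)])
  have "coord (\<lambda>e. case_nat (e 0) (\<lambda>n. e (Suc (Suc n))))" by (intro coord_intros)
  from recp_coord[OF assms(2) this]
  have *: "recp (\<lambda>e. P (e 0) (\<lambda>n. e (Suc (Suc n))))" by simp
  then have "sigma (\<lambda>e. \<forall>x<e 0. P x (\<lambda>n. e (Suc n)))"
    unfolding recp_def by (intro sigma_all[where P = "\<lambda>x e. P x (\<lambda>n. e (Suc n))"] trm_var) blast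
  moreover have "sigma (\<lambda>e. \<exists>x<e 0. \<not> P x (\<lambda>n. e (Suc n)))"
    using * unfolding recp_def
    by (intro sigma_ex[where P = "\<lambda>x e. x < e 0 \<and> \<not> P x (\<lambda>n. e (Suc n))"]
        sigma_conj sigma_delta[OF delta_less] trm_var) blast
  ultimately show "recp (\<lambda>e. \<forall>x<e 0. P x (\<lambda>n. e (Suc n)))" unfolding recp_def by simp
qed

lemma recp_ex:
  assumes "recf f" "recp (\<lambda>e. P (e 0) (\<lambda>n. e (Suc n)))"
  shows "recp (\<lambda>e. \<exists>x<f e. P x e)"
  using recp_not[OF recp_all[of f "\<lambda>x e. \<not> P x e", OF assms(1) recp_not[OF assms(2)]]] by simp

lemma le_iff_less_succ: "x \<le> y \<longleftrightarrow> x < y + 1" for x y :: "'a::RCA0_model"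
  unfolding less_succ le_iff_less_or_eq ..

lemma recp_all_le:
  "recf f \<Longrightarrow> recp (\<lambda>e. P (e 0) (\<lambda>n. e (Suc n))) \<Longrightarrow> recp (\<lambda>e. \<forall>x\<le>f e. P x e)"
  unfolding le_iff_less_succ by (intro recp_all recf_add recf_const)

lemma recp_ex_le:
  "recf f \<Longrightarrow> recp (\<lambda>e. P (e 0) (\<lambda>n. e (Suc n))) \<Longrightarrow> recp (\<lambda>e. \<exists>x\<le>f e. P x e)"
  unfolding le_iff_less_succ by (intro recp_ex recf_add recf_const)

lemmas rec_intros = recf_var recf_const recf_add recf_mult recp_eq recp_less recp_le recp_mem recp_bool
  recp_not recp_conj recp_disj recp_imp recp_all recp_ex recp_all_le recp_ex_le

lemma recfI:
  assumes "recp (\<lambda>e. G (e 0) (\<lambda>n. e (Suc n)))" "\<And>y e. y = f e \<longleftrightarrow> G y e"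
  shows "recf f"
  using assms unfolding recf_def recp_def by simp

lemma sigma_recp: "recp P \<Longrightarrow> sigma P"
  unfolding recp_def by blast

lemmas rec_induct = sigma_induct[OF sigma_recp]

lemma rec_comprehension:
  assumes "recp (\<lambda>e. P (e 0))"
  obtains X where "\<And>x. mem X x \<longleftrightarrow> P x"
  using assms comprehension[of P] unfolding recp_def by blast

text \<open>If there were no least element, induction on \<open>u\<close> would show that there is
  no element below \<open>u\<close> at all.\<close>

lemma least_number:
  fixes x :: "'a::RCA0_model"
  assumes "recp (\<lambda>e. P (e 0))" "P x"
  obtains y where "P y" "y \<le> x" "\<And>z. z < y \<Longrightarrow> \<not> P z"
proof -
  have "\<exists>y. P y \<and> (\<forall>z<y. \<not> P z)"
  proof (rule ccontr)
    assume none: "\<not> ?thesis"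
    have "\<forall>z<u. \<not> P z" for u
    proof (rule rec_induct[where x = u])
      show "recp (\<lambda>e. \<forall>z<e 0. \<not> P z)" by (intro rec_intros assms(1))
    next
      fix u assume "\<forall>z<u. \<not> P z"
      then show "\<forall>z<u + 1. \<not> P z" unfolding less_succ using none by blast
    qed (simp add: not_less_zero)
    from this[of "x + 1"] show False using assms(2) unfolding less_succ by blast
  qed
  then show ?thesis using that assms(2) by (meson not_less)
qed

section \<open>Pairing and binary codes\<close>

lemma times_cancel: "x * z = y * z \<Longrightarrow> 0 < z \<Longrightarrow> x = y" for x y z :: "'a::RCA0_model"
  by (simp only: to_diff) simp

lemma times_mono: "x \<le> y \<Longrightarrow> x * z \<le> y * z" for x y z :: "'a::RCA0_model"
  using to_diff_nonneg[of z] by (simp only: to_diff mult_right_mono)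

definition pair :: "'a::RCA0_model \<Rightarrow> 'a \<Rightarrow> 'a" where
  "pair x y = (x + y) * (x + y) + x"

text \<open>The codes \<open>pair x y\<close> with \<open>x + y = s\<close> lie between
  \<open>s * s\<close> and \<open>s * s + s\<close>; hence those for different sums are kept
  apart.\<close>

lemma square_less: "s < t \<Longrightarrow> s * s + s < t * t" for s t :: "'a::RCA0_model"
proof -
  assume "s < t"
  then obtain d where d: "t = s + (d + 1)" unfolding less_iff_plus ..
  have "t * t = (s * s + s) + ((s * d + s * d + s + d * d + d + d) + 1)"
    unfolding d by (simp add: algebra_simps)
  then show ?thesis unfolding less_iff_plus by blast
qed

lemma pair_less:
  assumes "x + y < u + v"
  shows "pair x y < pair u v"
  using square_less[OF assms] to_diff_nonneg[of y] to_diff_nonneg[of u]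
  unfolding pair_def by (simp only: to_diff; linarith)

lemma pair_inject: "pair x y = pair u v \<longleftrightarrow> x = u \<and> y = v"
proof
  assume eq: "pair x y = pair u v"
  then have s: "x + y = u + v" using pair_less[of x y u v] pair_less[of u v x y] by (metis less_irrefl less_linear)
  from eq have "x = u" unfolding pair_def s by (simp only: to_diff; linarith)
  with s show "x = u \<and> y = v" by (simp only: to_diff; linarith)
qed simp

lemma le_square: "x \<le> x * x" for x :: "'a::RCA0_model"
  using zero_or_succ[of x] le_iff_plus by (metis times_succ zero_times order_refl add.commute)

lemma pair_ge: "x \<le> pair x y" "y \<le> pair x y"
  using le_square[of "x + y"] to_diff_nonneg[of x] to_diff_nonneg[of y]
  unfolding pair_def by (simp_all only: to_diff; linarith)+

lemma recf_pair: "recf f \<Longrightarrow> recf g \<Longrightarrow> recf (\<lambda>e. pair (f e) (g e))"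
  unfolding pair_def by (intro rec_intros)

lemma odd_not_even: "q + q + 1 \<noteq> m + m" for q m :: "'a::RCA0_model"
proof
  assume eq: "q + q + 1 = m + m"
  consider "m \<le> q" | "q + 1 \<le> m" using discrete[of q m] by (meson not_less)
  then show False using eq by cases (simp_all only: to_diff; linarith)+
qed

section \<open>Powers of two and binary digits\<close>

locale exponential =
  fixes ex :: "'a::RCA0_model \<Rightarrow> 'a"
  assumes rec_ex: "recf (\<lambda>e. ex (e 0))"
    and ex_zero: "ex 0 = 1"
    and ex_succ: "ex (x + 1) = ex x + ex x"
begin

lemma ex_add: "ex (x + y) = ex x * ex y"
proof (rule rec_induct[where x = y])
  fix y assume "ex (x + y) = ex x * ex y"
  then show "ex (x + (y + 1)) = ex x * ex (y + 1)"
    unfolding plus_succ ex_succ by (simp only: distrib_left)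
next
  show "recp (\<lambda>e. ex (x + e 0) = ex x * ex (e 0))" by (intro rec_intros recf_app1[OF rec_ex])
qed (simp add: ex_zero)

lemma less_ex: "x < ex x"
proof (rule rec_induct[where x = x])
  show "recp (\<lambda>e. e 0 < ex (e 0))" by (intro rec_intros recf_app1[OF rec_ex])
  show "0 < ex 0" unfolding ex_zero less_iff_plus by (metis zero_plus)
  show "x + 1 < ex (x + 1)" if "x < ex x" for x
    using that[unfolded discrete] that to_diff_nonneg[of x] unfolding ex_succ by (simp only: to_diff; linarith)
qed

lemma ex_pos: "0 < ex x"
  using less_ex zero_le by (meson le_less_trans)

lemma ex_ge_one: "1 \<le> ex x"
  using ex_pos[of x, unfolded discrete] by (simp only: zero_plus)

lemma ex_multiple: "x \<le> y \<Longrightarrow> \<exists>k. ex y = k * ex x"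
  unfolding le_iff_plus by (metis ex_add mult.commute)

text \<open>Evenness of the factor is what matters: adding a higher power of two leaves the lower
  digits and the least exponent of a number alone.\<close>

lemma ex_even_multiple: "x < y \<Longrightarrow> \<exists>k. ex y = (k + k) * ex x \<and> 0 < k"
proof -
  assume "x < y"
  then obtain d where "y = x + (d + 1)" unfolding less_iff_plus ..
  then have "ex y = (ex d + ex d) * ex x" using ex_add[of x "d + 1"] by (simp only: ex_succ mult.commute)
  then show ?thesis using ex_pos by blast
qed

lemma ex_double_le: "x < y \<Longrightarrow> ex x + ex x \<le> ex y"
proof -
  assume "x < y"
  then obtain k where k: "ex y = (k + k) * ex x" "0 < k" using ex_even_multiple by blast
  from k(2)[unfolded discrete zero_plus] have "1 * ex x \<le> k * ex x" by (rule times_mono)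
  then show ?thesis unfolding k(1) by (simp only: to_diff algebra_simps mult_1_left mult_1_right; linarith)
qed

lemma ex_less:
  assumes "x < y"
  shows "ex x < ex y"
  using ex_double_le[OF assms] ex_pos[of x] by (simp only: to_diff; linarith)

lemma ex_le: "x \<le> y \<Longrightarrow> ex x \<le> ex y"
  using ex_less[of x y] unfolding le_iff_less_or_eq by blast

text \<open>Digit \<open>a\<close> in the binary expansion of \<open>w\<close> is 1:
  \<open>q\<close> holds the digits above it and \<open>r\<close> those below. The bound on
  \<open>q\<close> excludes nothing, by \<open>digitI\<close>, and keeps the predicate
  recursive.\<close>

definition digit :: "'a \<Rightarrow> 'a \<Rightarrow> bool" where
  "digit w a \<longleftrightarrow> (\<exists>q\<le>w. \<exists>r<ex a. w = (q + q + 1) * ex a + r)"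

lemma le_times_ex: "q \<le> q * ex a"
  using times_mono[OF ex_ge_one[of a], of q] by (simp only: mult_1_left mult.commute)

lemma digitI: "r < ex a \<Longrightarrow> w = (q + q + 1) * ex a + r \<Longrightarrow> digit w a"
  unfolding digit_def
  using le_times_ex[of "q + q + 1" a] to_diff_nonneg[of q] to_diff_nonneg[of r]
  by (intro exI[of _ q] exI[of _ r] conjI) (simp_all only: to_diff; linarith)+

lemma digit_ge: "digit w a \<Longrightarrow> ex a \<le> w"
  unfolding digit_def
proof clarify
  fix q r
  have "1 * ex a \<le> (q + q + 1) * ex a" using to_diff_nonneg[of q] by (intro times_mono) (simp only: to_diff; linarith)
  then show "ex a \<le> (q + q + 1) * ex a + r" using to_diff_nonneg[of r] by (simp only: to_diff mult_1_left; linarith)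
qed

lemma digit_less: "digit w a \<Longrightarrow> a < w"
  using digit_ge less_ex less_le_trans by blast

lemma rec_digit: "recp (\<lambda>e. digit (e 0) (e (Suc 0)))"
  unfolding digit_def by (intro rec_intros recf_app1[OF rec_ex])

lemmas recp_digit = recp_app2[OF rec_digit]

text \<open>No carry occurs because all digits of \<open>w\<close> lie below \<open>a\<close>. In
  terms of coded sets, \<open>a\<close> is inserted.\<close>

lemma digit_add:
  assumes "w < ex a"
  shows "digit (w + ex a) b \<longleftrightarrow> b = a \<or> digit w b"
proof -
  consider "b = a" | "a < b" | "b < a" using less_linear by blast
  then show ?thesis
  proof cases
    case 1
    have "digit (w + ex a) a" by (rule digitI[OF assms, of _ 0]) (simp add: add.commute)
    then show ?thesis using 1 by blast
  next
    case 2
    have "w + ex a < ex b" using assms ex_double_le[OF 2] by (simp only: to_diff; linarith)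
    then have "\<not> digit (w + ex a) b" "\<not> digit w b"
      using digit_ge[of "w + ex a" b] digit_ge[of w b] to_diff_nonneg[of "ex a"] by (simp_all only: to_diff; linarith)+
    then show ?thesis using 2 less_irrefl by blast
  next
    case 3
    obtain k where k: "ex a = (k + k) * ex b" using ex_even_multiple[OF 3] by blast
    have "digit (w + ex a) b \<longleftrightarrow> digit w b"
    proof
      assume "digit w b"
      then obtain q r where "r < ex b" "w = (q + q + 1) * ex b + r" unfolding digit_def by blast
      then show "digit (w + ex a) b"
        by (intro digitI[of r b _ "q + k"]) (simp_all add: k algebra_simps)
    next
      assume "digit (w + ex a) b"
      then obtain q r where r: "r < ex b" and eq: "w + ex a = (q + q + 1) * ex b + r"
        unfolding digit_def by blast
      \<comment> \<open>Otherwise \<open>2 * (q + 1) * ex b \<le> ex a\<close>, whereas the equation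
        for \<open>w + ex a\<close> places this sum below \<open>2 * (q + 1) * ex b\<close>.\<close>
      have "k \<le> q"
      proof (rule ccontr)
        assume "\<not> k \<le> q"
        then have "q + 1 \<le> k" unfolding not_le discrete .
        then have "(q + 1) * ex b \<le> k * ex b" by (rule times_mono)
        then show False using eq r to_diff_nonneg[of w] unfolding k
          by (simp only: to_diff algebra_simps mult_1_left mult_1_right; linarith)
      qed
      then obtain j where j: "q = k + j" unfolding le_iff_plus ..
      have "w = (j + j + 1) * ex b + r"
        using eq unfolding k j by (simp only: to_diff algebra_simps mult_1_left mult_1_right; linarith)
      with r show "digit w b" by (rule digitI)
    qed
    then show ?thesis using 3 less_irrefl by blast
  qed
qed

lemma not_digit_zero: "\<not> digit 0 a"
  using digit_less[of 0 a] not_less_zero by blast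

end

section \<open>Recursion with nondecreasing values\<close>

context exponential
begin

text \<open>
  The number \<open>w\<close> codes the finite set of its binary digits, a set of pairs \<open>(n, v)\<close>; it is a
  history if each of these pairs is justified by an earlier one.
\<close>

definition history :: "'a \<Rightarrow> ('a \<Rightarrow> 'a \<Rightarrow> 'a) \<Rightarrow> 'a \<Rightarrow> bool" where
  "history a g w \<longleftrightarrow> (\<forall>n\<le>w. \<forall>v\<le>w. digit w (pair n v) \<longrightarrow>
    n = 0 \<and> v = a \<or> (\<exists>i<n. \<exists>u\<le>w. n = i + 1 \<and> digit w (pair i u) \<and> v = g i u))"

lemma historyD:
  assumes "history a g w" "digit w (pair n v)"
  shows "n = 0 \<and> v = a \<or> (\<exists>i u. n = i + 1 \<and> digit w (pair i u) \<and> v = g i u)"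
proof -
  have "n \<le> w" "v \<le> w"
    using digit_less[OF assms(2)] pair_ge[of n v] pair_ge[of v n] by (meson le_less_trans less_imp_le)+
  then show ?thesis using assms unfolding history_def by blast
qed

lemma rec_history:
  assumes "recf (\<lambda>e. g (e 0) (e (Suc 0)))"
  shows "recp (\<lambda>e. history a g (e 0))"
  unfolding history_def by (intro rec_intros recp_digit recf_pair recf_app2[OF assms])

lemma history_unique:
  assumes "recf (\<lambda>e. g (e 0) (e (Suc 0)))" "history a g w" "history a g w'"
    and "digit w (pair n v)" "digit w' (pair n v')"
  shows "v = v'"
proof -
  \<comment> \<open>The bounds \<open>w\<close> and \<open>w'\<close> keep the induction formula
    \<Delta>1. They exclude nothing: a digit position lies below the number, and so do the
    components of the pair that it codes.\<close>
  have "\<forall>v<w. \<forall>v'<w'. digit w (pair n v) \<and> digit w' (pair n v') \<longrightarrow> v = v'"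
  proof (rule rec_induct[where x = n])
    show "recp (\<lambda>e. \<forall>v<w. \<forall>v'<w'. digit w (pair (e 0) v) \<and> digit w' (pair (e 0) v') \<longrightarrow> v = v')"
      by (intro rec_intros recp_digit recf_pair)
  next
    show "\<forall>v<w. \<forall>v'<w'. digit w (pair 0 v) \<and> digit w' (pair 0 v') \<longrightarrow> v = v'"
      using historyD[OF assms(2), of 0] historyD[OF assms(3), of 0] succ_nonzero by metis
  next
    fix n assume IH: "\<forall>v<w. \<forall>v'<w'. digit w (pair n v) \<and> digit w' (pair n v') \<longrightarrow> v = v'"
    have "v = v'" if d: "digit w (pair (n + 1) v)" "digit w' (pair (n + 1) v')" for v v'
    proof -
      obtain u where u: "digit w (pair n u)" "v = g n u"
        using historyD[OF assms(2) d(1)] succ_nonzero succ_inject by metis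
      obtain u' where u': "digit w' (pair n u')" "v' = g n u'"
        using historyD[OF assms(3) d(2)] succ_nonzero succ_inject by metis
      have "u < w" "u' < w'"
        using digit_less[OF u(1)] digit_less[OF u'(1)] pair_ge(2) le_less_trans by blast+
      then show ?thesis using IH u u' by blast
    qed
    then show "\<forall>v<w. \<forall>v'<w'. digit w (pair (n + 1) v) \<and> digit w' (pair (n + 1) v') \<longrightarrow> v = v'"
      by blast
  qed
  moreover have "v < w" "v' < w'"
    using digit_less[OF assms(4)] digit_less[OF assms(5)] pair_ge(2) le_less_trans by blast+
  ultimately show ?thesis using assms(4,5) by blast
qed

text \<open>As the values increase, a history is extended by digits above all previous ones.\<close>

lemma history_exists:
  assumes rec: "recf (\<lambda>e. g (e 0) (e (Suc 0)))" and mono: "\<And>n v. v \<le> g n v"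
  shows "\<exists>w v. history a g w \<and> digit w (pair n v) \<and> w < ex (pair n v + 1)"
proof (rule sigma_induct[where x = n])
  \<comment> \<open>The last conjunct says that no digit of \<open>w\<close> lies above the newest
    pair, so that the next pair can be added without a carry.\<close>
  show "sigma (\<lambda>e. \<exists>w v. history a g w \<and> digit w (pair (e 0) v) \<and> w < ex (pair (e 0) v + 1))"
    by (intro sigma_ex sigma_recp rec_intros recp_app1[OF rec_history[OF rec]] recp_digit recf_pair
        recf_app1[OF rec_ex])
next
  let ?w = "ex (pair 0 a)"
  have *: "digit ?w b \<longleftrightarrow> b = pair 0 a" for b
    using digit_add[OF ex_pos, of "pair 0 a" b] not_digit_zero by (simp only: zero_plus) blast
  have "history a g ?w" unfolding history_def * pair_inject by blast
  moreover have "?w < ex (pair 0 a + 1)" by (rule ex_less) (simp add: less_succ)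
  ultimately show "\<exists>w v. history a g w \<and> digit w (pair 0 v) \<and> w < ex (pair 0 v + 1)"
    using * by blast
next
  fix n assume "\<exists>w v. history a g w \<and> digit w (pair n v) \<and> w < ex (pair n v + 1)"
  then obtain w v where w: "history a g w" "digit w (pair n v)" "w < ex (pair n v + 1)" by blast
  define v' where "v' = g n v"
  define b where "b = pair (n + 1) v'"
  \<comment> \<open>This is where the step must not decrease the value: pairs are ordered by their
    sums first, so the next pair gets the larger code.\<close>
  have "n + v < n + 1 + v'"
    using mono[of v n] unfolding v'_def by (simp only: to_diff; linarith)
  then have "pair n v < b" unfolding b_def by (rule pair_less)
  then have "ex (pair n v + 1) \<le> ex b" unfolding discrete by (rule ex_le)
  with w(3) have *: "w < ex b" by (rule less_le_trans)
  note digit = digit_add[OF this]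
  have "history a g (w + ex b)"
    unfolding history_def digit
  proof (intro allI impI)
    fix m x assume "m \<le> w + ex b" "x \<le> w + ex b" and "pair m x = b \<or> digit w (pair m x)"
    from this(3) obtain i u where "m = 0 \<and> x = a \<or> m = i + 1 \<and> digit w (pair i u) \<and> x = g i u"
    proof
      assume "pair m x = b"
      then have "m = n + 1" "x = v'" unfolding b_def pair_inject by blast+
      then show ?thesis using that[of n v] w(2) v'_def by blast
    next
      assume "digit w (pair m x)"
      then show ?thesis using that historyD[OF w(1)] by blast
    qed
    then show "m = 0 \<and> x = a \<or> (\<exists>i<m. \<exists>u\<le>w + ex b. m = i + 1 \<and>
        (pair i u = b \<or> digit w (pair i u)) \<and> x = g i u)"
    proof
      assume iu: "m = i + 1 \<and> digit w (pair i u) \<and> x = g i u"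
      then have "u \<le> w" using digit_less[of w "pair i u"] pair_ge(2)[of u i] by (meson le_less_trans less_imp_le)
      then have "u \<le> w + ex b" using zero_le[of "ex b"] by (simp only: to_diff; linarith)
      moreover have "i < m" using iu by (simp add: less_succ)
      ultimately show ?thesis using iu by blast
    qed blast
  qed
  moreover have "digit (w + ex b) (pair (n + 1) v')" unfolding digit by (simp add: b_def)
  moreover have "w + ex b < ex (pair (n + 1) v' + 1)"
    using * unfolding ex_succ b_def by (simp only: to_diff; linarith)
  ultimately show "\<exists>w v. history a g w \<and> digit w (pair (n + 1) v) \<and> w < ex (pair (n + 1) v + 1)" by blast
qed

text \<open>The histories are quantified existentially without a bound. This gives a \<Sigma>1
  graph, which is all that \<open>recf\<close> asks for.\<close>

lemma monotone_recursion:
  fixes a :: 'a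
  assumes rec: "recf (\<lambda>e. g (e 0) (e (Suc 0)))" and mono: "\<And>n v. v \<le> g n v"
  obtains F where "recf (\<lambda>e. F (e 0))" "F 0 = a" "\<And>n. F (n + 1) = g n (F n)"
proof -
  define R where "R n v \<longleftrightarrow> (\<exists>w. history a g w \<and> digit w (pair n v))" for n v
  have ex1: "\<exists>!v. R n v" for n
    using history_exists[OF assms, of a n] history_unique[OF rec, of a] unfolding R_def by metis
  define F where "F n = (THE v. R n v)" for n
  have F: "v = F n \<longleftrightarrow> R n v" for n v
    unfolding F_def using ex1[of n] by (metis theI')
  show ?thesis
  proof
    show "recf (\<lambda>e. F (e 0))"
      unfolding recf_def F R_def
      by (intro sigma_ex sigma_recp rec_intros recp_app1[OF rec_history[OF rec]] recp_digit recf_pair)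
    obtain w where w: "history a g w" "digit w (pair 0 (F 0))" using F R_def by blast
    show "F 0 = a" using historyD[OF w] succ_nonzero by metis
    fix n
    obtain w where w: "history a g w" "digit w (pair (n + 1) (F (n + 1)))" using F R_def by blast
    obtain u where "digit w (pair n u)" "F (n + 1) = g n u"
      using historyD[OF w] succ_nonzero succ_inject by metis
    moreover from this(1) w(1) have "u = F n" unfolding F R_def by blast
    ultimately show "F (n + 1) = g n (F n)" by simp
  qed
qed

end

section \<open>Functions with a recursive graph, and enumerations\<close>

lemma rec_the:
  assumes "recp (\<lambda>e. G (e 0) (e (Suc 0)))" "\<And>x. \<exists>!y. G x y"
  shows "recf (\<lambda>e. THE y. G (e 0) y)"
proof (rule recfI)
  show "recp (\<lambda>e. G (e (Suc 0)) (e 0))" by (rule recp_app2[OF assms(1) recf_var recf_var])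
  show "y = (THE y. G (e 0) y) \<longleftrightarrow> G (e 0) y" for y and e :: "nat \<Rightarrow> 'a"
    using assms(2)[of "e 0"] by (metis theI')
qed

lemma rec_choice:
  fixes G :: "'a::RCA0_model \<Rightarrow> 'a \<Rightarrow> bool"
  assumes "recp (\<lambda>e. G (e 0) (e (Suc 0)))" "\<And>x. \<exists>!y. G x y"
  obtains f where "recf (\<lambda>e. f (e 0))" "\<And>x y. G x y \<longleftrightarrow> y = f x"
proof
  show "recf (\<lambda>e. THE y. G (e 0) y)" by (rule rec_the[OF assms])
  show "G x y \<longleftrightarrow> y = (THE y. G x y)" for x y
    using assms(2)[of x] by (metis theI')
qed

lemma strict_mono_ge:
  fixes h :: "'a::RCA0_model \<Rightarrow> 'a"
  assumes "recf (\<lambda>e. h (e 0))" "\<And>i. h i < h (i + 1)"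
  shows "i \<le> h i" "i < j \<Longrightarrow> h i < h j"
proof -
  show "i \<le> h i"
  proof (rule rec_induct[where x = i])
    show "recp (\<lambda>e. e 0 \<le> h (e 0))" by (intro rec_intros recf_app1[OF assms(1)])
    show "i + 1 \<le> h (i + 1)" if "i \<le> h i" for i
      using that assms(2)[of i] unfolding discrete[symmetric] by (rule le_less_trans)
  qed (rule zero_le)
  have "i < j \<longrightarrow> h i < h j"
  proof (rule rec_induct[where x = j])
    show "recp (\<lambda>e. i < e 0 \<longrightarrow> h i < h (e 0))" by (intro rec_intros recf_app1[OF assms(1)])
    show "i < j + 1 \<longrightarrow> h i < h (j + 1)" if "i < j \<longrightarrow> h i < h j" for j
      using that assms(2) less_trans unfolding less_succ by blast
  qed (simp add: not_less_zero)
  then show "i < j \<Longrightarrow> h i < h j" ..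
qed

text \<open>Iterates the search for the next element, a step that increases the value and thus falls
  under \<open>monotone_recursion\<close>.\<close>

lemma (in exponential) enumeration:
  fixes P :: "'a \<Rightarrow> bool"
  assumes rec: "recp (\<lambda>e. P (e 0))" and inf: "\<And>x. \<exists>y>x. P y"
  obtains h where "recf (\<lambda>e. h (e 0))" "\<And>i. h i < h (i + 1)" "\<And>x. P x \<longleftrightarrow> (\<exists>i. x = h i)"
proof -
  define G where "G x y \<longleftrightarrow> P y \<and> x < y \<and> (\<forall>z<y. \<not> (P z \<and> x < z))" for x y
  have "recp (\<lambda>e. G (e 0) (e (Suc 0)))"
    unfolding G_def by (intro rec_intros recp_app1[OF rec])
  moreover have "\<exists>!y. G x y" for x
  proof -
    obtain y where "P y" "x < y" using inf by blast
    moreover have "recp (\<lambda>e. P (e 0) \<and> x < e 0)" by (intro rec_intros rec)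
    ultimately obtain y where "P y \<and> x < y" "\<And>z. z < y \<Longrightarrow> \<not> (P z \<and> x < z)"
      using least_number[of "\<lambda>y. P y \<and> x < y" y] by blast
    then have "G x y" unfolding G_def by blast
    moreover have "y' = y" if "G x y'" for y'
      using that \<open>G x y\<close> less_linear[of y y'] unfolding G_def by blast
    ultimately show ?thesis by blast
  qed
  ultimately obtain next_elem where N: "recf (\<lambda>e. next_elem (e 0))" "\<And>x y. G x y \<longleftrightarrow> y = next_elem x"
    by (rule rec_choice) (rule that)
  have G: "G x (next_elem x)" for x using N(2) by blast
  obtain y where "P y" using inf by blast
  obtain a where a: "P a" "\<And>z. z < a \<Longrightarrow> \<not> P z" using least_number[OF rec \<open>P y\<close>] by blast
  have "recf (\<lambda>e. next_elem (e (Suc 0)))" by (intro recf_app1[OF N(1)] recf_var)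
  moreover have "v \<le> next_elem v" for v using G[of v] unfolding G_def le_iff_less_or_eq by blast
  ultimately obtain h where h: "recf (\<lambda>e. h (e 0))" "h 0 = a" "\<And>n. h (n + 1) = next_elem (h n)"
    using monotone_recursion[of "\<lambda>n v. next_elem v" a] by metis
  have mono: "h i < h (i + 1)" for i using G[of "h i"] unfolding h(3) G_def by blast
  show ?thesis
  proof (rule that[OF h(1) mono])
    fix x
    show "P x \<longleftrightarrow> (\<exists>i. x = h i)"
    proof
      assume "P x"
      \<comment> \<open>Take the least \<open>i\<close> with \<open>x \<le> h i\<close>. If
        \<open>i\<close> has a predecessor, its value lies below \<open>x\<close>, so
        \<open>h i\<close>, the next element after it, cannot overshoot \<open>x\<close>.\<close>
      have rec_le: "recp (\<lambda>e. x \<le> h (e 0))" by (intro rec_intros recf_app1[OF h(1)])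
      obtain i where i: "x \<le> h i" "\<And>j. j < i \<Longrightarrow> \<not> x \<le> h j"
        using least_number[OF rec_le strict_mono_ge(1)[OF h(1) mono]] by blast
      from zero_or_succ[of i] show "\<exists>i. x = h i"
      proof (elim disjE exE)
        assume "i = 0"
        then have "x = h i" using i(1) a(2)[of x] \<open>P x\<close> h(2) unfolding le_iff_less_or_eq by blast
        then show ?thesis ..
      next
        fix j assume j: "i = j + 1"
        then have "h j < x" using i(2)[of j] by (simp add: less_succ)
        then have "x = h i"
          using G[of "h j"] i(1) \<open>P x\<close> unfolding j h(3) G_def le_iff_less_or_eq by blast
        then show ?thesis ..
      qed
    next
      assume "\<exists>i. x = h i"
      then obtain i where "x = h i" ..
      then show "P x"
        using zero_or_succ[of i] a(1) h(2,3) G unfolding G_def by auto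
    qed
  qed
qed

section \<open>Sums of adjacent elements\<close>

lemma times_less: "x * z < y * z \<Longrightarrow> x < y" for x y z :: "'a::RCA0_model"
  using times_mono[of y x z] by (meson not_less)

context exponential
begin

definition lam :: "'a \<Rightarrow> 'a \<Rightarrow> bool" where
  "lam n a \<longleftrightarrow> (\<exists>q\<le>n. n = (q + q + 1) * ex a)"

definition mu :: "'a \<Rightarrow> 'a \<Rightarrow> bool" where
  "mu n b \<longleftrightarrow> ex b \<le> n \<and> n < ex b + ex b"

lemma rec_lam: "recp (\<lambda>e. lam (e 0) (e (Suc 0)))"
  unfolding lam_def by (intro rec_intros recf_app1[OF rec_ex])

lemma rec_mu: "recp (\<lambda>e. mu (e 0) (e (Suc 0)))"
  unfolding mu_def by (intro rec_intros recf_app1[OF rec_ex])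

lemmas recp_lam = recp_app2[OF rec_lam]
lemmas recp_mu = recp_app2[OF rec_mu]

lemma lamI: "n = (q + q + 1) * ex a \<Longrightarrow> lam n a"
  unfolding lam_def
  using le_times_ex[of "q + q + 1" a] to_diff_nonneg[of q]
  by (intro exI[of _ q] conjI) (simp_all only: to_diff; linarith)+

lemma lam_ge: "lam n a \<Longrightarrow> ex a \<le> n"
  unfolding lam_def using digit_ge[of n a] digitI[OF ex_pos, of n _ a] by (metis add_0_right)

lemma lam_ex: "lam (ex a) a"
  by (rule lamI[of _ 0]) simp

lemma mu_ex: "mu (ex a) a"
  unfolding mu_def using ex_pos[of a] by (simp only: to_diff; linarith)

text \<open>Cancelling the smaller of the two powers would leave an odd number equal to an even
  one.\<close>

lemma lam_unique:
  assumes "lam n a" "lam n a'"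
  shows "a = a'"
proof -
  have False if "lam n a" "lam n a'" "a < a'" for a a'
  proof -
    obtain q where q: "n = (q + q + 1) * ex a" using \<open>lam n a\<close> unfolding lam_def by blast
    obtain q' where q': "n = (q' + q' + 1) * ex a'" using \<open>lam n a'\<close> unfolding lam_def by blast
    obtain k where k: "ex a' = (k + k) * ex a" using ex_even_multiple[OF \<open>a < a'\<close>] by blast
    have "(q + q + 1) * ex a = ((q' + q' + 1) * (k + k)) * ex a" using q q' k by (simp only: mult.assoc)
    then have "q + q + 1 = (q' + q' + 1) * (k + k)" using ex_pos by (rule times_cancel)
    then have "q + q + 1 = (q' + q' + 1) * k + (q' + q' + 1) * k" by (simp only: distrib_left)
    then show False using odd_not_even by blast
  qed
  then show ?thesis using assms less_linear by blast
qed

lemma mu_unique: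
  assumes "mu n b" "mu n b'"
  shows "b = b'"
proof -
  have False if "mu n b" "mu n b'" "b < b'" for b b'
    using that(1,2) ex_double_le[OF that(3)] unfolding mu_def by (meson le_less_trans less_irrefl less_le_trans)
  then show ?thesis using assms less_linear by blast
qed

lemma lam_le_mu:
  assumes "lam n a" "mu n b"
  shows "a \<le> b"
proof (rule ccontr)
  assume "\<not> a \<le> b"
  then have "ex b + ex b \<le> ex a" using ex_double_le by (simp only: not_le)
  then show False using lam_ge[OF assms(1)] assms(2) unfolding mu_def
    by (meson le_less_trans less_irrefl less_le_trans)
qed

text \<open>All digits of \<open>z\<close> lie below those of \<open>y\<close>. For the least
  exponent, \<open>y\<close> is an even multiple of \<open>ex a\<close>, and adding it to the odd
  multiple \<open>z\<close> leaves an odd one. For the greatest, \<open>y\<close> and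
  \<open>2 * ex b'\<close> are both multiples of \<open>ex a'\<close>; so \<open>y\<close> stays at
  least \<open>ex a'\<close> below \<open>2 * ex b'\<close>, and \<open>z\<close> is too small to
  fill this gap.\<close>

lemma lam_mu_add:
  assumes "lam z a" "mu z b" "lam y a'" "mu y b'" "b < a'"
  shows "lam (z + y) a" "mu (z + y) b'"
proof -
  obtain q where q: "z = (q + q + 1) * ex a" using assms(1) unfolding lam_def by blast
  obtain q' where q': "y = (q' + q' + 1) * ex a'" using assms(3) unfolding lam_def by blast
  have "a < a'" using lam_le_mu[OF assms(1,2)] assms(5) by (rule le_less_trans)
  then obtain k where k: "ex a' = (k + k) * ex a" using ex_even_multiple by blast
  define m where "m = q + (q' + q' + 1) * k"
  have "z + y = (m + m + 1) * ex a" unfolding q q' k m_def by (simp add: algebra_simps)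
  then show "lam (z + y) a" by (rule lamI)
  have "a' \<le> b' + 1" using lam_le_mu[OF assms(3,4)] unfolding le_iff_less_succ less_succ by blast
  then obtain m where m: "ex b' + ex b' = m * ex a'" using ex_multiple[of a' "b' + 1"] unfolding ex_succ by blast
  have "(q' + q' + 1) * ex a' < m * ex a'" using assms(4) unfolding mu_def m q' by blast
  then have "q' + q' + 1 + 1 \<le> m" unfolding discrete[symmetric] by (rule times_less)
  then have "(q' + q' + 1 + 1) * ex a' \<le> m * ex a'" by (rule times_mono)
  moreover have "(q' + q' + 1 + 1) * ex a' = y + ex a'" unfolding q' by (simp only: distrib_right mult_1_left)
  ultimately have "y + ex a' \<le> ex b' + ex b'" unfolding m by simp
  moreover have "z < ex a'" using assms(2) ex_double_le[OF assms(5)] unfolding mu_def by (meson less_le_trans)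
  moreover have "ex b' \<le> y" using assms(4) unfolding mu_def by blast
  ultimately show "mu (z + y) b'"
    unfolding mu_def using to_diff_nonneg[of z] by (intro conjI) (simp_all only: to_diff; linarith)+
qed

text \<open>Applied twice: to the elements of an apart set with their two exponents, and to a list
  of single powers of two, where \<open>u\<close> and \<open>v\<close> are both the list of
  exponents. Such a list is controlled only up to its length, so the conditions on the values are
  confined to indices up to \<open>j\<close>.\<close>

lemma adjacent_sums:
  assumes rec: "recf (\<lambda>e. h (e 0))" "recf (\<lambda>e. s (e 0))" "recf (\<lambda>e. u (e 0))" "recf (\<lambda>e. v (e 0))"
    and lam: "\<And>i. i \<le> j \<Longrightarrow> lam (h i) (u i)" and mu: "\<And>i. i \<le> j \<Longrightarrow> mu (h i) (v i)"
    and apart: "\<And>i. i < j \<Longrightarrow> v i < u (i + 1)" and sum: "\<And>n. n \<le> j \<Longrightarrow> s (n + 1) = s n + h n"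
    and "i \<le> j"
  shows "\<exists>z. s (j + 1) = s i + z \<and> lam z (u i) \<and> mu z (v j)"
proof -
  \<comment> \<open>Induction on the number of further summands; bounding \<open>z\<close> by the
    partial sum keeps the formula \<Delta>1.\<close>
  let ?P = "\<lambda>d. i + d \<le> j \<longrightarrow>
    (\<exists>z\<le>s (i + d + 1). s (i + d + 1) = s i + z \<and> lam z (u i) \<and> mu z (v (i + d)))"
  have P: "?P d" for d
  proof (rule rec_induct[where x = d])
    show "recp (\<lambda>e. ?P (e 0))"
      by (intro rec_intros recp_lam recp_mu recf_app1[OF rec(2)] recf_app1[OF rec(3)] recf_app1[OF rec(4)])
    show "?P 0"
    proof
      assume "i + 0 \<le> j"
      then have "i \<le> j" by (simp only: plus_zero)
      then have "s (i + 1) = s i + h i \<and> lam (h i) (u i) \<and> mu (h i) (v i)" using sum lam mu by blast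
      moreover from this have "h i \<le> s (i + 1)" using zero_le[of "s i"] by (simp only: to_diff; linarith)
      ultimately show "\<exists>z\<le>s (i + 0 + 1). s (i + 0 + 1) = s i + z \<and> lam z (u i) \<and> mu z (v (i + 0))"
        unfolding plus_zero by blast
    qed
    fix d assume IH: "?P d"
    show "?P (d + 1)"
      unfolding plus_succ
    proof
      let ?j = "i + d + 1"
      assume j: "?j \<le> j"
      then have j': "i + d < j" unfolding discrete .
      then obtain z where z: "s ?j = s i + z" "lam z (u i)" "mu z (v (i + d))"
        using IH unfolding le_iff_less_or_eq by blast
      have "s (?j + 1) = s i + (z + h ?j)" using sum[OF j] z(1) by (simp only: plus_assoc)
      moreover from this have "z + h ?j \<le> s (?j + 1)" using zero_le[of "s i"] by (simp only: to_diff; linarith)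
      moreover have "lam (z + h ?j) (u i)" "mu (z + h ?j) (v ?j)"
        using lam_mu_add[OF z(2,3) lam[OF j] mu[OF j] apart[OF j']] by blast+
      ultimately show "\<exists>z\<le>s (?j + 1). s (?j + 1) = s i + z \<and> lam z (u i) \<and> mu z (v ?j)" by blast
    qed
  qed
  obtain d where "j = i + d" using \<open>i \<le> j\<close> unfolding le_iff_plus ..
  then show ?thesis using P[of d] by blast
qed

end

text \<open>As \<open>i \<le> u i\<close>, the search for an index is bounded by the value;
  therefore the range is \<Delta>1 and exists as a set.\<close>

lemma strict_mono_range:
  fixes u :: "'a::RCA0_model \<Rightarrow> 'a"
  assumes "recf (\<lambda>e. u (e 0))" "\<And>i. u i < u (i + 1)"
  obtains X where "\<And>a. mem X a \<longleftrightarrow> (\<exists>i. a = u i)" "\<And>x :: 'a. \<exists>y>x. mem X y"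
proof -
  have "(\<exists>i. a = u i) \<longleftrightarrow> (\<exists>i\<le>a. a = u i)" for a using strict_mono_ge(1)[OF assms] by blast
  moreover have "recp (\<lambda>e. \<exists>i\<le>e 0. e 0 = u i)" by (intro rec_intros recf_app1[OF assms(1)])
  ultimately have "recp (\<lambda>e. \<exists>i. e 0 = u i)" by simp
  then obtain X where X: "\<And>a. mem X a \<longleftrightarrow> (\<exists>i. a = u i)" by (rule rec_comprehension) (rule that)
  have "\<exists>y>x. mem X y" for x :: 'a
  proof (intro exI conjI)
    show "x < u (x + 1)" using strict_mono_ge(1)[OF assms, of "x + 1"] unfolding discrete .
    show "mem X (u (x + 1))" using X by blast
  qed
  then show ?thesis using that X by blast
qed

section \<open>The meaning of the formulas\<close>

text \<open>The connectives are abbreviations by implications. These equations open one of them at a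
  time and leave the subformulas folded.\<close>

lemma sat_And: "sat z u a m l M e S (p \<^bold>\<and> q) \<longleftrightarrow> sat z u a m l M e S p \<and> sat z u a m l M e S q"
  by simp

lemma sat_ExN: "sat z u a m l M e S (ExN p) \<longleftrightarrow> (\<exists>x. sat z u a m l M (case_nat x e) S p)"
  by simp

lemma sat_ExS: "sat z u a m l M e S (ExS p) \<longleftrightarrow> (\<exists>X. sat z u a m l M e (case_nat X S) p)"
  by simp

definition represents :: "nat \<Rightarrow> ('a::RCA0_model \<Rightarrow> 'a) \<Rightarrow> bool" where
  "represents F f \<longleftrightarrow> (\<forall>z. mem F z \<longleftrightarrow> (\<exists>x. z = pair x (f x)))"

lemma represents_mem: "represents F f \<Longrightarrow> mem F (pair x y) \<longleftrightarrow> y = f x"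
  by (auto simp: represents_def pair_inject)

lemma represents_recf:
  assumes "represents F f"
  shows "recf (\<lambda>e. f (e 0))"
proof (rule recfI)
  show "recp (\<lambda>e. mem F (pair (e (Suc 0)) (e 0)))" by (intro rec_intros recf_pair)
qed (simp add: represents_mem[OF assms])

lemma represents_exists:
  assumes "recf (\<lambda>e. f (e 0))"
  obtains F where "represents F f"
proof -
  have "(\<exists>x. z = pair x (f x)) \<longleftrightarrow> (\<exists>x\<le>z. z = pair x (f x))" for z
    using pair_ge(1) by blast
  moreover have "recp (\<lambda>e. \<exists>x\<le>e 0. e 0 = pair x (f x))"
    by (intro rec_intros recf_pair recf_app1[OF assms])
  ultimately have "recp (\<lambda>e. \<exists>x. e 0 = pair x (f x))" by simp
  then obtain F where "\<And>z. mem F z \<longleftrightarrow> (\<exists>x. z = pair x (f x))" by (rule rec_comprehension) (rule that)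
  then show ?thesis using that unfolding represents_def by blast
qed

lemma val_pr [simp]: "val e (pr s t) = pair (val e s) (val e t)"
  by (simp add: pr_def pair_def)

lemma holds_Fun:
  fixes e :: "nat \<Rightarrow> 'a::RCA0_model"
  shows "holds e S (Fun F) \<longleftrightarrow> (\<exists>f :: 'a \<Rightarrow> 'a. represents (S F) f)" (is "_ \<longleftrightarrow> ?R")
proof
  assume "holds e S (Fun F)"
  then have F: "\<And>z :: 'a. mem (S F) z \<Longrightarrow> \<exists>x y. z = pair x y"
      "\<And>x :: 'a. \<exists>y. mem (S F) (pair x y)"
      "\<And>x y y' :: 'a. mem (S F) (pair x y) \<Longrightarrow> mem (S F) (pair x y') \<Longrightarrow> y = y'"
    unfolding Fun_def by (auto simp: App_def)
  obtain f :: "'a \<Rightarrow> 'a" where f: "\<And>x. mem (S F) (pair x (f x))" using F(2) by metis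
  have "represents (S F) f" unfolding represents_def using F(1,3) f by metis
  then show ?R by blast
next
  assume ?R
  then obtain f :: "'a \<Rightarrow> 'a" where f: "represents (S F) f" ..
  then have "\<exists>x y. z = pair x y" if "mem (S F) z" for z :: 'a
    using that unfolding represents_def by blast
  then show "holds e S (Fun F)"
    unfolding Fun_def by (auto simp: App_def represents_mem[OF f])
qed

lemma holds_Partial_sums:
  fixes e :: "nat \<Rightarrow> 'a::RCA0_model"
    and g h :: "'a \<Rightarrow> 'a"
  assumes "represents (S s) g" "represents (S f) h"
  shows "holds e S (Partial_sums s f) \<longleftrightarrow> g 0 = 0 \<and> (\<forall>n. g (n + 1) = g n + h n)"
proof -
  have "holds e S (Fun s)" unfolding holds_Fun using assms(1) by blast
  then show ?thesis
    by (auto simp: Partial_sums_def App_def represents_mem[OF assms(1)] represents_mem[OF assms(2)])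
qed

lemma holds_Pow2:
  fixes e :: "nat \<Rightarrow> 'a::RCA0_model"
  shows "holds e S (Pow2 x y) \<longleftrightarrow>
    (\<exists>E f. represents E f \<and> f 0 = 1 \<and> (\<forall>n. f (n + 1) = f n + f n) \<and> val e y = f (val e x))"
    (is "_ \<longleftrightarrow> (\<exists>E f. ?R E f)")
proof -
  have *: "holds e (case_nat E S) (Fun 0 \<^bold>\<and> App 0 \<^bold>0 \<^bold>1 \<^bold>\<and>
      AllN (AllN (App 0 (Var 1) (Var 0) \<^bold>\<longrightarrow> App 0 (Var 1 \<^bold>+ \<^bold>1) (Var 0 \<^bold>+ Var 0))) \<^bold>\<and>
      App 0 x y) \<longleftrightarrow> (\<exists>f. ?R E f)" for E
  proof (cases "\<exists>f :: 'a \<Rightarrow> 'a. represents E f")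
    case True
    then obtain f :: "'a \<Rightarrow> 'a" where f: "represents E f" ..
    have "g = f" if "represents E g" for g
      using represents_mem[OF that] represents_mem[OF f] by (simp add: fun_eq_iff)
    then have "(\<exists>g. ?R E g) \<longleftrightarrow> ?R E f" using f by blast
    moreover have "holds e (case_nat E S) (Fun 0)" unfolding holds_Fun using f by auto
    ultimately show ?thesis
      by (auto simp: App_def represents_mem[OF f] f)
  next
    case False
    then have "\<not> holds e (case_nat E S) (Fun 0)" unfolding holds_Fun by simp
    with False show ?thesis by auto
  qed
  show ?thesis unfolding *[symmetric] Pow2_def by (simp add: conj_ac)
qed

text \<open>An elimination rule, because \<open>Lambda\<close> and \<open>Mu\<close> occur in
  \<open>AHT_k\<close> only within \<open>Apart\<close>, which is part of what the hypothesis
  delivers. Each power comes with an exponential function \<open>f\<close> of its own.\<close>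

lemma holds_Binary:
  fixes e :: "nat \<Rightarrow> 'a::RCA0_model" and \<tau> :: "'a \<Rightarrow> 'a"
  assumes "holds e S (Binary n p t)" "represents (S t) \<tau>"
  obtains g s :: "'a \<Rightarrow> 'a" where "0 < val e p" "\<And>i j. i < j \<Longrightarrow> j < val e p \<Longrightarrow> \<tau> i < \<tau> j"
    "recf (\<lambda>e. g (e 0))" "recf (\<lambda>e. s (e 0))"
    "\<And>i. i < val e p \<Longrightarrow> \<exists>E f. represents E f \<and> f 0 = 1 \<and> (\<forall>n. f (n + 1) = f n + f n) \<and> g i = f (\<tau> i)"
    "s 0 = 0" "\<And>i. s (i + 1) = s i + g i" "s (val e p) = val e n"
proof -
  from assms have p: "0 < val e p" "\<And>i j. i < j \<Longrightarrow> j < val e p \<Longrightarrow> \<tau> i < \<tau> j"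
    by (auto simp: Binary_def App_def represents_mem[OF assms(2)])
  from assms(1) obtain G T where "holds e (case_nat T (case_nat G S)) (Fun 1)"
    and pow: "holds e (case_nat T (case_nat G S)) (AllN (AllN (AllN (Var 2 \<^bold>< up (up (up p)) \<^bold>\<and>
         App (Suc (Suc t)) (Var 2) (Var 1) \<^bold>\<and> App 1 (Var 2) (Var 0) \<^bold>\<longrightarrow> Pow2 (Var 1) (Var 0)))))"
    and sums: "holds e (case_nat T (case_nat G S)) (Partial_sums 0 1)"
    and last: "holds e (case_nat T (case_nat G S)) (App 0 p n)"
    unfolding Binary_def sat_And sat_ExS by blast
  then obtain g :: "'a \<Rightarrow> 'a" where g: "represents G g" unfolding holds_Fun by auto
  from sums obtain s :: "'a \<Rightarrow> 'a" where s: "represents T s"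
    unfolding Partial_sums_def sat_And holds_Fun by auto
  have "s 0 = 0" "\<And>i. s (i + 1) = s i + g i"
    using sums holds_Partial_sums[of "case_nat T (case_nat G S)" 0 s 1 g e] g s by simp_all
  moreover have "s (val e p) = val e n" using last by (simp add: App_def represents_mem[OF s])
  moreover have "\<exists>E f. represents E f \<and> f 0 = 1 \<and> (\<forall>n. f (n + 1) = f n + f n) \<and> g i = f (\<tau> i)"
    if "i < val e p" for i
    using pow that
    by (simp add: App_def holds_Pow2 represents_mem[OF g] represents_mem[OF assms(2)])
  ultimately show ?thesis using that p represents_recf[OF g] represents_recf[OF s] by blast
qed

text \<open>The list of powers is nonempty, and the witness for \<open>Pow2\<close> at its first
  entry is the function sought.\<close>

lemma Binary_exponential:
  fixes e :: "nat \<Rightarrow> 'a::RCA0_model" and \<tau> :: "'a \<Rightarrow> 'a"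
  assumes "holds e S (Binary n p t)" "represents (S t) \<tau>"
  obtains ex :: "'a \<Rightarrow> 'a" where "exponential ex"
proof -
  obtain g :: "'a \<Rightarrow> 'a" where p: "0 < val e p" and
    g: "\<And>i. i < val e p \<Longrightarrow> \<exists>E f. represents E f \<and> f 0 = 1 \<and> (\<forall>n. f (n + 1) = f n + f n) \<and> g i = f (\<tau> i)"
    by (rule holds_Binary[OF assms]) (rule that)
  from g[OF p] obtain E and f :: "'a \<Rightarrow> 'a" where "represents E f" "f 0 = 1" "\<forall>n. f (n + 1) = f n + f n" by blast
  then have "exponential f" by (simp add: exponential_def represents_recf)
  then show ?thesis by (rule that)
qed

context exponential
begin

text \<open>Makes the separate witnesses for \<open>Pow2\<close> within one \<open>Binary\<close>
  agree with the fixed \<open>ex\<close>.\<close>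

lemma exponential_unique:
  assumes "recf (\<lambda>e. f (e 0))" "f 0 = 1" "\<And>n. f (n + 1) = f n + f n"
  shows "f x = ex x"
proof (rule rec_induct[where x = x])
  show "recp (\<lambda>e. f (e 0) = ex (e 0))"
    by (intro rec_intros recf_app1[OF rec_ex] recf_app1[OF assms(1)])
qed (simp_all add: assms(2,3) ex_zero ex_succ)

text \<open>\<open>n\<close> is the sum of the powers at the places \<open>0\<close> to
  \<open>q\<close>, an instance of \<open>adjacent_sums\<close> with \<open>\<tau>\<close> for both
  exponents. The length is \<open>q + 1\<close>, so the last exponent stands at place
  \<open>q\<close>.\<close>

lemma Binary_lam_mu:
  fixes e :: "nat \<Rightarrow> 'a" and \<tau> :: "'a \<Rightarrow> 'a"
  assumes "holds e S (Binary n p t)" "represents (S t) \<tau>" "val e p = q + 1"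
  shows "lam (val e n) (\<tau> 0)" "mu (val e n) (\<tau> q)"
proof -
  obtain g s where \<tau>: "\<And>i j. i < j \<Longrightarrow> j < val e p \<Longrightarrow> \<tau> i < \<tau> j"
    and rec: "recf (\<lambda>e. g (e 0))" "recf (\<lambda>e. s (e 0))"
    and g: "\<And>i. i < val e p \<Longrightarrow> \<exists>E f. represents E f \<and> f 0 = 1 \<and> (\<forall>n. f (n + 1) = f n + f n) \<and> g i = f (\<tau> i)"
    and s: "s 0 = 0" "\<And>i. s (i + 1) = s i + g i" "s (val e p) = val e n"
    by (rule holds_Binary[OF assms(1,2)]) (rule that)
  have g: "g i = ex (\<tau> i)" if i: "i \<le> q" for i
  proof -
    have "i < val e p" using i unfolding assms(3) le_iff_less_succ .
    from g[OF this] obtain E f where f: "represents E f" "f 0 = 1" "\<forall>n. f (n + 1) = f n + f n" "g i = f (\<tau> i)"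
      by blast
    have "f (\<tau> i) = ex (\<tau> i)"
      using represents_recf[OF f(1)] f(2) f(3)[rule_format] by (rule exponential_unique)
    then show ?thesis using f(4) by (simp only:)
  qed
  have "\<exists>z. s (q + 1) = s 0 + z \<and> lam z (\<tau> 0) \<and> mu z (\<tau> q)"
  proof (rule adjacent_sums[OF rec represents_recf[OF assms(2)] represents_recf[OF assms(2)]])
    show "lam (g i) (\<tau> i)" "mu (g i) (\<tau> i)" if "i \<le> q" for i
      using that by (simp_all add: g lam_ex mu_ex)
    show "\<tau> i < \<tau> (i + 1)" if "i < q" for i
      using that by (intro \<tau>) (simp add: less_succ, simp only: assms(3) plus_less_cancel)
  qed (use s zero_le in simp_all)
  then show "lam (val e n) (\<tau> 0)" "mu (val e n) (\<tau> q)" using s assms(3) by simp_all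
qed

lemma Lambda_lam:
  fixes e :: "nat \<Rightarrow> 'a"
  assumes "holds e S (Lambda n a)"
  shows "lam (val e n) (val e a)"
proof -
  from assms obtain T x where T: "holds (case_nat x e) (case_nat T S) (Binary (up n) (Var 0) 0)"
    "holds (case_nat x e) (case_nat T S) (App 0 \<^bold>0 (up a))"
    unfolding Lambda_def sat_And sat_ExN sat_ExS by blast
  from T(1) obtain \<tau> :: "'a \<Rightarrow> 'a" where \<tau>: "represents T \<tau>"
    unfolding Binary_def sat_And holds_Fun by auto
  have "0 < x" using T(1) unfolding Binary_def sat_And by simp
  then obtain q where "x = q + 1" using zero_or_succ[of x] less_irrefl by blast
  then show ?thesis
    using Binary_lam_mu(1)[OF T(1), of \<tau> q] \<tau> T(2) by (simp add: App_def represents_mem[OF \<tau>])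
qed

text \<open>\<open>Apart\<close> mentions the least exponent only for the larger of two elements.
  That of the smaller one is recovered here from the expansion which witnesses
  \<open>Mu\<close>.\<close>

lemma Mu_mu:
  fixes e :: "nat \<Rightarrow> 'a"
  assumes "holds e S (Mu n a)"
  shows "mu (val e n) (val e a)" "\<exists>a. lam (val e n) a"
proof -
  from assms obtain T q where T: "holds (case_nat q e) (case_nat T S) (Binary (up n) (Var 0 \<^bold>+ \<^bold>1) 0)"
    "holds (case_nat q e) (case_nat T S) (App 0 (Var 0) (up a))"
    unfolding Mu_def sat_And sat_ExN sat_ExS by blast
  from T(1) obtain \<tau> :: "'a \<Rightarrow> 'a" where \<tau>: "represents T \<tau>"
    unfolding Binary_def sat_And holds_Fun by auto
  show "mu (val e n) (val e a)" "\<exists>a. lam (val e n) a"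
    using Binary_lam_mu[OF T(1), of \<tau> q] \<tau> T(2) by (auto simp: App_def represents_mem[OF \<tau>])
qed

end

lemma Mu_exponential:
  fixes e :: "nat \<Rightarrow> 'a::RCA0_model"
  assumes "holds e S (Mu n a)"
  obtains ex :: "'a \<Rightarrow> 'a" where "exponential ex"
proof -
  from assms obtain T x where T: "holds (case_nat x e) (case_nat T S) (Binary (up n) (Var 0 \<^bold>+ \<^bold>1) 0)"
    unfolding Mu_def sat_And sat_ExN sat_ExS by blast
  from T obtain \<tau> :: "'a \<Rightarrow> 'a" where "represents (case_nat T S 0) \<tau>"
    unfolding Binary_def sat_And holds_Fun by auto
  with T show ?thesis by (rule Binary_exponential) (rule that)
qed

lemma holds_Apart:
  fixes e :: "nat \<Rightarrow> 'a::RCA0_model"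
  assumes "holds e S (Apart X)" "mem (S X) x" "mem (S X) y" "x < y"
  obtains a b where
    "holds (case_nat a (case_nat b (case_nat y (case_nat x e)))) S (Mu (Var 3) (Var 1))"
    "holds (case_nat a (case_nat b (case_nat y (case_nat x e)))) S (Lambda (Var 2) (Var 0))"
    "b < a"
proof -
  from assms(1) have "\<forall>x y. mem (S X) x \<and> mem (S X) y \<and> x < y \<longrightarrow> (\<exists>b a.
      holds (case_nat a (case_nat b (case_nat y (case_nat x e)))) S (Mu (Var 3) (Var 1)) \<and>
      holds (case_nat a (case_nat b (case_nat y (case_nat x e)))) S (Lambda (Var 2) (Var 0)) \<and> b < a)"
    by (simp add: Apart_def)
  then show ?thesis using assms(2-4) that by blast
qed

text \<open>An introduction rule, because \<open>AS\<close> is the premise of the homogeneity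
  clause. That \<open>h\<close> and \<open>s\<close> are recursive provides the sets which
  \<open>AS\<close> quantifies over.\<close>

lemma holds_AS:
  fixes e :: "nat \<Rightarrow> 'a::RCA0_model"
  assumes "recf (\<lambda>e. h (e 0))" "recf (\<lambda>e. s (e 0))"
    and "\<And>i j. i < j \<Longrightarrow> h i < h j" "\<And>x. mem (S H) x \<longleftrightarrow> (\<exists>i. x = h i)"
    and "s 0 = 0" "\<And>n. s (n + 1) = s n + h n" "i \<le> j" "s (j + 1) = s i + val e z"
  shows "holds e S (AS H z)"
proof -
  obtain F where F: "represents F h" using represents_exists[OF assms(1)] by blast
  obtain G where G: "represents G s" using represents_exists[OF assms(2)] by blast
  let ?S = "case_nat G (case_nat F S)"
  have "holds e ?S (Enumerates 1 (Suc (Suc H)))"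
    unfolding Enumerates_def using F assms(3,4) by (auto simp: holds_Fun App_def represents_mem[OF F])
  moreover have "holds e ?S (Partial_sums 0 1)"
    using holds_Partial_sums[of ?S 0 s 1 h e] F G assms(5,6) by simp
  moreover have "holds e ?S (ExN (ExN (ExN (Var 2 \<^bold>\<le> Var 1 \<^bold>\<and> App 0 (Var 2) (Var 0) \<^bold>\<and>
        App 0 (Var 1 \<^bold>+ \<^bold>1) (Var 0 \<^bold>+ up (up (up z)))))))"
    unfolding sat_ExN
  proof (intro exI)
    show "holds (case_nat (s i) (case_nat j (case_nat i e))) ?S (Var 2 \<^bold>\<le> Var 1 \<^bold>\<and>
        App 0 (Var 2) (Var 0) \<^bold>\<and> App 0 (Var 1 \<^bold>+ \<^bold>1) (Var 0 \<^bold>+ up (up (up z))))"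
      using assms(7) assms(8)[symmetric] by (auto simp: App_def represents_mem[OF G] le_iff_less_or_eq)
  qed
  ultimately show ?thesis unfolding AS_def sat_And sat_ExS by blast
qed

section \<open>From adjacent sums to polarized pairs\<close>

lemma holds_Infinite:
  fixes e :: "nat \<Rightarrow> 'a::RCA0_model"
  shows "holds e S (Infinite X) \<longleftrightarrow> (\<forall>x :: 'a. \<exists>y>x. mem (S X) y)"
  by (simp add: Infinite_def)

lemma holds_Pair_map_into:
  fixes e :: "nat \<Rightarrow> 'a::RCA0_model"
  assumes "holds e S (Pair_map_into F k)"
  shows "\<And>x y :: 'a. x < y \<Longrightarrow> \<exists>v. mem (S F) (pair (pair x y) v)"
    and "\<And>x y v w :: 'a. mem (S F) (pair (pair x y) v) \<Longrightarrow> mem (S F) (pair (pair x y) w) \<Longrightarrow> v = w"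
    and "\<And>x y v. mem (S F) (pair (pair x y) v) \<Longrightarrow> v < val e k"
proof -
  from assms have 1: "\<forall>z. mem (S F) z \<longrightarrow> (\<exists>x y v. x < y \<and> v < val e k \<and> z = pair (pair x y) v)"
    and 2: "\<forall>x y :: 'a. x < y \<longrightarrow> (\<exists>v. mem (S F) (pair (pair x y) v))"
    and 3: "\<forall>z v w :: 'a. mem (S F) (pair z v) \<and> mem (S F) (pair z w) \<longrightarrow> v = w"
    unfolding Pair_map_into_def sat_And by (simp_all add: App_def)
  show "\<exists>v. mem (S F) (pair (pair x y) v)" if "x < y" for x y :: 'a using 2 that by blast
  show "v = w" if "mem (S F) (pair (pair x y) v)" "mem (S F) (pair (pair x y) w)" for x y v w :: 'a
    using 3 that by blast
  show "v < val e k" if "mem (S F) (pair (pair x y) v)" for x y v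
    using 1[rule_format, OF that] unfolding pair_inject by blast
qed

text \<open>The colouring enters as a recursive function and becomes a set here; \<open>R\<close>
  stands for the assignment of the remaining set variables.\<close>

lemma holds_AHT_k:
  fixes e :: "nat \<Rightarrow> 'a::RCA0_model"
  assumes "holds e S (AHT_k k)" "recf (\<lambda>e. f (e 0))" "\<And>x. f x < val e k"
  obtains H R c where "\<And>x :: 'a. \<exists>y>x. mem H y" "holds e (case_nat H R) (Apart 0)"
    "\<And>z. holds (case_nat z (case_nat c e)) (case_nat H R) (AS 0 (Var 0)) \<Longrightarrow> c = f z"
proof -
  obtain C where C: "represents C f" using represents_exists[OF assms(2)] by blast
  have "holds e (case_nat C S) (Fun 0)" unfolding holds_Fun using C by auto
  moreover have "holds e (case_nat C S) (AllN (AllN (App 0 (Var 1) (Var 0) \<^bold>\<longrightarrow> Var 0 \<^bold>< up (up k))))"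
    using assms(3) by (simp add: App_def represents_mem[OF C])
  ultimately have "holds e (case_nat C S) (Map_into 0 k)" unfolding Map_into_def sat_And by blast
  then have "holds e (case_nat C S) (ExS (Infinite 0 \<^bold>\<and> AllN (Var 0 \<^bold>\<in> 0 \<^bold>\<longrightarrow> \<^bold>0 \<^bold>< Var 0) \<^bold>\<and> Apart 0 \<^bold>\<and>
        ExN (AllN (AS 0 (Var 0) \<^bold>\<longrightarrow> App 1 (Var 0) (Var 1)))))"
    using assms(1) unfolding AHT_k_def sat.simps(7) sat.simps(5)[of _ _ _ _ _ _ _ _ "Map_into 0 k"] by blast
  then obtain H c where "holds e (case_nat H (case_nat C S)) (Infinite 0)"
    and apart: "holds e (case_nat H (case_nat C S)) (Apart 0)"
    and c: "holds (case_nat c e) (case_nat H (case_nat C S)) (AllN (AS 0 (Var 0) \<^bold>\<longrightarrow> App 1 (Var 0) (Var 1)))"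
    unfolding sat_And sat_ExN sat_ExS by blast
  then have "\<exists>y>x. mem H y" for x :: 'a unfolding holds_Infinite by simp
  moreover have "c = f z" if "holds (case_nat z (case_nat c e)) (case_nat H (case_nat C S)) (AS 0 (Var 0))" for z
    using c that by (simp add: App_def represents_mem[OF C])
  ultimately show ?thesis using that apart by blast
qed

theorem holds_AHT_k_imp_IPT2_k:
  fixes e :: "nat \<Rightarrow> 'a::RCA0_model"
  assumes AHT: "holds e S (AHT_k k)"
  shows "holds e S (IPT2_k k)"
proof -
  have "\<exists>X Y c. (\<forall>x :: 'a. \<exists>y>x. mem X y) \<and> (\<forall>x :: 'a. \<exists>y>x. mem Y y) \<and> c < val e k \<and>
      (\<forall>x y. mem X x \<and> mem Y y \<and> x < y \<longrightarrow> mem F (pair (pair x y) c))"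
    if "holds e (case_nat F S) (Pair_map_into 0 k)" for F
  proof -
    note F = holds_Pair_map_into[OF that, simplified nat.case]
    \<comment> \<open>The pair \<open>(0, 1)\<close> has a colour below \<open>k\<close>, so
      \<open>k\<close> is positive and the constant colour \<open>0\<close> is admissible.\<close>
    have "(0 :: 'a) < 0 + 1" unfolding less_succ by blast
    then have "0 < val e k" using F(1,3) zero_le le_less_trans by metis

    \<comment> \<open>Two elements of this first set are enough: the witness for \<open>Mu\<close>
      at the smaller one contains the exponential function.\<close>
    obtain H R c where "\<And>x :: 'a. \<exists>y>x. mem H y" and H: "holds e (case_nat H R) (Apart 0)"
      by (rule holds_AHT_k[OF AHT recf_const \<open>0 < val e k\<close>]) (rule that)
    then obtain x y :: 'a where "mem (case_nat H R 0) x" "mem (case_nat H R 0) y" "x < y"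
      unfolding nat.case by blast
    with H obtain b a where
      "holds (case_nat a (case_nat b (case_nat y (case_nat x e)))) (case_nat H R) (Mu (Var 3) (Var 1))"
      by (rule holds_Apart)
    then obtain ex :: "'a \<Rightarrow> 'a" where "exponential ex" by (rule Mu_exponential)
    then interpret exponential ex .

    \<comment> \<open>The graph of the colouring. If the exponents are equal, as for powers of two,
      or missing, as for \<open>n = 0\<close>, the pair has no colour under \<open>F\<close> and
      \<open>0\<close> is the default. Bounding \<open>a\<close> and \<open>b\<close> by
      \<open>n\<close> makes the graph recursive.\<close>
    define G where "G n v \<longleftrightarrow> (\<exists>a\<le>n. \<exists>b\<le>n. lam n a \<and> mu n b \<and> a < b \<and> mem F (pair (pair a b) v)) \<or>
      \<not> (\<exists>a\<le>n. \<exists>b\<le>n. lam n a \<and> mu n b \<and> a < b) \<and> v = 0" for n v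
    have "recp (\<lambda>e. G (e 0) (e (Suc 0)))"
      unfolding G_def by (intro rec_intros recp_lam recp_mu recf_pair)
    moreover have "\<exists>!v. G n v" for n
    proof (cases "\<exists>a\<le>n. \<exists>b\<le>n. lam n a \<and> mu n b \<and> a < b")
      case True
      then obtain a b where ab: "a \<le> n" "b \<le> n" "lam n a" "mu n b" "a < b" by blast
      then obtain v where v: "mem F (pair (pair a b) v)" using F(1) by blast
      have "w = v" if "G n w" for w
        using that True lam_unique[OF ab(3)] mu_unique[OF ab(4)] F(2)[OF _ v] unfolding G_def by blast
      then show ?thesis using ab v unfolding G_def by blast
    qed (auto simp: G_def)
    ultimately obtain f where f: "recf (\<lambda>e. f (e 0))" "\<And>n v. G n v \<longleftrightarrow> v = f n"
      by (rule rec_choice) (rule that)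
    have f_cases: "(\<exists>a b. lam n a \<and> mu n b \<and> mem F (pair (pair a b) (f n))) \<or>
        \<not> (\<exists>a\<le>n. \<exists>b\<le>n. lam n a \<and> mu n b \<and> a < b) \<and> f n = 0" for n
    proof -
      have "G n (f n)" using f(2) by blast
      then show ?thesis unfolding G_def by blast
    qed
    have f_less: "f n < val e k" for n
      using f_cases[of n] F(3) \<open>0 < val e k\<close> by auto
    have f_color: "mem F (pair (pair a b) (f n))" if ab: "lam n a" "mu n b" "a < b" for n a b
    proof -
      \<comment> \<open>The bounds in \<open>G\<close> lose nothing, since an exponent is smaller
        than its power of two, which is at most \<open>n\<close>.\<close>
      have "a \<le> n" using lam_ge[OF ab(1)] less_ex[of a] by (meson less_imp_le less_le_trans)
      moreover have "b \<le> n" using ab(2) less_ex[of b] unfolding mu_def by (meson less_imp_le less_le_trans)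
      ultimately obtain a' b' where "lam n a'" "mu n b'" "mem F (pair (pair a' b') (f n))"
        using f_cases[of n] ab by blast
      then show ?thesis using lam_unique[OF ab(1)] mu_unique[OF ab(2)] by blast
    qed

    obtain H R c where inf: "\<And>x :: 'a. \<exists>y>x. mem H y" and apart: "holds e (case_nat H R) (Apart 0)"
      and c: "\<And>z. holds (case_nat z (case_nat c e)) (case_nat H R) (AS 0 (Var 0)) \<Longrightarrow> c = f z"
      by (rule holds_AHT_k[OF AHT f(1) f_less]) (rule that)
    have apart: "(\<exists>b a. mu x b \<and> lam y a \<and> b < a) \<and> (\<exists>a. lam x a)" if xy: "mem H x" "mem H y" "x < y" for x y
    proof -
      have "mem (case_nat H R 0) x" "mem (case_nat H R 0) y" using xy by simp_all
      with apart obtain a b where *: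
        "holds (case_nat a (case_nat b (case_nat y (case_nat x e)))) (case_nat H R) (Mu (Var 3) (Var 1))"
        "holds (case_nat a (case_nat b (case_nat y (case_nat x e)))) (case_nat H R) (Lambda (Var 2) (Var 0))"
        "b < a"
        by (rule holds_Apart[OF _ _ _ xy(3)]) (rule that)
      show ?thesis using Mu_mu[OF *(1)] Lambda_lam[OF *(2)] *(3) by auto
    qed

    have rec_H: "recp (\<lambda>e :: nat \<Rightarrow> 'a. mem H (e 0))" by (intro rec_intros)
    obtain h where h: "recf (\<lambda>e. h (e 0))" "\<And>i :: 'a. h i < h (i + 1)"
      "\<And>x :: 'a. mem H x \<longleftrightarrow> (\<exists>i. x = h i)"
      by (rule enumeration[of "mem H", OF rec_H inf]) (rule that)
    have "mem H (h i)" for i using h(3) by blast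
    note apart = apart[OF this this h(2)]
    have "recp (\<lambda>e. lam (h (e 0)) (e (Suc 0)))" "recp (\<lambda>e. mu (h (e 0)) (e (Suc 0)))"
      by (intro recp_lam recp_mu recf_app1[OF h(1)] recf_var)+
    note * = rec_choice[OF this(1)] rec_choice[OF this(2)]
    obtain u where u: "recf (\<lambda>e. u (e 0))" "\<And>i a. lam (h i) a \<longleftrightarrow> a = u i"
      by (rule *(1)) (use apart lam_unique in metis)+
    obtain v where v: "recf (\<lambda>e. v (e 0))" "\<And>i b. mu (h i) b \<longleftrightarrow> b = v i"
      by (rule *(2)) (use apart mu_unique in metis)+
    \<comment> \<open>The exponents interlace, \<open>u i \<le> v i < u (i + 1)\<close>, and so both
      sequences increase strictly.\<close>
    have vu: "v i < u (i + 1)" for i using apart[of i] unfolding u(2) v(2) by blast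
    have uv: "u i \<le> v i" for i using lam_le_mu u(2) v(2) by blast
    have u_mono: "u i < u (i + 1)" for i using uv vu by (rule le_less_trans)
    have v_mono: "v i < v (i + 1)" for i using vu uv by (rule less_le_trans)

    have "recf (\<lambda>e. e (Suc 0) + h (e 0))" by (intro rec_intros recf_app1[OF h(1)])
    moreover have "x \<le> x + h n" for x n using zero_le[of "h n"] by (simp only: to_diff; linarith)
    ultimately obtain s where s: "recf (\<lambda>e. s (e 0))" "s 0 = 0" "\<And>n. s (n + 1) = s n + h n"
      by (rule monotone_recursion[of "\<lambda>n x. x + h n" 0]) (rule that)
    have sum: "\<exists>z. c = f z \<and> lam z (u i) \<and> mu z (v j)" if "i \<le> j" for i j
    proof -
      obtain z where z: "s (j + 1) = s i + z" "lam z (u i)" "mu z (v j)"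
        using adjacent_sums[OF h(1) s(1) u(1) v(1), of j i] u(2) v(2) vu s(3) \<open>i \<le> j\<close> by blast
      have "holds (case_nat z (case_nat c e)) (case_nat H R) (AS 0 (Var 0))"
        using strict_mono_ge(2)[OF h(1,2)] h(3) s(2,3) \<open>i \<le> j\<close> z(1)
        by (intro holds_AS[OF h(1) s(1)]) simp_all
      then show ?thesis using c z by blast
    qed
    \<comment> \<open>\<open>AHT_k\<close> does not bound its colour; \<open>c\<close> is below
      \<open>k\<close> because it is the colour of some sum.\<close>
    have "c < val e k" using sum[OF order_refl] f_less by blast
    moreover have "mem F (pair (pair (u i) (v j)) c)" if "u i < v j" for i j
    proof -
      \<comment> \<open>The only use of \<open>u i < v j\<close> besides the colour of the pair: for
        \<open>j < i\<close> the interlacing gives \<open>v j < u (j + 1) \<le> u i\<close>. Hence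
        each increasing pair comes from an actual sum of adjacent elements.\<close>
      have "i \<le> j"
      proof (rule ccontr)
        assume "\<not> i \<le> j"
        then have "v j < v i \<and> j + 1 \<le> i" using strict_mono_ge(2)[OF v(1) v_mono] unfolding not_le discrete by blast
        then have "u (j + 1) \<le> u i"
          using strict_mono_ge(2)[OF u(1) u_mono, of "j + 1" i] unfolding le_iff_less_or_eq by blast
        then show False using vu[of j] that by (meson le_less_trans less_irrefl less_le_trans less_trans)
      qed
      then show ?thesis using sum f_color that by blast
    qed
    moreover obtain X where "\<And>a. mem X a \<longleftrightarrow> (\<exists>i. a = u i)" "\<And>x :: 'a. \<exists>y>x. mem X y"
      by (rule strict_mono_range[OF u(1) u_mono]) (rule that)
    moreover obtain Y where "\<And>a. mem Y a \<longleftrightarrow> (\<exists>i. a = v i)" "\<And>x :: 'a. \<exists>y>x. mem Y y"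
      by (rule strict_mono_range[OF v(1) v_mono]) (rule that)
    ultimately show ?thesis by (intro exI[of _ X] exI[of _ Y] exI[of _ c]) auto
  qed
  note main = this
  show ?thesis
    unfolding IPT2_k_def sat.simps(7)
  proof
    fix F
    let ?S = "case_nat F S"
    show "holds e ?S (Pair_map_into 0 k \<^bold>\<longrightarrow> ExS (ExS (Infinite 1 \<^bold>\<and> Infinite 0 \<^bold>\<and>
        ExN (Var 0 \<^bold>< up k \<^bold>\<and> AllN (AllN (Var 1 \<^bold>\<in> 1 \<^bold>\<and> Var 0 \<^bold>\<in> 0 \<^bold>\<and> Var 1 \<^bold>< Var 0 \<^bold>\<longrightarrow>
            App 2 (pr (Var 1) (Var 0)) (Var 2)))))))"
      unfolding sat.simps(5)[of _ _ _ _ _ _ _ _ "Pair_map_into 0 k"]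
    proof
      assume "holds e ?S (Pair_map_into 0 k)"
      from main[OF this] obtain X Y c where XY: "\<forall>x :: 'a. \<exists>y>x. mem X y" "\<forall>x :: 'a. \<exists>y>x. mem Y y"
        "c < val e k" "\<forall>x y. mem X x \<and> mem Y y \<and> x < y \<longrightarrow> mem F (pair (pair x y) c)" by blast
      show "holds e ?S (ExS (ExS (Infinite 1 \<^bold>\<and> Infinite 0 \<^bold>\<and>
        ExN (Var 0 \<^bold>< up k \<^bold>\<and> AllN (AllN (Var 1 \<^bold>\<in> 1 \<^bold>\<and> Var 0 \<^bold>\<in> 0 \<^bold>\<and> Var 1 \<^bold>< Var 0 \<^bold>\<longrightarrow>
            App 2 (pr (Var 1) (Var 0)) (Var 2)))))))"
        unfolding sat_ExS sat_ExN sat_And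
      proof (intro exI conjI)
        show "holds e (case_nat Y (case_nat X ?S)) (Infinite 1)" "holds e (case_nat Y (case_nat X ?S)) (Infinite 0)"
          unfolding holds_Infinite using XY by simp_all
        show "holds (case_nat c e) (case_nat Y (case_nat X ?S)) (Var 0 \<^bold>< up k)" using XY by simp
        show "holds (case_nat c e) (case_nat Y (case_nat X ?S))
            (AllN (AllN (Var 1 \<^bold>\<in> 1 \<^bold>\<and> Var 0 \<^bold>\<in> 0 \<^bold>\<and> Var 1 \<^bold>< Var 0 \<^bold>\<longrightarrow>
              App 2 (pr (Var 1) (Var 0)) (Var 2))))"
          using XY by (simp add: App_def)
      qed
    qed
  qed
qed

theorem proposition3:
  "(RCA0 \<turnstile> AllN (AHT_k (Var 0) \<^bold>\<longrightarrow> IPT2_k (Var 0))) \<and> (RCA0 \<turnstile> (AHT \<^bold>\<longrightarrow> IPT2))"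
proof -
  have "holds e S p" if "p \<in> goals" for p S and e :: "nat \<Rightarrow> number"
  proof -
    have "holds e S (AHT_k k) \<longrightarrow> holds e S (IPT2_k k)" for e :: "nat \<Rightarrow> number" and k
      by (intro impI holds_AHT_k_imp_IPT2_k)
    then have "holds e S (AllN (AHT_k (Var 0) \<^bold>\<longrightarrow> IPT2_k (Var 0)))" "holds e S (AHT \<^bold>\<longrightarrow> IPT2)"
      unfolding AHT_def IPT2_def by simp_all
    then show ?thesis using that unfolding goals_def by blast
  qed
  then show ?thesis using RCA0_proves_goals unfolding goals_def by blast
qed

end
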